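(* Let $L \geq 1$, and let $\theta$ be a concave, nondecreasing and strictly sublinear function with $\theta\ge 1$. Let $X$ and $Y$ be proper geodesic metric spaces with basepoints, and let $\Phi \colon X \to Y$ be an $(L,\theta)$-sublinear biLipschitz equivalence between $X$ and $Y$. Then, for every concave, nondecreasing and strictly sublinear function $\kappa\ge 1$ that dominates $\theta$, there is a homeomorphism $\Phi_\star \colon \partial_\kappa X \to \partial_\kappa Y$ between the $\kappa$-Morse boundaries, induced by $\Phi$.
   Context: Sublinear functions: $\kappa,\theta\colon[0,\infty)\to[1,\infty)$ are concave and nondecreasing; $\kappa$ is strictly sublinear if $\kappa(r)/r\to 0$ as $r\to\infty$. We say $\kappa$ dominates $\theta$ if there are constants $C_1>0$, $C_2$ and $t_0\ge 0$ with $\kappa(t)\geq C_1\theta(t)+C_2$ for all $t>t_0$. Basepoints of both spaces are denoted $\mathfrak o$; $\Vert x\Vert=d(x,\mathfrak o)$ and $\kappa(x):=\kappa(\Vert x\Vert)$. For a subset $Z$ and $D>0$, $\mathcal N_\kappa(Z,D)=\{x: d(x,Z)\le D\,\kappa(x)\}$. For $D>0,r>0$, write $D\ll_\kappa r$ if $D\le r/(2\kappa(r))$. $(L,\theta)$-sublinear biLipschitz equivalence (SBE): a map $\Phi\colon X\to Y$ such that for all $x_1,x_2\in X$, $$\tfrac1L d(x_1,x_2)-\theta(\max(\Vert x_1\Vert,\Vert x_2\Vert))\le d(\Phi(x_1),\Phi(x_2))\le L d(x_1,x_2)+\theta(\max(\Vert x_1\Vert,\Vert x_2\Vert)),$$ and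 $Y=\mathcal N_\theta(\Phi(X),D)$ for some $D\ge0$. Quasi-geodesic rays: a $(\mathsf q,\mathsf Q)$-quasi-geodesic ray is a map $\gamma\colon[0,\infty)\to X$ with $\frac1{\mathsf q}|s-t|-\mathsf Q\le d(\gamma(s),\gamma(t))\le\mathsf q|s-t|+\mathsf Q$ for all $s,t$; quasi-geodesic rays are taken continuous and with $\gamma(0)=\mathfrak o$. For such $\beta$ and $r>0$, let $t_r$ be the first time with $\Vert\beta(t_r)\Vert=r$; put $\beta_r=\beta(t_r)$ and $\beta|_r=\beta([0,t_r])$. A ray is identified with its image when regarded as a subset. $\kappa$-Morse: a subset $Z\subseteq X$ is $\kappa$-Morse with Morse gauge $m_Z\colon\mathbb R^2\to\mathbb R$ (a proper function) if for every sublinear function $\kappa'$ and all $r>0,n>0$ there is $R=R(Z,r,n,\kappa')>0$ such that for every $(\mathsf q,\mathsf Q)$-quasi-geodesic ray $\beta$ with $m_Z(\mathsf q,\mathsf Q)\ll_\kappa r$: $d(\beta_R,Z)\le n\,\kappa'(R)$ implies $\beta|_r\subset\mathcal N_\kappa(Z,m_Z(\mathsf q,\mathsf Q))$. $Z$ is $\kappa$-Morse if it has such a gauge. Equivalence: for rays $\alpha,\beta$, $\alpha\sim\beta$ if $\lim_{t\to\infty}d(\alpha(t),\beta)/t=0$ or $\lim_{t\to\infty}d(\beta(t),\alpha)/t=0$. $\kappa$-Morse boundary: $\partial_\kappa X$ is the set of $\sim$-classes of $\kappa$-Morse quasi-geodesic rays. For a $\kappa$-Morse quasi-geodesic ray $\beta$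 with gauge $m_\beta$ and $r>0$, $\partial\mathcal U(\beta,r)$ is the set of classes $\mathbf a\in\partial_\kappa X$ such that every $(\mathsf q,\mathsf Q)$-quasi-geodesic ray $\alpha\in\mathbf a$ with $m_\beta(\mathsf q,\mathsf Q)\ll_\kappa r$ satisfies $\alpha|_r\subseteq\mathcal N_\kappa(\beta,m_\beta(\mathsf q,\mathsf Q))$. The topology on $\partial_\kappa X$ is the unique one for which the neighbourhoods of $\mathbf b$ are the sets $\mathcal V\subseteq\partial_\kappa X$ containing $\partial\mathcal U(\beta,r)$ for some $\beta\in\mathbf b$ and $r>0$. Induced by $\Phi$: for every $\kappa$-Morse quasi-geodesic ray $\zeta$ in $X$, $\Phi_\star([\zeta])$ is the class in $\partial_\kappa Y$ of a $\kappa$-Morse geodesic ray $\eta$ in $Y$ such that $\Phi\circ\zeta\subset\mathcal N_\kappa(\eta,m)$ for some $m>0$ (such an $\eta$ is unique up to $\sim$). *)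

theory Defs
  imports "HOL-Analysis.Analysis"
begin

definition geodesic_segment :: "(real \<Rightarrow> 'a::metric_space) \<Rightarrow> 'a \<Rightarrow> 'a \<Rightarrow> bool" where
  "geodesic_segment g x y \<longleftrightarrow>
     g 0 = x \<and> g (dist x y) = y \<and>
     (\<forall>s\<in>{0..dist x y}. \<forall>t\<in>{0..dist x y}. dist (g s) (g t) = \<bar>s - t\<bar>)"

definition proper_geodesic_space :: "'a::metric_space itself \<Rightarrow> bool" where
  "proper_geodesic_space TYPE('a) \<longleftrightarrow>
     (\<forall>(x::'a) r. compact (cball x r)) \<and>
     (\<forall>(x::'a) y. \<exists>g. geodesic_segment g x y)"

(* Functions on [0,oo) are rendered as functions on all reals that are only
   inspected on {0..}; this applies to rays as well. *)

definition sublinear :: "(real \<Rightarrow> real) \<Rightarrow> bool" where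
  "sublinear \<kappa> \<longleftrightarrow> concave_on {0..} \<kappa> \<and> mono_on {0..} \<kappa> \<and> (\<forall>t\<ge>0. 1 \<le> \<kappa> t)"

definition strictly_sublinear :: "(real \<Rightarrow> real) \<Rightarrow> bool" where
  "strictly_sublinear \<kappa> \<longleftrightarrow> sublinear \<kappa> \<and> ((\<lambda>r. \<kappa> r / r) \<longlongrightarrow> 0) at_top"

definition dominates :: "(real \<Rightarrow> real) \<Rightarrow> (real \<Rightarrow> real) \<Rightarrow> bool" where
  "dominates \<kappa> \<theta> \<longleftrightarrow>
     (\<exists>C\<^sub>1 C\<^sub>2 t\<^sub>0. C\<^sub>1 > 0 \<and> t\<^sub>0 \<ge> 0 \<and> (\<forall>t>t\<^sub>0. \<kappa> t \<ge> C\<^sub>1 * \<theta> t + C\<^sub>2))"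

definition small_wrt :: "(real \<Rightarrow> real) \<Rightarrow> real \<Rightarrow> real \<Rightarrow> bool" where
  "small_wrt \<kappa> D r \<longleftrightarrow> D \<le> r / (2 * \<kappa> r)"

(* Throughout, p is the basepoint. The set Z is always nonempty below, so the
   convention infdist x {} = 0 plays no role. *)

definition nbhd :: "'a::metric_space \<Rightarrow> (real \<Rightarrow> real) \<Rightarrow> 'a set \<Rightarrow> real \<Rightarrow> 'a set" where
  "nbhd p \<kappa> Z D = {x. infdist x Z \<le> D * \<kappa> (dist x p)}"

definition sublinear_biLipschitz_equivalence ::
  "'a::metric_space \<Rightarrow> 'b::metric_space \<Rightarrow> real \<Rightarrow> (real \<Rightarrow> real) \<Rightarrow> ('a \<Rightarrow> 'b) \<Rightarrow> bool" where
  "sublinear_biLipschitz_equivalence p q L \<theta> \<Phi> \<longleftrightarrow>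
     (\<forall>x\<^sub>1 x\<^sub>2.
        1 / L * dist x\<^sub>1 x\<^sub>2 - \<theta> (max (dist x\<^sub>1 p) (dist x\<^sub>2 p)) \<le> dist (\<Phi> x\<^sub>1) (\<Phi> x\<^sub>2) \<and>
        dist (\<Phi> x\<^sub>1) (\<Phi> x\<^sub>2) \<le> L * dist x\<^sub>1 x\<^sub>2 + \<theta> (max (dist x\<^sub>1 p) (dist x\<^sub>2 p))) \<and>
     (\<exists>D\<ge>0. nbhd q \<theta> (range \<Phi>) D = UNIV)"

(* The range q \<ge> 1, Q \<ge> 0 is forced by the inequalities, except that x / 0 = 0
   would otherwise admit q = 0. *)

definition quasi_geodesic_ray ::
  "'a::metric_space \<Rightarrow> real \<Rightarrow> real \<Rightarrow> (real \<Rightarrow> 'a) \<Rightarrow> bool" where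
  "quasi_geodesic_ray p q Q \<gamma> \<longleftrightarrow>
     q \<ge> 1 \<and> Q \<ge> 0 \<and> continuous_on {0..} \<gamma> \<and> \<gamma> 0 = p \<and>
     (\<forall>s\<ge>0. \<forall>t\<ge>0. 1 / q * \<bar>s - t\<bar> - Q \<le> dist (\<gamma> s) (\<gamma> t) \<and>
                    dist (\<gamma> s) (\<gamma> t) \<le> q * \<bar>s - t\<bar> + Q)"

definition geodesic_ray :: "'a::metric_space \<Rightarrow> (real \<Rightarrow> 'a) \<Rightarrow> bool" where
  "geodesic_ray p \<gamma> \<longleftrightarrow> \<gamma> 0 = p \<and> (\<forall>s\<ge>0. \<forall>t\<ge>0. dist (\<gamma> s) (\<gamma> t) = \<bar>s - t\<bar>)"

definition ray_image :: "(real \<Rightarrow> 'a) \<Rightarrow> 'a set" where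
  "ray_image \<gamma> = \<gamma> ` {0..}"

definition hit_time :: "'a::metric_space \<Rightarrow> (real \<Rightarrow> 'a) \<Rightarrow> real \<Rightarrow> real" where
  "hit_time p \<beta> r = (LEAST t. 0 \<le> t \<and> dist (\<beta> t) p = r)"

definition ray_point :: "'a::metric_space \<Rightarrow> (real \<Rightarrow> 'a) \<Rightarrow> real \<Rightarrow> 'a" where
  "ray_point p \<beta> r = \<beta> (hit_time p \<beta> r)"

definition ray_upto :: "'a::metric_space \<Rightarrow> (real \<Rightarrow> 'a) \<Rightarrow> real \<Rightarrow> 'a set" where
  "ray_upto p \<beta> r = \<beta> ` {0..hit_time p \<beta> r}"

definition proper_function :: "(real \<times> real \<Rightarrow> real) \<Rightarrow> bool" where
  "proper_function m \<longleftrightarrow> (\<forall>K. compact K \<longrightarrow> compact (m -` K))"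

(* The smallness relation and the neighbourhoods are meant for a positive constant D only,
   whence the positivity of the gauge on the relevant range of quasi-geodesic constants. *)

definition morse_gauge ::
  "'a::metric_space \<Rightarrow> (real \<Rightarrow> real) \<Rightarrow> (real \<times> real \<Rightarrow> real) \<Rightarrow> 'a set \<Rightarrow> bool" where
  "morse_gauge p \<kappa> m Z \<longleftrightarrow>
     proper_function m \<and> (\<forall>q\<ge>1. \<forall>Q\<ge>0. m (q, Q) > 0) \<and>
     (\<forall>\<kappa>' r n. strictly_sublinear \<kappa>' \<and> r > 0 \<and> n > 0 \<longrightarrow>
        (\<exists>R>0. \<forall>q Q \<beta>.
           quasi_geodesic_ray p q Q \<beta> \<and> small_wrt \<kappa> (m (q, Q)) r \<longrightarrow>
           infdist (ray_point p \<beta> R) Z \<le> n * \<kappa>' R \<longrightarrow>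
           ray_upto p \<beta> r \<subseteq> nbhd p \<kappa> Z (m (q, Q))))"

definition morse_set :: "'a::metric_space \<Rightarrow> (real \<Rightarrow> real) \<Rightarrow> 'a set \<Rightarrow> bool" where
  "morse_set p \<kappa> Z \<longleftrightarrow> (\<exists>m. morse_gauge p \<kappa> m Z)"

definition morse_rays :: "'a::metric_space \<Rightarrow> (real \<Rightarrow> real) \<Rightarrow> (real \<Rightarrow> 'a) set" where
  "morse_rays p \<kappa> = {\<gamma>. (\<exists>q Q. quasi_geodesic_ray p q Q \<gamma>) \<and> morse_set p \<kappa> (ray_image \<gamma>)}"

definition ray_equiv :: "(real \<Rightarrow> 'a::metric_space) \<Rightarrow> (real \<Rightarrow> 'a) \<Rightarrow> bool" where
  "ray_equiv \<alpha> \<beta> \<longleftrightarrow>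
     ((\<lambda>t. infdist (\<alpha> t) (ray_image \<beta>) / t) \<longlongrightarrow> 0) at_top \<or>
     ((\<lambda>t. infdist (\<beta> t) (ray_image \<alpha>) / t) \<longlongrightarrow> 0) at_top"

definition ray_rel ::
  "'a::metric_space \<Rightarrow> (real \<Rightarrow> real) \<Rightarrow> ((real \<Rightarrow> 'a) \<times> (real \<Rightarrow> 'a)) set" where
  "ray_rel p \<kappa> = {(\<alpha>, \<beta>). \<alpha> \<in> morse_rays p \<kappa> \<and> \<beta> \<in> morse_rays p \<kappa> \<and> ray_equiv \<alpha> \<beta>}"

definition ray_class ::
  "'a::metric_space \<Rightarrow> (real \<Rightarrow> real) \<Rightarrow> (real \<Rightarrow> 'a) \<Rightarrow> (real \<Rightarrow> 'a) set" where
  "ray_class p \<kappa> \<gamma> = ray_rel p \<kappa> `` {\<gamma>}"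

definition morse_boundary ::
  "'a::metric_space \<Rightarrow> (real \<Rightarrow> real) \<Rightarrow> (real \<Rightarrow> 'a) set set" where
  "morse_boundary p \<kappa> = morse_rays p \<kappa> // ray_rel p \<kappa>"

definition boundary_nbhd ::
  "'a::metric_space \<Rightarrow> (real \<Rightarrow> real) \<Rightarrow> (real \<times> real \<Rightarrow> real) \<Rightarrow> (real \<Rightarrow> 'a) \<Rightarrow> real
     \<Rightarrow> (real \<Rightarrow> 'a) set set" where
  "boundary_nbhd p \<kappa> m \<beta> r =
     {A \<in> morse_boundary p \<kappa>. \<forall>\<alpha>\<in>A. \<forall>q Q.
        quasi_geodesic_ray p q Q \<alpha> \<and> small_wrt \<kappa> (m (q, Q)) r \<longrightarrow>
        ray_upto p \<alpha> r \<subseteq> nbhd p \<kappa> (ray_image \<beta>) (m (q, Q))}"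

(* V is a neighbourhood of the class B; any Morse gauge m of the representative may be used. *)

definition is_boundary_nbhd ::
  "'a::metric_space \<Rightarrow> (real \<Rightarrow> real) \<Rightarrow> (real \<Rightarrow> 'a) set \<Rightarrow> (real \<Rightarrow> 'a) set set \<Rightarrow> bool" where
  "is_boundary_nbhd p \<kappa> B V \<longleftrightarrow>
     V \<subseteq> morse_boundary p \<kappa> \<and>
     (\<exists>\<beta>\<in>B. \<exists>m r. morse_gauge p \<kappa> m (ray_image \<beta>) \<and> r > 0 \<and> boundary_nbhd p \<kappa> m \<beta> r \<subseteq> V)"

definition is_boundary_topology ::
  "'a::metric_space \<Rightarrow> (real \<Rightarrow> real) \<Rightarrow> (real \<Rightarrow> 'a) set topology \<Rightarrow> bool" where
  "is_boundary_topology p \<kappa> T \<longleftrightarrow>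
     topspace T = morse_boundary p \<kappa> \<and>
     (\<forall>B\<in>morse_boundary p \<kappa>. \<forall>V\<subseteq>morse_boundary p \<kappa>.
        (\<exists>W. openin T W \<and> B \<in> W \<and> W \<subseteq> V) \<longleftrightarrow> is_boundary_nbhd p \<kappa> B V)"

definition boundary_topology ::
  "'a::metric_space \<Rightarrow> (real \<Rightarrow> real) \<Rightarrow> (real \<Rightarrow> 'a) set topology" where
  "boundary_topology p \<kappa> = (THE T. is_boundary_topology p \<kappa> T)"

definition induced_by ::
  "'a::metric_space \<Rightarrow> 'b::metric_space \<Rightarrow> (real \<Rightarrow> real) \<Rightarrow> ('a \<Rightarrow> 'b)
     \<Rightarrow> ((real \<Rightarrow> 'a) set \<Rightarrow> (real \<Rightarrow> 'b) set) \<Rightarrow> bool" where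
  "induced_by p q \<kappa> \<Phi> F \<longleftrightarrow>
     (\<forall>\<zeta>\<in>morse_rays p \<kappa>. \<exists>\<eta>\<in>morse_rays q \<kappa>.
        geodesic_ray q \<eta> \<and>
        (\<exists>m>0. (\<Phi> \<circ> \<zeta>) ` {0..} \<subseteq> nbhd q \<kappa> (ray_image \<eta>) m) \<and>
        F (ray_class p \<kappa> \<zeta>) = ray_class q \<kappa> \<eta>)"

end

theory Submission
  imports Defs
begin

text \<open>A \<open>\<kappa>\<close>-ray is a coarse ray with multiplicative constant \<open>A\<close> and additive error \<open>A * \<kappa> t\<close> at time
  \<open>t\<close> (predicate \<open>scale_ray\<close>). This notion, unlike that of a quasi-geodesic ray, is preserved by
  sublinear bi-Lipschitz equivalences. The key point is that every \<open>\<kappa>\<close>-ray is within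
  \<open>O(\<kappa>)\<close> of an honest quasi-geodesic ray whose constants depend on \<open>A\<close> only: first interpolate
  it by a Lipschitz path \<open>v\<close>, then repeatedly jump along a geodesic from \<open>v a\<close> to the last \<open>v b\<close> with
  \<open>W * (dist (v a) (v b) - 1) \<le> b - a - 1\<close>. Since no longer jump is possible, the resulting path is
  quasi-geodesic with multiplicative constant \<open>W\<close>; since \<open>v\<close> is itself coarsely bi-Lipschitz, all
  jumps have length \<open>O(\<kappa>)\<close>. The same surgery joins a ray to a second ray that comes linearly close
  to it, with uniform constants.

  Hence a quasi-geodesic ray with image \<open>Z\<close> is \<open>\<kappa>\<close>-Morse iff every \<open>\<kappa>\<close>-ray that at a late time \<open>t\<close> is at
  distance at most \<open>\<epsilon> * t\<close> from \<open>Z\<close> stays within \<open>M * \<kappa> s\<close> of \<open>Z\<close> for all times \<open>s \<le> \<delta> * t\<close>, with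
  \<open>\<epsilon>\<close>, \<open>\<delta>\<close>, \<open>M\<close> depending only on \<open>A\<close> (predicate \<open>robustly_morse\<close>). In the same way, a class is close to
  that of \<open>\<beta>\<close> iff all \<open>\<kappa>\<close>-rays with constant \<open>A\<close> in the class are at distance at most \<open>\<epsilon> * t\<close> from \<open>\<beta>\<close> at
  some time \<open>t \<ge> R\<close> (\<open>tracking_nbhd\<close>). Both descriptions are visibly invariant under \<open>\<Phi>\<close> and a
  coarse inverse of it.\<close>

section \<open>Sublinear scales and piecewise geodesic paths\<close>

text \<open>The obstacle is that the definitions of Morse sets and of \<open>boundary_nbhd\<close>
  test honest quasi-geodesic rays only, while \<open>\<Phi>\<close> sends such a ray to a possibly
  discontinuous path whose error grows with the norm, so neither definition can be transported
  directly. Straightening helps because its quasi-geodesic constants do not depend on the size of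
  the additive error; only the distance to the original path does. Two features of the definitions
  make the detour lossless. The radius \<open>R\<close> may depend on the factor \<open>n\<close>,
  so a ray that is close to \<open>Z\<close> with some unknown constant is automatically close with
  the constant prescribed by the gauge. And a gauge is proper, so at a given radius
  \<open>small_wrt\<close> admits only a bounded range of quasi-geodesic constants, for which
  uniform choices exist. Sublinearity mostly enters as follows: a term \<open>C * \<kappa> t\<close>
  is at most \<open>t / 2\<close> plus a constant, hence can be absorbed in an inequality that
  bounds \<open>t\<close>, and it is below \<open>\<epsilon> * t\<close> at late times. Linear
  closeness therefore survives all maps involved.\<close>

locale sublinear_scale =
  fixes \<kappa> :: "real \<Rightarrow> real"
  assumes strict: "strictly_sublinear \<kappa>"
begin

lemma scale_ge_1: "0 \<le> t \<Longrightarrow> 1 \<le> \<kappa> t"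
  using strict by (simp add: strictly_sublinear_def sublinear_def)

lemma scale_pos: "0 \<le> t \<Longrightarrow> 0 < \<kappa> t"
  using scale_ge_1[of t] by linarith

lemma scale_mono: "0 \<le> s \<Longrightarrow> s \<le> t \<Longrightarrow> \<kappa> s \<le> \<kappa> t"
  using strict by (auto simp: strictly_sublinear_def sublinear_def mono_on_def)

text \<open>The point \<open>s\<close> lies on the segment from 0 to \<open>c * s\<close> with
  weight \<open>1/c\<close>; concavity there, after dropping the nonnegative term at 0, is the
  claim.\<close>

lemma scale_times:
  assumes "1 \<le> c" "0 \<le> s"
  shows "\<kappa> (c * s) \<le> c * \<kappa> s"
proof -
  have conc: "concave_on {0..} \<kappa>"
    using strict by (simp add: strictly_sublinear_def sublinear_def)
  have c: "0 < c" "c \<noteq> 0" using assms by auto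
  have "(1 - 1/c) * \<kappa> 0 + (1/c) * \<kappa> (c * s) \<le> \<kappa> ((1 - 1/c) *\<^sub>R 0 + (1/c) *\<^sub>R (c * s))"
    using concave_onD[OF conc, of "1/c" 0 "c * s"] assms by (simp add: divide_simps)
  moreover have "(1 - 1/c) *\<^sub>R 0 + (1/c) *\<^sub>R (c * s) = s" using c by simp
  moreover have "0 \<le> (1 - 1/c) * \<kappa> 0" using assms scale_ge_1[of 0] by simp
  ultimately have "(1/c) * \<kappa> (c * s) \<le> \<kappa> s" by (metis add_le_cancel_right add_0 order_trans)
  then show ?thesis using c by (simp add: field_simps)
qed

text \<open>Time, norm and nearest-point parameters of rays agree only up to affine distortion. This
  makes \<open>\<kappa>\<close> blind to such a change, so that it may be evaluated at whichever of
  them is convenient.\<close>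

lemma scale_affine:
  assumes "0 \<le> c"
  obtains C where "1 \<le> C" "\<And>s t. 0 \<le> s \<Longrightarrow> 0 \<le> t \<Longrightarrow> t \<le> c * s + c \<Longrightarrow> \<kappa> t \<le> C * \<kappa> s"
proof
  define c' where "c' = max 1 (2 * c)"
  show "1 \<le> c' * \<kappa> 1" using scale_ge_1[of 1] mult_mono[of 1 c' 1 "\<kappa> 1"] by (simp add: c'_def)
  fix s t :: real assume st: "0 \<le> s" "0 \<le> t" "t \<le> c * s + c"
  have c': "1 \<le> c'" "2 * c \<le> c'" by (auto simp: c'_def)
  \<comment> \<open>Passing to \<open>max s 1\<close> turns the affine bound into a purely
    multiplicative one, at the price of the factor \<open>\<kappa> 1\<close>.\<close>
  have "t \<le> 2 * c * max s 1"
    using st assms mult_left_mono[of s "max s 1" c] mult_left_mono[of 1 "max s 1" c] by simp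
  also have "\<dots> \<le> c' * max s 1" using c' by (intro mult_right_mono) auto
  finally have "\<kappa> t \<le> \<kappa> (c' * max s 1)" using st by (intro scale_mono) auto
  also have "\<dots> \<le> c' * \<kappa> (max s 1)" using c' by (intro scale_times) auto
  also have "\<kappa> (max s 1) \<le> \<kappa> 1 * \<kappa> s"
  proof (cases "s \<le> 1")
    case True
    then show ?thesis using scale_ge_1[of s] scale_ge_1[of 1] st mult_left_mono[of 1 "\<kappa> s" "\<kappa> 1"] by (simp add: max_def)
  next
    case False
    then show ?thesis using scale_ge_1[of s] scale_ge_1[of 1] mult_right_mono[of 1 "\<kappa> 1" "\<kappa> s"] by (simp add: max_def)
  qed
  then have "c' * \<kappa> (max s 1) \<le> c' * (\<kappa> 1 * \<kappa> s)" using c' by (intro mult_left_mono) auto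
  finally show "\<kappa> t \<le> c' * \<kappa> 1 * \<kappa> s" by (simp add: mult.assoc)
qed

text \<open>With a slope such as \<open>1 / (2 * A)\<close>, the term \<open>A * \<kappa> s\<close>
  is at most \<open>s / 2\<close> plus a constant and can be absorbed; in this form sublinearity
  bounds a time by a norm.\<close>

lemma scale_small:
  assumes "0 < \<epsilon>"
  obtains C where "0 \<le> C" "\<And>s. 0 \<le> s \<Longrightarrow> \<kappa> s \<le> \<epsilon> * s + C"
proof -
  have "((\<lambda>r. \<kappa> r / r) \<longlongrightarrow> 0) at_top" using strict by (simp add: strictly_sublinear_def)
  then have "eventually (\<lambda>r. \<kappa> r / r < \<epsilon>) at_top" using assms by (auto dest: order_tendstoD)
  then obtain N where N: "\<And>r. N \<le> r \<Longrightarrow> \<kappa> r / r < \<epsilon>" by (auto simp: eventually_at_top_linorder)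
  define N' where "N' = max N 1"
  have N'_ge: "0 \<le> N'" by (simp add: N'_def)
  show ?thesis
  proof
    show "0 \<le> \<kappa> N'" using scale_ge_1[of N'] N'_ge by linarith
    fix s :: real assume s: "0 \<le> s"
    show "\<kappa> s \<le> \<epsilon> * s + \<kappa> N'"
    proof (cases "s \<le> N'")
      case True
      then have "\<kappa> s \<le> \<kappa> N'" using s by (intro scale_mono) auto
      moreover have "0 \<le> \<epsilon> * s" using s assms by simp
      ultimately show ?thesis by linarith
    next
      case False
      then have "\<kappa> s < \<epsilon> * s" using N[of s] by (simp add: N'_def field_simps)
      moreover have "0 \<le> \<kappa> N'" using scale_ge_1[of N'] N'_ge by linarith
      ultimately show ?thesis by linarith
    qed
  qed
qed

lemma scale_eventually_le:
  assumes "0 < \<epsilon>"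
  obtains T where "1 \<le> T" "\<And>t. T \<le> t \<Longrightarrow> C * \<kappa> t + D \<le> \<epsilon> * t"
proof -
  define C' where "C' = max C 1"
  have C': "1 \<le> C'" "C \<le> C'" by (auto simp: C'_def)
  obtain K where K: "0 \<le> K" "\<And>s. 0 \<le> s \<Longrightarrow> \<kappa> s \<le> (\<epsilon> / (2 * C')) * s + K"
    using scale_small[of "\<epsilon> / (2 * C')"] C' assms by auto
  show ?thesis
  proof
    show "1 \<le> max 1 (2 * (C' * K + D) / \<epsilon>)" by simp
    fix t assume t: "max 1 (2 * (C' * K + D) / \<epsilon>) \<le> t"
    then have 1: "2 * (C' * K + D) \<le> \<epsilon> * t" using assms by (simp add: field_simps)
    have 2: "C * \<kappa> t \<le> C' * \<kappa> t" using C' t scale_pos[of t] by (intro mult_right_mono) auto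
    have "C' * \<kappa> t \<le> C' * ((\<epsilon> / (2 * C')) * t + K)" using K(2)[of t] C' t by (intro mult_left_mono) auto
    moreover have "C' * ((\<epsilon> / (2 * C')) * t + K) = \<epsilon> * t / 2 + C' * K" using C' by (simp add: field_simps)
    ultimately have 3: "C' * \<kappa> t \<le> \<epsilon> * t / 2 + C' * K" by metis
    have "y + D \<le> e" if "2 * (x + D) \<le> e" "y \<le> z" "z \<le> e / 2 + x" for x y z e :: real
      using that by argo
    from this[OF 1 2] show "C * \<kappa> t + D \<le> \<epsilon> * t" using 3 by blast
  qed
qed

end

text \<open>Every fixed gauge value satisfies \<open>small_wrt\<close> at all large radii, so Morse
  and neighbourhood conditions apply to a given ray once the radius is large.\<close>

lemma strictly_sublinear_ratio_at_top:
  assumes "strictly_sublinear \<kappa>"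
  shows "filterlim (\<lambda>r. r / (2 * \<kappa> r)) at_top at_top"
proof -
  interpret sublinear_scale \<kappa> using assms by unfold_locales
  show ?thesis unfolding filterlim_at_top
  proof
    fix Z :: real
    obtain T where T: "1 \<le> T" "\<And>t. T \<le> t \<Longrightarrow> (2 * \<bar>Z\<bar>) * \<kappa> t + 0 \<le> 1 * t"
      using scale_eventually_le[of 1 "2 * \<bar>Z\<bar>" 0] by auto
    have "Z \<le> t / (2 * \<kappa> t)" if "T \<le> t" for t
    proof -
      have k: "0 < \<kappa> t" using that T scale_pos[of t] by auto
      have "\<bar>Z\<bar> \<le> t / (2 * \<kappa> t)" using T(2)[OF that] k by (simp add: field_simps)
      then show ?thesis by linarith
    qed
    then show "eventually (\<lambda>x. Z \<le> x / (2 * \<kappa> x)) at_top" by (auto simp: eventually_at_top_linorder)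
  qed
qed

text \<open>Gaps of at least 1 rule out accumulation of the breakpoints.\<close>

lemma locate_in_partition:
  fixes \<tau> :: "nat \<Rightarrow> real"
  assumes "\<tau> 0 = 0" "\<And>k. \<tau> k + 1 \<le> \<tau> (Suc k)" "0 \<le> s"
  obtains k where "\<tau> k \<le> s" "s < \<tau> (Suc k)"
proof -
  have ge: "real k \<le> \<tau> k" for k
  proof (induction k)
    case (Suc k) then show ?case using assms(2)[of k] by simp
  qed (use assms in simp)
  obtain n where "s < real n" using reals_Archimedean2 by blast
  then have ex: "s < \<tau> n" using ge[of n] by linarith
  define m where "m = (LEAST n. s < \<tau> n)"
  have m: "s < \<tau> m" unfolding m_def using ex by (rule LeastI)
  then have "m \<noteq> 0" using assms by (cases m) auto
  then obtain k where k: "m = Suc k" by (cases m) auto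
  have "\<not> s < \<tau> k" using not_less_Least[of k "\<lambda>n. s < \<tau> n"] k by (simp add: m_def)
  then show ?thesis using that[of k] m k by auto
qed

lemma strict_mono_partition:
  fixes \<tau> :: "nat \<Rightarrow> real"
  assumes "\<And>k. \<tau> k + 1 \<le> \<tau> (Suc k)"
  shows "strict_mono \<tau>"
  unfolding strict_mono_Suc_iff
proof
  show "\<tau> k < \<tau> (Suc k)" for k using assms[of k] by linarith
qed

lemma piecewise_geodesic:
  fixes x :: "nat \<Rightarrow> 'a::metric_space" and \<tau> :: "nat \<Rightarrow> real"
  assumes geo: "\<And>x y::'a. \<exists>g. geodesic_segment g x y"
    and tau: "\<tau> 0 = 0" "\<And>k. \<tau> k + 1 \<le> \<tau> (Suc k)"
  obtains \<gamma> where "\<And>k. \<gamma> (\<tau> k) = x k"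
    "\<And>k s t. \<lbrakk>\<tau> k \<le> s; s \<le> \<tau> (Suc k); \<tau> k \<le> t; t \<le> \<tau> (Suc k)\<rbrakk> \<Longrightarrow>
       dist (\<gamma> s) (\<gamma> t) = \<bar>s - t\<bar> * (dist (x k) (x (Suc k)) / (\<tau> (Suc k) - \<tau> k))"
proof -
  have "\<forall>k. \<exists>g. geodesic_segment g (x k) (x (Suc k))" using geo by blast
  then obtain g where g: "\<And>k. geodesic_segment (g k) (x k) (x (Suc k))" by metis
  define D where "D k = dist (x k) (x (Suc k)) / (\<tau> (Suc k) - \<tau> k)" for k
  have mono: "strict_mono \<tau>" by (rule strict_mono_partition) (rule tau(2))
  \<comment> \<open>Half-open intervals make the index unique; the common endpoint of two pieces is
    treated in \<open>on\<close> below.\<close>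
  define idx where "idx s = (THE k. \<tau> k \<le> s \<and> s < \<tau> (Suc k))" for s
  have idx: "idx s = k" if "\<tau> k \<le> s" "s < \<tau> (Suc k)" for s k
    unfolding idx_def
  proof (rule the_equality)
    show "\<tau> k \<le> s \<and> s < \<tau> (Suc k)" using that by simp
    fix j assume j: "\<tau> j \<le> s \<and> s < \<tau> (Suc j)"
    then have "\<tau> j < \<tau> (Suc k)" "\<tau> k < \<tau> (Suc j)" using that by auto
    then show "j = k" using strict_mono_less[OF mono] by auto
  qed
  define \<gamma> where "\<gamma> s = g (idx s) ((s - \<tau> (idx s)) * D (idx s))" for s
  have at: "\<gamma> (\<tau> k) = x k" for k
  proof -
    have "idx (\<tau> k) = k" using idx[of k "\<tau> k"] tau(2)[of k] by simp
    then show ?thesis using g[of k] by (simp add: \<gamma>_def geodesic_segment_def)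
  qed
  have on: "\<gamma> s = g k ((s - \<tau> k) * D k)" if "\<tau> k \<le> s" "s \<le> \<tau> (Suc k)" for s k
  proof (cases "s = \<tau> (Suc k)")
    case True
    have "(s - \<tau> k) * D k = dist (x k) (x (Suc k))" using tau(2)[of k] True by (simp add: D_def)
    then show ?thesis using at[of "Suc k"] g[of k] True by (simp add: geodesic_segment_def)
  next
    case False
    then show ?thesis using idx[of k s] that by (simp add: \<gamma>_def)
  qed
  show ?thesis
  proof (rule that[of \<gamma>])
    show "\<gamma> (\<tau> k) = x k" for k by (rule at)
    fix k s t assume st: "\<tau> k \<le> s" "s \<le> \<tau> (Suc k)" "\<tau> k \<le> t" "t \<le> \<tau> (Suc k)"
    have D0: "0 \<le> D k" using tau(2)[of k] by (simp add: D_def)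
    have r: "(u - \<tau> k) * D k \<in> {0..dist (x k) (x (Suc k))}" if "\<tau> k \<le> u" "u \<le> \<tau> (Suc k)" for u
    proof -
      have "(u - \<tau> k) * D k \<le> (\<tau> (Suc k) - \<tau> k) * D k" using that D0 by (intro mult_right_mono) auto
      also have "\<dots> = dist (x k) (x (Suc k))" using tau(2)[of k] by (simp add: D_def)
      finally show ?thesis using that D0 by simp
    qed
    have "dist (\<gamma> s) (\<gamma> t) = \<bar>(s - \<tau> k) * D k - (t - \<tau> k) * D k\<bar>"
      using g[of k] r[of s] r[of t] st by (simp add: on[of k] geodesic_segment_def)
    also have "\<dots> = \<bar>(s - t) * D k\<bar>" by (simp add: algebra_simps)
    also have "\<dots> = \<bar>s - t\<bar> * D k" using D0 by (simp add: abs_mult)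
    finally show "dist (\<gamma> s) (\<gamma> t) = \<bar>s - t\<bar> * (dist (x k) (x (Suc k)) / (\<tau> (Suc k) - \<tau> k))" by (simp add: D_def)
  qed
qed

lemma piecewise_Lipschitz:
  fixes \<gamma> :: "real \<Rightarrow> 'a::metric_space" and \<tau> :: "nat \<Rightarrow> real"
  assumes tau: "\<tau> 0 = 0" "\<And>k. \<tau> k + 1 \<le> \<tau> (Suc k)"
    and lip: "\<And>k s t. \<lbrakk>\<tau> k \<le> s; s \<le> t; t \<le> \<tau> (Suc k)\<rbrakk> \<Longrightarrow> dist (\<gamma> s) (\<gamma> t) \<le> C * (t - s)"
    and st: "0 \<le> s" "0 \<le> t"
  shows "dist (\<gamma> s) (\<gamma> t) \<le> C * \<bar>s - t\<bar>"
proof -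
  have mono: "strict_mono \<tau>" by (rule strict_mono_partition) (rule tau(2))
  have vert: "dist (\<gamma> (\<tau> k)) (\<gamma> (\<tau> (k + n))) \<le> C * (\<tau> (k + n) - \<tau> k)" for k n
  proof (induction n)
    case (Suc n)
    have "dist (\<gamma> (\<tau> (k + n))) (\<gamma> (\<tau> (k + Suc n))) \<le> C * (\<tau> (k + Suc n) - \<tau> (k + n))"
      using lip[of "k + n" "\<tau> (k+n)" "\<tau> (Suc (k+n))"] tau(2)[of "k+n"] by simp
    then show ?case using Suc dist_triangle[of "\<gamma> (\<tau> k)" "\<gamma> (\<tau> (k + Suc n))" "\<gamma> (\<tau> (k + n))"]
      by (simp add: algebra_simps)
  qed simp
  have *: "dist (\<gamma> s) (\<gamma> t) \<le> C * (t - s)" if st: "0 \<le> s" "s \<le> t" for s t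
  proof -
    obtain j where j: "\<tau> j \<le> s" "s < \<tau> (Suc j)" using locate_in_partition[of \<tau> s, OF tau] st by blast
    obtain k where k: "\<tau> k \<le> t" "t < \<tau> (Suc k)" using locate_in_partition[of \<tau> t, OF tau] st by auto
    have "\<tau> j < \<tau> (Suc k)" using j k st by linarith
    then have "j \<le> k" using strict_mono_less[OF mono] by auto
    show ?thesis
    proof (cases "j = k")
      case True then show ?thesis using lip[of j s t] j k st by simp
    next
      case False
      then have jk: "Suc j + (k - Suc j) = k" using \<open>j \<le> k\<close> by simp
      have "dist (\<gamma> s) (\<gamma> (\<tau> (Suc j))) \<le> C * (\<tau> (Suc j) - s)" using lip[of j s "\<tau> (Suc j)"] j by simp
      moreover have "dist (\<gamma> (\<tau> (Suc j))) (\<gamma> (\<tau> k)) \<le> C * (\<tau> k - \<tau> (Suc j))" using vert[of "Suc j" "k - Suc j"] jk by simp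
      moreover have "dist (\<gamma> (\<tau> k)) (\<gamma> t) \<le> C * (t - \<tau> k)" using lip[of k "\<tau> k" t] k by simp
      ultimately show ?thesis
        using dist_triangle[of "\<gamma> s" "\<gamma> t" "\<gamma> (\<tau> k)"] dist_triangle[of "\<gamma> s" "\<gamma> (\<tau> k)" "\<gamma> (\<tau> (Suc j))"]
        by (simp add: algebra_simps)
    qed
  qed
  show ?thesis
  proof (cases "s \<le> t")
    case True then show ?thesis using *[of s t] st by simp
  next
    case False then show ?thesis using *[of t s] st by (simp add: dist_commute)
  qed
qed

section \<open>Greedy straightening\<close>

definition Lipschitz_ray :: "real \<Rightarrow> (real \<Rightarrow> 'a::metric_space) \<Rightarrow> bool" where
  "Lipschitz_ray B v \<longleftrightarrow> (\<forall>s\<ge>0. \<forall>t\<ge>0. dist (v s) (v t) \<le> B * \<bar>s - t\<bar>)"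

lemma Lipschitz_rayD: "Lipschitz_ray B v \<Longrightarrow> 0 \<le> s \<Longrightarrow> 0 \<le> t \<Longrightarrow> dist (v s) (v t) \<le> B * \<bar>s - t\<bar>"
  by (simp add: Lipschitz_ray_def)

lemma Lipschitz_ray_continuous:
  assumes "Lipschitz_ray B v"
  shows "continuous_on {0..} v"
proof -
  have "(max B 0)-lipschitz_on {0..} v"
  proof (rule lipschitz_onI)
    fix s t :: real assume "s \<in> {0..}" "t \<in> {0..}"
    then have "dist (v s) (v t) \<le> B * \<bar>s - t\<bar>" using assms by (simp add: Lipschitz_rayD)
    also have "\<dots> \<le> max B 0 * \<bar>s - t\<bar>" by (intro mult_right_mono) auto
    finally show "dist (v s) (v t) \<le> max B 0 * dist s t" by (simp add: dist_real_def)
  qed simp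
  then show ?thesis by (rule lipschitz_on_continuous_on)
qed

text \<open>The admissible targets form a closed set, bounded by \<open>bdd\<close>, so there is a
  last one. The shifts by 1 make \<open>a + 1\<close> admissible for every 1-Lipschitz path; hence
  each jump advances by at least 1 and iteration exhausts the half-line.\<close>

lemma greedy_next:
  fixes v :: "real \<Rightarrow> 'a::metric_space"
  assumes lip: "Lipschitz_ray 1 v" and W: "1 \<le> W" and a: "0 \<le> a"
    and bdd: "\<And>b. a + 1 \<le> b \<Longrightarrow> W * (dist (v a) (v b) - 1) \<le> b - a - 1 \<Longrightarrow> b \<le> K"
  obtains b where "a + 1 \<le> b" "W * (dist (v a) (v b) - 1) \<le> b - a - 1"
    "\<And>c. b < c \<Longrightarrow> c - a - 1 < W * (dist (v a) (v c) - 1)"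
    "b - a \<le> W * dist (v a) (v b)"
proof -
  define S where "S = {b. a + 1 \<le> b \<and> W * (dist (v a) (v b) - 1) \<le> b - a - 1}"
  have ne: "a + 1 \<in> S"
  proof -
    have "dist (v a) (v (a+1)) \<le> 1" using Lipschitz_rayD[OF lip, of a "a+1"] a by simp
    then show ?thesis using W by (simp add: S_def mult_le_0_iff)
  qed
  have bS: "bdd_above S" using bdd by (auto simp: S_def bdd_above_def)
  have cont: "continuous_on {a+1..} v"
    by (rule continuous_on_subset[OF Lipschitz_ray_continuous[OF lip]]) (use a in auto)
  have "closed S"
  proof -
    have "closed {x \<in> {a+1..}. W * (dist (v a) (v x) - 1) \<le> x - a - 1}"
      by (rule continuous_on_closed_Collect_le) (auto intro!: continuous_intros cont)
    then show ?thesis by (simp add: S_def)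
  qed
  then have b: "Sup S \<in> S" using ne bS by (metis closed_contains_Sup empty_iff)
  define b where "b = Sup S"
  have b1: "a + 1 \<le> b" "W * (dist (v a) (v b) - 1) \<le> b - a - 1" using b by (auto simp: S_def b_def)
  have b2: "c - a - 1 < W * (dist (v a) (v c) - 1)" if "b < c" for c
  proof (rule ccontr)
    assume "\<not> ?thesis"
    then have "c \<in> S" using that b1 by (simp add: S_def)
    then show False using cSup_upper[OF _ bS, of c] that by (simp add: b_def)
  qed
  \<comment> \<open>Just beyond \<open>b\<close> the jump condition fails; letting the excess
    \<open>h\<close> tend to 0, the Lipschitz bound turns this failure into the reverse inequality
    at \<open>b\<close> itself.\<close>
  have "b - a - 1 \<le> W * (dist (v a) (v b) - 1)"
  proof (rule field_le_epsilon)
    fix e :: real assume e: "0 < e"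
    define h where "h = e / W"
    have h: "0 < h" "W * h = e" using e W by (auto simp: h_def)
    have "dist (v a) (v (b + h)) \<le> dist (v a) (v b) + h"
      using Lipschitz_rayD[OF lip, of b "b+h"] dist_triangle[of "v a" "v (b+h)" "v b"] a b1 h by simp
    then have "W * (dist (v a) (v (b + h)) - 1) \<le> W * (dist (v a) (v b) + h - 1)" using W by (intro mult_left_mono) auto
    moreover have "b + h - a - 1 < W * (dist (v a) (v (b + h)) - 1)" using b2[of "b + h"] h by simp
    ultimately show "b - a - 1 \<le> W * (dist (v a) (v b) - 1) + e" using h by (simp add: algebra_simps)
  qed
  then have "b - a \<le> W * dist (v a) (v b)" using W by (simp add: algebra_simps)
  then show ?thesis using that b1 b2 by blast
qed

text \<open>Vertices of different jumps are far apart because a jump always goes to the last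
  admissible point: anything beyond the target of the jump from \<open>\<tau> j\<close> fails the
  jump condition, and this failure is a lower bound on the distance. The last conclusion records the
  jump containing \<open>s\<close>, from which callers estimate the distance to
  \<open>v\<close>.\<close>

lemma greedy_path:
  fixes v :: "real \<Rightarrow> 'a::metric_space"
  assumes geo: "\<And>x y::'a. \<exists>g. geodesic_segment g x y"
    and lip: "Lipschitz_ray 1 v" and W: "1 \<le> W"
    and bdd: "\<And>a. 0 \<le> a \<Longrightarrow> \<exists>K. \<forall>b\<ge>a+1. W * (dist (v a) (v b) - 1) \<le> b - a - 1 \<longrightarrow> b \<le> K"
  obtains \<gamma> where "\<gamma> 0 = v 0" "Lipschitz_ray 1 \<gamma>"
    "\<And>s t. 0 \<le> s \<Longrightarrow> 0 \<le> t \<Longrightarrow> \<bar>s - t\<bar> \<le> W * dist (\<gamma> s) (\<gamma> t) + W"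
    "\<And>s. 0 \<le> s \<Longrightarrow> \<exists>a b. 0 \<le> a \<and> a \<le> s \<and> s \<le> b \<and> \<gamma> a = v a \<and> a + 1 \<le> b \<and> W * (dist (v a) (v b) - 1) \<le> b - a - 1"
proof -
  have "\<exists>b. a + 1 \<le> b \<and> W * (dist (v a) (v b) - 1) \<le> b - a - 1 \<and>
      (\<forall>c. b < c \<longrightarrow> c - a - 1 < W * (dist (v a) (v c) - 1)) \<and> b - a \<le> W * dist (v a) (v b)" if "0 \<le> a" for a
    using greedy_next[OF lip W that] bdd[OF that] by metis
  then obtain nxt where nxt: "\<And>a. 0 \<le> a \<Longrightarrow> a + 1 \<le> nxt a"
     "\<And>a. 0 \<le> a \<Longrightarrow> W * (dist (v a) (v (nxt a)) - 1) \<le> nxt a - a - 1"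
     "\<And>a c. 0 \<le> a \<Longrightarrow> nxt a < c \<Longrightarrow> c - a - 1 < W * (dist (v a) (v c) - 1)"
     "\<And>a. 0 \<le> a \<Longrightarrow> nxt a - a \<le> W * dist (v a) (v (nxt a))" by metis
  define \<tau> where "\<tau> k = (nxt ^^ k) 0" for k
  have tau0: "\<tau> 0 = 0" by (simp add: \<tau>_def)
  have tauS: "\<tau> (Suc k) = nxt (\<tau> k)" for k by (simp add: \<tau>_def)
  have pos: "0 \<le> \<tau> k" for k
  proof (induction k)
    case (Suc k) then show ?case using nxt(1)[of "\<tau> k"] by (simp add: tauS)
  qed (simp add: tau0)
  have step: "\<tau> k + 1 \<le> \<tau> (Suc k)" for k using nxt(1)[OF pos] by (simp add: tauS)
  have mono: "strict_mono \<tau>" by (rule strict_mono_partition) (rule step)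
  obtain \<gamma> where g: "\<And>k. \<gamma> (\<tau> k) = v (\<tau> k)"
    "\<And>k s t. \<lbrakk>\<tau> k \<le> s; s \<le> \<tau> (Suc k); \<tau> k \<le> t; t \<le> \<tau> (Suc k)\<rbrakk> \<Longrightarrow>
       dist (\<gamma> s) (\<gamma> t) = \<bar>s - t\<bar> * (dist (v (\<tau> k)) (v (\<tau> (Suc k))) / (\<tau> (Suc k) - \<tau> k))"
    using piecewise_geodesic[of \<tau> "\<lambda>k. v (\<tau> k)", OF geo tau0 step] by metis
  define D where "D k = dist (v (\<tau> k)) (v (\<tau> (Suc k)))" for k
  define l where "l k = \<tau> (Suc k) - \<tau> k" for k
  have l: "1 \<le> l k" for k using step[of k] by (simp add: l_def)
  have D1: "W * (D k - 1) \<le> l k - 1" for k using nxt(2)[OF pos, of k] by (simp add: D_def l_def tauS)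
  have D2: "l k \<le> W * D k" for k using nxt(4)[OF pos, of k] by (simp add: D_def l_def tauS)
  have D3: "D k \<le> l k" for k
    using Lipschitz_rayD[OF lip pos pos, of k "Suc k"] step[of k] by (simp add: D_def l_def)
  \<comment> \<open>Along a jump the path moves slowly: \<open>W\<close> times the distance covered
    exceeds the elapsed time by at most \<open>W - 1\<close>. Replacing vertices by inner points
    thus costs an additive constant only.\<close>
  have seg: "W * (r * (D k / l k)) \<le> r + W - 1" if "0 \<le> r" "r \<le> l k" for r k
  proof -
    have "W * (r * (D k / l k)) = (r / l k) * (W * D k)" by simp
    also have "\<dots> \<le> (r / l k) * (l k + W - 1)"
      using D1[of k] that l[of k] by (intro mult_left_mono) (auto simp: algebra_simps)
    also have "\<dots> = r + (r / l k) * (W - 1)" using l[of k] by (simp add: field_simps)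
    also have "(r / l k) * (W - 1) \<le> 1 * (W - 1)" using that l[of k] W by (intro mult_right_mono) auto
    finally show ?thesis by simp
  qed
  have lower: "t - s \<le> W * dist (\<gamma> s) (\<gamma> t) + W" if st: "0 \<le> s" "s \<le> t" for s t
  proof -
    obtain j where j: "\<tau> j \<le> s" "s < \<tau> (Suc j)" using locate_in_partition[of \<tau> s, OF tau0 step] st by blast
    obtain k where k: "\<tau> k \<le> t" "t < \<tau> (Suc k)" using locate_in_partition[of \<tau> t, OF tau0 step] st by auto
    have "\<tau> j < \<tau> (Suc k)" using j k st by linarith
    then have jk: "j \<le> k" using strict_mono_less[OF mono] by auto
    show ?thesis
    proof (cases "j = k")
      case True
      have "dist (\<gamma> s) (\<gamma> t) = (t - s) * (D k / l k)" using g(2)[of k s t] j k True st by (simp add: D_def l_def)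
      moreover have "(t - s) * 1 \<le> (t - s) * (W * D k / l k)"
        using D2[of k] l[of k] st by (intro mult_left_mono) (auto simp: field_simps)
      ultimately have "t - s \<le> W * dist (\<gamma> s) (\<gamma> t)" by (simp add: algebra_simps)
      then show ?thesis using W by simp
    next
      case False
      then have "Suc j < Suc k" using jk by simp
      then have "\<tau> (Suc j) < \<tau> (Suc k)" using strict_mono_less[OF mono] by blast
      \<comment> \<open>Both ends are pushed outwards to \<open>\<tau> j\<close> and
        \<open>\<tau> (Suc k)\<close>, a pair that fails the jump condition.\<close>
      then have far: "\<tau> (Suc k) - \<tau> j - 1 < W * (dist (v (\<tau> j)) (v (\<tau> (Suc k))) - 1)"
        using nxt(3)[OF pos, of j "\<tau> (Suc k)"] by (simp add: tauS)
      have a: "dist (v (\<tau> j)) (\<gamma> s) = (s - \<tau> j) * (D j / l j)"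
        using g(2)[of j "\<tau> j" s] g(1)[of j] j by (simp add: D_def l_def)
      have b: "dist (\<gamma> t) (v (\<tau> (Suc k))) = (\<tau> (Suc k) - t) * (D k / l k)"
        using g(2)[of k t "\<tau> (Suc k)"] g(1)[of "Suc k"] k step[of k] by (simp add: D_def l_def)
      have "dist (v (\<tau> j)) (v (\<tau> (Suc k))) \<le> dist (v (\<tau> j)) (\<gamma> s) + dist (\<gamma> s) (\<gamma> t) + dist (\<gamma> t) (v (\<tau> (Suc k)))"
        using dist_triangle[of "v (\<tau> j)" "v (\<tau> (Suc k))" "\<gamma> t"] dist_triangle[of "v (\<tau> j)" "\<gamma> t" "\<gamma> s"] by linarith
      then have "W * dist (v (\<tau> j)) (v (\<tau> (Suc k))) \<le> W * (dist (v (\<tau> j)) (\<gamma> s) + dist (\<gamma> s) (\<gamma> t) + dist (\<gamma> t) (v (\<tau> (Suc k))))"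
        using W by (intro mult_left_mono) auto
      also have "\<dots> = W * dist (v (\<tau> j)) (\<gamma> s) + W * dist (\<gamma> s) (\<gamma> t) + W * dist (\<gamma> t) (v (\<tau> (Suc k)))"
        by (simp add: algebra_simps)
      also have "W * dist (v (\<tau> j)) (\<gamma> s) \<le> (s - \<tau> j) + W - 1" unfolding a using j by (intro seg) (auto simp: l_def)
      also have "W * dist (\<gamma> t) (v (\<tau> (Suc k))) \<le> (\<tau> (Suc k) - t) + W - 1" unfolding b using k by (intro seg) (auto simp: l_def)
      finally show ?thesis using far W by (simp add: algebra_simps)
    qed
  qed
  have gl: "Lipschitz_ray 1 \<gamma>"
    unfolding Lipschitz_ray_def
  proof (intro allI impI piecewise_Lipschitz[of \<tau>])
    fix k s t assume st: "\<tau> k \<le> s" "s \<le> t" "t \<le> \<tau> (Suc k)"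
    have "dist (\<gamma> s) (\<gamma> t) = (t - s) * (D k / l k)" using g(2)[of k s t] st by (simp add: D_def l_def)
    also have "\<dots> \<le> (t - s) * 1" using D3[of k] l[of k] st by (intro mult_left_mono) (auto simp: field_simps)
    finally show "dist (\<gamma> s) (\<gamma> t) \<le> 1 * (t - s)" by simp
  qed (use tau0 step in auto)
  show ?thesis
  proof (rule that[of \<gamma>])
    show "\<gamma> 0 = v 0" using g(1)[of 0] tau0 by simp
    show "Lipschitz_ray 1 \<gamma>" by (rule gl)
    show "\<bar>s - t\<bar> \<le> W * dist (\<gamma> s) (\<gamma> t) + W" if "0 \<le> s" "0 \<le> t" for s t
    proof (cases "s \<le> t")
      case True then show ?thesis using lower[of s t] that by simp
    next
      case False then show ?thesis using lower[of t s] that by (simp add: dist_commute)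
    qed
    fix s :: real assume s: "0 \<le> s"
    obtain j where j: "\<tau> j \<le> s" "s < \<tau> (Suc j)" using locate_in_partition[of \<tau> s, OF tau0 step] s by blast
    show "\<exists>a b. 0 \<le> a \<and> a \<le> s \<and> s \<le> b \<and> \<gamma> a = v a \<and> a + 1 \<le> b \<and> W * (dist (v a) (v b) - 1) \<le> b - a - 1"
      using j g(1)[of j] pos[of j] step[of j] D1[of j]
      by (intro exI[of _ "\<tau> j"] exI[of _ "\<tau> (Suc j)"]) (auto simp: D_def l_def)
  qed
qed

text \<open>The normal form of the outputs of straightening: Lipschitz rather than coarsely
  Lipschitz, hence continuous, and governed by one constant.\<close>

definition tight_ray :: "real \<Rightarrow> 'a::metric_space \<Rightarrow> (real \<Rightarrow> 'a) \<Rightarrow> bool" where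
  "tight_ray B p \<gamma> \<longleftrightarrow> 1 \<le> B \<and> \<gamma> 0 = p \<and> Lipschitz_ray B \<gamma> \<and>
     (\<forall>s\<ge>0. \<forall>t\<ge>0. \<bar>s - t\<bar> \<le> B * dist (\<gamma> s) (\<gamma> t) + B)"

lemma tight_ray_quasi_geodesic:
  assumes "tight_ray B p \<gamma>"
  shows "quasi_geodesic_ray p B 1 \<gamma>"
proof -
  have B: "1 \<le> B" and lip: "Lipschitz_ray B \<gamma>" and "\<gamma> 0 = p" using assms by (auto simp: tight_ray_def)
  have "1 / B * \<bar>s - t\<bar> - 1 \<le> dist (\<gamma> s) (\<gamma> t)" if "0 \<le> s" "0 \<le> t" for s t
  proof -
    have "\<bar>s - t\<bar> \<le> B * dist (\<gamma> s) (\<gamma> t) + B" using assms that by (simp add: tight_ray_def)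
    then show ?thesis using B by (simp add: field_simps)
  qed
  moreover have "dist (\<gamma> s) (\<gamma> t) \<le> B * \<bar>s - t\<bar> + 1" if "0 \<le> s" "0 \<le> t" for s t
    using Lipschitz_rayD[OF lip that] by simp
  ultimately show ?thesis
    using B Lipschitz_ray_continuous[OF lip] \<open>\<gamma> 0 = p\<close> by (simp add: quasi_geodesic_ray_def)
qed

text \<open>The tightness constant involves \<open>B\<close> and \<open>q\<close> but not the
  additive errors \<open>E\<close>, which may depend on the starting point and serve only to make
  the jumps finite. The distance to \<open>v\<close> is left in terms of the jump containing
  \<open>s\<close>, so that each caller can bound that jump by the best lower estimate available at
  its start.\<close>

lemma greedy_straighten:
  fixes v :: "real \<Rightarrow> 'a::metric_space"
  assumes geo: "\<And>x y::'a. \<exists>g. geodesic_segment g x y"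
    and v0: "v 0 = p" and lip: "Lipschitz_ray B v" and B: "1 \<le> B" and q: "1 \<le> q"
    and coarse: "\<And>a. 0 \<le> a \<Longrightarrow> \<exists>E. \<forall>b\<ge>a. b - a \<le> q * dist (v a) (v b) + E"
  obtains \<gamma> where "tight_ray (2 * B * q) p \<gamma>"
    "\<And>s. 0 \<le> s \<Longrightarrow> \<exists>a b. 0 \<le> a \<and> a \<le> s \<and> s \<le> b \<and> 2 * q * (dist (v a) (v b) - 1) \<le> b - a \<and>
        dist (\<gamma> s) (v s) \<le> 2 * B * (b - a)"
proof -
  \<comment> \<open>Twice the coarse constant \<open>B * q\<close> of the 1-Lipschitz path
    \<open>v'\<close>: the jump condition bounds \<open>B * q * dist\<close> by roughly half of
    \<open>b - a\<close>, the coarse bound makes it roughly all of \<open>b - a\<close>, so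
    \<open>b - a\<close> is bounded.\<close>
  define W where "W = 2 * B * q"
  have Bq: "1 \<le> B * q" using B q mult_mono[of 1 B 1 q] by simp
  have W: "1 \<le> W" "B \<le> W" "W = B * q + B * q" using B q Bq mult_left_mono[of 1 q B] by (auto simp: W_def)
  define v' where "v' s = v (s / B)" for s
  have lip': "Lipschitz_ray 1 v'"
    unfolding Lipschitz_ray_def
  proof (intro allI impI)
    fix s t :: real assume st: "0 \<le> s" "0 \<le> t"
    have "dist (v' s) (v' t) \<le> B * \<bar>s / B - t / B\<bar>" using Lipschitz_rayD[OF lip, of "s/B" "t/B"] st B by (simp add: v'_def)
    also have "B * \<bar>s / B - t / B\<bar> = \<bar>s - t\<bar>" using B by (simp add: diff_divide_distrib[symmetric] abs_divide)
    finally show "dist (v' s) (v' t) \<le> 1 * \<bar>s - t\<bar>" by simp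
  qed
  have bdd: "\<exists>K. \<forall>b\<ge>a+1. W * (dist (v' a) (v' b) - 1) \<le> b - a - 1 \<longrightarrow> b \<le> K" if a: "0 \<le> a" for a
  proof -
    obtain E where E: "\<forall>b\<ge>a/B. b - a/B \<le> q * dist (v (a/B)) (v b) + E" using coarse[of "a/B"] a B by auto
    show ?thesis
    proof (intro exI allI impI)
      fix b assume b: "a + 1 \<le> b" "W * (dist (v' a) (v' b) - 1) \<le> b - a - 1"
      have "b/B - a/B \<le> q * dist (v' a) (v' b) + E" using E b B by (simp add: v'_def divide_right_mono)
      then have "B * (b/B - a/B) \<le> B * (q * dist (v' a) (v' b) + E)" using B by (intro mult_left_mono) auto
      then have 1: "b - a \<le> B * q * dist (v' a) (v' b) + B * E" using B by (simp add: algebra_simps)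
      have "2 * (B * q * dist (v' a) (v' b)) - W \<le> b - a - 1" using b(2) W(3) by (simp add: algebra_simps)
      then show "b \<le> a + W + 2 * (B * E)" using 1 by linarith
    qed
  qed
  obtain \<gamma> where g: "\<gamma> 0 = v' 0" "Lipschitz_ray 1 \<gamma>"
    "\<And>s t. 0 \<le> s \<Longrightarrow> 0 \<le> t \<Longrightarrow> \<bar>s - t\<bar> \<le> W * dist (\<gamma> s) (\<gamma> t) + W"
    "\<And>s. 0 \<le> s \<Longrightarrow> \<exists>a b. 0 \<le> a \<and> a \<le> s \<and> s \<le> b \<and> \<gamma> a = v' a \<and> a + 1 \<le> b \<and> W * (dist (v' a) (v' b) - 1) \<le> b - a - 1"
    using greedy_path[OF geo lip' W(1) bdd] by metis
  define \<gamma>' where "\<gamma>' s = \<gamma> (B * s)" for s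
  have lipB: "dist (\<gamma>' s) (\<gamma>' t) \<le> B * \<bar>s - t\<bar>" if "0 \<le> s" "0 \<le> t" for s t
  proof -
    have "dist (\<gamma>' s) (\<gamma>' t) \<le> \<bar>B * s - B * t\<bar>" using Lipschitz_rayD[OF g(2), of "B * s" "B * t"] that B by (simp add: \<gamma>'_def)
    also have "\<dots> = B * \<bar>s - t\<bar>" using B by (simp add: right_diff_distrib[symmetric] abs_mult)
    finally show ?thesis .
  qed
  show ?thesis
  proof (rule that[of \<gamma>'])
    have "Lipschitz_ray W \<gamma>'" unfolding Lipschitz_ray_def
      using lipB W(2) by (meson abs_ge_zero mult_right_mono order_trans)
    moreover have "\<bar>s - t\<bar> \<le> W * dist (\<gamma>' s) (\<gamma>' t) + W" if "0 \<le> s" "0 \<le> t" for s t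
    proof -
      have "1 * \<bar>s - t\<bar> \<le> B * \<bar>s - t\<bar>" using B by (intro mult_right_mono) auto
      also have "\<dots> = \<bar>B * s - B * t\<bar>" using B by (simp add: right_diff_distrib[symmetric] abs_mult)
      also have "\<dots> \<le> W * dist (\<gamma>' s) (\<gamma>' t) + W" using g(3)[of "B * s" "B * t"] that B by (simp add: \<gamma>'_def)
      finally show ?thesis by simp
    qed
    ultimately show "tight_ray (2 * B * q) p \<gamma>'" using W(1) g(1) v0 unfolding W_def[symmetric]
      by (simp add: tight_ray_def \<gamma>'_def v'_def)
    fix s :: real assume s: "0 \<le> s"
    obtain a b where ab: "0 \<le> a" "a \<le> B * s" "B * s \<le> b" "\<gamma> a = v' a" "a + 1 \<le> b"
      "W * (dist (v' a) (v' b) - 1) \<le> b - a - 1" using g(4)[of "B * s"] s B by auto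
    define a' b' where "a' = a / B" and "b' = b / B"
    have a'b': "0 \<le> a'" "a' \<le> s" "s \<le> b'" using ab B by (auto simp: a'_def b'_def field_simps)
    have ga: "\<gamma>' a' = v a'" using ab(4) B by (simp add: a'_def \<gamma>'_def v'_def)
    have "B * (2 * q * (dist (v a') (v b') - 1)) \<le> B * (b' - a')"
      using ab(6) B unfolding W_def by (simp add: a'_def b'_def v'_def algebra_simps)
    then have 1: "2 * q * (dist (v a') (v b') - 1) \<le> b' - a'" using B by simp
    have "dist (\<gamma>' s) (v s) \<le> dist (\<gamma>' s) (\<gamma>' a') + dist (v a') (v s)"
      using dist_triangle[of "\<gamma>' s" "v s" "v a'"] ga by simp
    also have "\<dots> \<le> B * (s - a') + B * (s - a')"
      using lipB[of s a'] Lipschitz_rayD[OF lip, of a' s] a'b' s by simp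
    also have "\<dots> \<le> B * (b' - a') + B * (b' - a')" using a'b' B by (intro add_mono mult_left_mono) auto
    finally have "dist (\<gamma>' s) (v s) \<le> 2 * B * (b' - a')" by simp
    then show "\<exists>a b. 0 \<le> a \<and> a \<le> s \<and> s \<le> b \<and> 2 * q * (dist (v a) (v b) - 1) \<le> b - a \<and>
        dist (\<gamma>' s) (v s) \<le> 2 * B * (b - a)" using a'b' 1 by blast
  qed
qed

section \<open>Rays with sublinear error: size, Lipschitz models, straightening\<close>

text \<open>The basepoint condition is coarse and continuity is not asked for, since
  \<open>\<Phi>\<close> may respect neither. The error is measured by time, which
  \<open>scale_ray_norm\<close> makes interchangeable with the norm.\<close>

definition scale_ray :: "'a::metric_space \<Rightarrow> (real \<Rightarrow> real) \<Rightarrow> real \<Rightarrow> (real \<Rightarrow> 'a) \<Rightarrow> bool" where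
  "scale_ray p \<kappa> A f \<longleftrightarrow> 1 \<le> A \<and> dist (f 0) p \<le> A \<and>
     (\<forall>s\<ge>0. \<forall>t\<ge>0. dist (f s) (f t) \<le> A * \<bar>s - t\<bar> + A * \<kappa> (max s t) \<and>
                    \<bar>s - t\<bar> \<le> A * dist (f s) (f t) + A * \<kappa> (max s t))"

lemma scale_rayD:
  assumes "scale_ray p \<kappa> A f"
  shows "1 \<le> A" "dist (f 0) p \<le> A"
    "0 \<le> s \<Longrightarrow> 0 \<le> t \<Longrightarrow> dist (f s) (f t) \<le> A * \<bar>s - t\<bar> + A * \<kappa> (max s t)"
    "0 \<le> s \<Longrightarrow> 0 \<le> t \<Longrightarrow> \<bar>s - t\<bar> \<le> A * dist (f s) (f t) + A * \<kappa> (max s t)"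
  using assms by (auto simp: scale_ray_def)

context sublinear_scale
begin

lemma scale_ray_mono:
  assumes f: "scale_ray p \<kappa> A f" and A: "A \<le> A'"
  shows "scale_ray p \<kappa> A' f"
proof -
  have "dist (f s) (f t) \<le> A' * \<bar>s - t\<bar> + A' * \<kappa> (max s t) \<and>
        \<bar>s - t\<bar> \<le> A' * dist (f s) (f t) + A' * \<kappa> (max s t)" if st: "0 \<le> s" "0 \<le> t" for s t
  proof -
    have "A * x \<le> A' * x" if "0 \<le> x" for x using A that by (rule mult_right_mono)
    moreover have "0 \<le> \<kappa> (max s t)" by (rule less_imp_le[OF scale_pos]) (use st in auto)
    ultimately have "A * \<bar>s - t\<bar> \<le> A' * \<bar>s - t\<bar>" "A * \<kappa> (max s t) \<le> A' * \<kappa> (max s t)"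
      "A * dist (f s) (f t) \<le> A' * dist (f s) (f t)" by auto
    then show ?thesis using scale_rayD(3,4)[OF f st] by linarith
  qed
  then show ?thesis using scale_rayD(1,2)[OF f] A by (simp add: scale_ray_def)
qed

lemma quasi_geodesic_scale_ray:
  assumes qg: "quasi_geodesic_ray p q Q f" and A: "q * (Q + 1) \<le> A"
  shows "scale_ray p \<kappa> A f"
proof -
  have q: "1 \<le> q" "0 \<le> Q" and f0: "f 0 = p" using qg by (auto simp: quasi_geodesic_ray_def)
  have le: "q \<le> q * (Q + 1)" "Q \<le> q * (Q + 1)" "1 \<le> q * (Q + 1)"
    using q mult_left_mono[of 1 "Q+1" q] mult_right_mono[of 1 q Q] by (auto simp: algebra_simps)
  have "scale_ray p \<kappa> (q * (Q + 1)) f"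
    unfolding scale_ray_def
  proof (intro conjI allI impI)
    show "1 \<le> q * (Q + 1)" "dist (f 0) p \<le> q * (Q + 1)" using le f0 by auto
    fix s t :: real assume st: "0 \<le> s" "0 \<le> t"
    have k: "1 \<le> \<kappa> (max s t)" using st by (intro scale_ge_1) auto
    have kk: "q * (Q + 1) \<le> q * (Q + 1) * \<kappa> (max s t)" using le k mult_left_mono[of 1 "\<kappa> (max s t)" "q * (Q+1)"] by simp
    have u: "dist (f s) (f t) \<le> q * \<bar>s - t\<bar> + Q" and l: "1 / q * \<bar>s - t\<bar> - Q \<le> dist (f s) (f t)"
      using qg st by (auto simp: quasi_geodesic_ray_def)
    have "q * \<bar>s - t\<bar> \<le> q * (Q + 1) * \<bar>s - t\<bar>" using le by (intro mult_right_mono) auto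
    then show "dist (f s) (f t) \<le> q * (Q + 1) * \<bar>s - t\<bar> + q * (Q + 1) * \<kappa> (max s t)"
      using u kk le by linarith
    have "\<bar>s - t\<bar> \<le> q * dist (f s) (f t) + q * Q" using l q by (simp add: field_simps)
    moreover have "q * dist (f s) (f t) \<le> q * (Q + 1) * dist (f s) (f t)" using le by (intro mult_right_mono) auto
    moreover have "q * Q \<le> q * (Q + 1)" using q by (simp add: algebra_simps)
    ultimately show "\<bar>s - t\<bar> \<le> q * (Q + 1) * dist (f s) (f t) + q * (Q + 1) * \<kappa> (max s t)"
      using kk by linarith
  qed
  then show ?thesis using A by (rule scale_ray_mono)
qed

text \<open>Uniformity is the point: the constant depends on \<open>A\<close> and
  \<open>\<kappa>\<close> alone, so it can be fixed before the ray. The error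
  \<open>A * \<kappa> s\<close> is absorbed by half of \<open>s\<close>.\<close>

lemma scale_ray_norm:
  assumes A: "1 \<le> A"
  obtains C where "1 \<le> C"
    "\<And>(p::'a::metric_space) f s. scale_ray p \<kappa> A f \<Longrightarrow> 0 \<le> s \<Longrightarrow> dist (f s) p \<le> C * s + C"
    "\<And>(p::'a::metric_space) f s. scale_ray p \<kappa> A f \<Longrightarrow> 0 \<le> s \<Longrightarrow> s \<le> C * dist (f s) p + C"
    "\<And>(p::'a::metric_space) f s. scale_ray p \<kappa> A f \<Longrightarrow> 0 \<le> s \<Longrightarrow> \<kappa> (dist (f s) p) \<le> C * \<kappa> s"
    "\<And>(p::'a::metric_space) f s. scale_ray p \<kappa> A f \<Longrightarrow> 0 \<le> s \<Longrightarrow> \<kappa> s \<le> C * \<kappa> (dist (f s) p)"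
proof -
  obtain K where K: "0 \<le> K" "\<And>s. 0 \<le> s \<Longrightarrow> \<kappa> s \<le> 1 / (2 * A) * s + K"
    using scale_small[of "1/(2*A)"] A by auto
  have AK: "A * \<kappa> s \<le> s / 2 + A * K" if "0 \<le> s" for s
    using K(2)[OF that] A mult_left_mono[of "\<kappa> s" "1 / (2 * A) * s + K" A] by (simp add: field_simps)
  define C1 where "C1 = 2 * A + 2 * A * A + 2 * (A * K) + 1"
  have AA: "0 \<le> A * A" "0 \<le> A * K" using A K by auto
  have C1: "1 \<le> C1" "A + 1 \<le> C1" "2 * A \<le> C1" "A * K + A \<le> C1" "2 * A * A + 2 * (A * K) \<le> C1"
    using AA A by (auto simp: C1_def)
  obtain C2 where C2: "1 \<le> C2" "\<And>s t. 0 \<le> s \<Longrightarrow> 0 \<le> t \<Longrightarrow> t \<le> C1 * s + C1 \<Longrightarrow> \<kappa> t \<le> C2 * \<kappa> s"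
    using scale_affine[of C1] C1 by auto
  have n1: "dist (f s) p \<le> C1 * s + C1" if f: "scale_ray p \<kappa> A f" and s: "0 \<le> s" for f s and p :: 'a
  proof -
    have "dist (f s) p \<le> A * s + A * \<kappa> s + A"
      using scale_rayD(3)[OF f s, of 0] scale_rayD(2)[OF f] s dist_triangle[of "f s" p "f 0"] by simp
    also have "\<dots> \<le> (A + 1) * s + (A * K + A)" using AK[OF s] s by (simp add: algebra_simps)
    also have "\<dots> \<le> C1 * s + C1" using C1 s by (intro add_mono mult_right_mono) auto
    finally show ?thesis .
  qed
  have n2: "s \<le> C1 * dist (f s) p + C1" if f: "scale_ray p \<kappa> A f" and s: "0 \<le> s" for f s and p :: 'a
  proof -
    have "s \<le> A * dist (f s) (f 0) + A * \<kappa> s" using scale_rayD(4)[OF f s, of 0] s by simp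
    also have "A * dist (f s) (f 0) \<le> A * (dist (f s) p + A)"
      using scale_rayD(2)[OF f] A dist_triangle[of "f s" "f 0" p] by (intro mult_left_mono) (auto simp: dist_commute)
    finally have "s \<le> A * dist (f s) p + A * A + (s / 2 + A * K)" using AK[OF s] by (simp add: algebra_simps)
    then have "s \<le> (2 * A) * dist (f s) p + (2 * A * A + 2 * (A * K))" by (simp add: algebra_simps)
    also have "\<dots> \<le> C1 * dist (f s) p + C1" using C1 by (intro add_mono mult_right_mono) auto
    finally show ?thesis .
  qed
  define C where "C = max C1 C2"
  have C: "C1 \<le> C" "C2 \<le> C" "1 \<le> C" using C1 by (auto simp: C_def)
  show ?thesis
  proof (rule that[of C])
    show "1 \<le> C" by fact
    fix p :: 'a and f s assume f: "scale_ray p \<kappa> A f" and s: "0 \<le> (s::real)"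
    have m: "C1 * x + C1 \<le> C * x + C" if "0 \<le> x" for x using C that by (intro add_mono mult_right_mono) auto
    have m2: "C2 * x \<le> C * x" if "0 \<le> x" for x using C that by (intro mult_right_mono) auto
    show "dist (f s) p \<le> C * s + C" using n1[OF f s] m[OF s] by linarith
    show "s \<le> C * dist (f s) p + C" using n2[OF f s] m[of "dist (f s) p"] by simp
    show "\<kappa> (dist (f s) p) \<le> C * \<kappa> s"
      using C2(2)[OF s _ n1[OF f s]] m2[of "\<kappa> s"] scale_pos[OF s] by (meson less_imp_le order_trans zero_le_dist)
    show "\<kappa> s \<le> C * \<kappa> (dist (f s) p)"
      using C2(2)[OF _ s n2[OF f s]] m2[of "\<kappa> (dist (f s) p)"] scale_pos[of "dist (f s) p"]
      by (meson less_imp_le order_trans zero_le_dist)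
  qed
qed

text \<open>Sampling at gaps of length \<open>\<kappa>\<close> balances both errors: consecutive
  samples are \<open>O(\<kappa>)\<close> apart, so interpolation by geodesics has bounded speed, and
  every time is within \<open>\<kappa>\<close> of a sample, so the interpolation stays close to
  \<open>f\<close>.\<close>

lemma tame_ray:
  fixes p :: "'a::metric_space"
  assumes geo: "\<And>x y::'a. \<exists>g. geodesic_segment g x y" and A: "1 \<le> A"
  obtains C where "1 \<le> C"
    "\<And>f. scale_ray p \<kappa> A f \<Longrightarrow> \<exists>v. v 0 = p \<and> Lipschitz_ray C v \<and> (\<forall>s\<ge>0. dist (v s) (f s) \<le> C * \<kappa> s)"
proof -
  obtain K where K: "0 \<le> K" "\<And>s. 0 \<le> s \<Longrightarrow> \<kappa> s \<le> 1 * s + K" using scale_small[of 1] by auto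
  obtain C1 where C1: "1 \<le> C1" "\<And>s t. 0 \<le> s \<Longrightarrow> 0 \<le> t \<Longrightarrow> t \<le> (2 + K) * s + (2 + K) \<Longrightarrow> \<kappa> t \<le> C1 * \<kappa> s"
    using scale_affine[of "2 + K"] K by auto
  define C2 where "C2 = A * (3 + C1)"
  have C2: "1 \<le> C2" "0 \<le> C2" using A C1 mult_mono[of 1 A 1 "3 + C1"] by (auto simp: C2_def)
  define \<tau> where "\<tau> k = ((\<lambda>t. t + \<kappa> t) ^^ k) 0" for k
  have tau0: "\<tau> 0 = 0" and tauS: "\<tau> (Suc k) = \<tau> k + \<kappa> (\<tau> k)" for k by (auto simp: \<tau>_def)
  have pos: "0 \<le> \<tau> k" for k
  proof (induction k)
    case (Suc k) then show ?case using scale_pos[of "\<tau> k"] by (simp add: tauS)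
  qed (simp add: tau0)
  have step: "\<tau> k + 1 \<le> \<tau> (Suc k)" for k using scale_ge_1[OF pos] by (simp add: tauS)
  have kS: "\<kappa> (\<tau> (Suc k)) \<le> C1 * \<kappa> (\<tau> k)" for k
  proof (rule C1(2)[OF pos pos])
    have "\<tau> (Suc k) \<le> 2 * \<tau> k + K" using K(2)[OF pos, of k] by (simp add: tauS)
    also have "\<dots> \<le> (2 + K) * \<tau> k + (2 + K)" using K(1) pos[of k] by (simp add: algebra_simps)
    finally show "\<tau> (Suc k) \<le> (2 + K) * \<tau> k + (2 + K)" .
  qed
  show ?thesis
  proof (rule that[of "C2 + 3 * A"])
    show "1 \<le> C2 + 3 * A" using A C2 by simp
    fix f assume f: "scale_ray p \<kappa> A f"
    \<comment> \<open>The first sample is moved to the basepoint, where a tight ray has to start;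
      this costs at most \<open>A\<close>.\<close>
    define x where "x k = (if k = 0 then p else f (\<tau> k))" for k
    have x: "dist (x k) (f (\<tau> k)) \<le> A" for k using scale_rayD(2)[OF f] A tau0 by (simp add: x_def dist_commute)
    have D: "dist (x k) (x (Suc k)) \<le> C2 * \<kappa> (\<tau> k)" for k
    proof -
      have "dist (x k) (x (Suc k)) \<le> dist (x k) (f (\<tau> k)) + dist (f (\<tau> k)) (f (\<tau> (Suc k)))"
        using dist_triangle[of "x k" "x (Suc k)" "f (\<tau> k)"] by (simp add: x_def)
      also have "\<dots> \<le> A + (A * \<kappa> (\<tau> k) + A * (C1 * \<kappa> (\<tau> k)))"
      proof -
        have "dist (f (\<tau> k)) (f (\<tau> (Suc k))) \<le> A * \<kappa> (\<tau> k) + A * \<kappa> (\<tau> (Suc k))"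
          using scale_rayD(3)[OF f pos pos, of k "Suc k"] scale_pos[OF pos, of k] step[of k]
          by (simp add: tauS max_def)
        moreover have "A * \<kappa> (\<tau> (Suc k)) \<le> A * (C1 * \<kappa> (\<tau> k))" using A kS by (intro mult_left_mono) auto
        ultimately show ?thesis using x[of k] by linarith
      qed
      also have "\<dots> \<le> A * \<kappa> (\<tau> k) + (A * \<kappa> (\<tau> k) + A * (C1 * \<kappa> (\<tau> k)))"
        using A scale_ge_1[OF pos, of k] by simp
      finally have "dist (x k) (x (Suc k)) \<le> A * (2 + C1) * \<kappa> (\<tau> k)" by (simp add: algebra_simps)
      also have "\<dots> \<le> C2 * \<kappa> (\<tau> k)"
        unfolding C2_def using A C1 scale_pos[OF pos, of k] by (intro mult_right_mono mult_left_mono) auto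
      finally show ?thesis .
    qed
    obtain v where v: "\<And>k. v (\<tau> k) = x k"
      "\<And>k s t. \<lbrakk>\<tau> k \<le> s; s \<le> \<tau> (Suc k); \<tau> k \<le> t; t \<le> \<tau> (Suc k)\<rbrakk> \<Longrightarrow>
         dist (v s) (v t) = \<bar>s - t\<bar> * (dist (x k) (x (Suc k)) / (\<tau> (Suc k) - \<tau> k))"
      using piecewise_geodesic[of \<tau> x, OF geo tau0 step] by metis
    have piece: "dist (v s) (v t) \<le> C2 * (t - s)" if st: "\<tau> k \<le> s" "s \<le> t" "t \<le> \<tau> (Suc k)" for k s t
    proof -
      have "dist (v s) (v t) = (t - s) * (dist (x k) (x (Suc k)) / \<kappa> (\<tau> k))" using v(2)[of k s t] st by (simp add: tauS)
      also have "\<dots> \<le> (t - s) * C2" using D[of k] scale_pos[OF pos, of k] st by (intro mult_left_mono) (auto simp: field_simps)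
      finally show ?thesis by (simp add: mult.commute)
    qed
    have lip: "dist (v s) (v t) \<le> C2 * \<bar>s - t\<bar>" if "0 \<le> s" "0 \<le> t" for s t
      by (rule piecewise_Lipschitz[of \<tau>, OF tau0 step]) (use piece that in auto)
    show "\<exists>v. v 0 = p \<and> Lipschitz_ray (C2 + 3 * A) v \<and> (\<forall>s\<ge>0. dist (v s) (f s) \<le> (C2 + 3 * A) * \<kappa> s)"
    proof (intro exI[of _ v] conjI allI impI)
      show "v 0 = p" using v(1)[of 0] tau0 by (simp add: x_def)
      show "Lipschitz_ray (C2 + 3 * A) v" unfolding Lipschitz_ray_def
      proof (intro allI impI)
        fix s t :: real assume "0 \<le> s" "0 \<le> t"
        then have "dist (v s) (v t) \<le> C2 * \<bar>s - t\<bar>" by (rule lip)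
        also have "\<dots> \<le> (C2 + 3 * A) * \<bar>s - t\<bar>" using A by (intro mult_right_mono) auto
        finally show "dist (v s) (v t) \<le> (C2 + 3 * A) * \<bar>s - t\<bar>" .
      qed
      fix s :: real assume s: "0 \<le> s"
      obtain k where k: "\<tau> k \<le> s" "s < \<tau> (Suc k)" using locate_in_partition[of \<tau> s, OF tau0 step] s by blast
      have sk: "s - \<tau> k \<le> \<kappa> s" using k scale_mono[OF pos k(1)] by (simp add: tauS)
      have "dist (v s) (x k) \<le> C2 * \<kappa> s"
      proof -
        have "dist (v s) (x k) \<le> C2 * (s - \<tau> k)" using lip[OF s pos, of k] v(1)[of k] k by simp
        also have "\<dots> \<le> C2 * \<kappa> s" using C2 sk by (intro mult_left_mono) auto
        finally show ?thesis .
      qed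
      moreover have "dist (f (\<tau> k)) (f s) \<le> A * \<kappa> s + A * \<kappa> s"
      proof -
        have "dist (f (\<tau> k)) (f s) \<le> A * (s - \<tau> k) + A * \<kappa> s"
          using scale_rayD(3)[OF f pos s, of k] k by (simp add: max_def)
        also have "A * (s - \<tau> k) \<le> A * \<kappa> s" using A sk by (intro mult_left_mono) auto
        finally show ?thesis by simp
      qed
      moreover have "A \<le> A * \<kappa> s" using A scale_ge_1[OF s] by simp
      ultimately have "dist (v s) (f s) \<le> C2 * \<kappa> s + A * \<kappa> s + (A * \<kappa> s + A * \<kappa> s)"
        using x[of k] dist_triangle[of "v s" "f s" "x k"] dist_triangle[of "x k" "f s" "f (\<tau> k)"] by linarith
      then show "dist (v s) (f s) \<le> (C2 + 3 * A) * \<kappa> s" by (simp add: algebra_simps)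
    qed
  qed
qed

lemma straighten_ray:
  fixes p :: "'a::metric_space"
  assumes geo: "\<And>x y::'a. \<exists>g. geodesic_segment g x y" and A: "1 \<le> A"
  obtains B C where "1 \<le> B" "1 \<le> C"
    "\<And>f. scale_ray p \<kappa> A f \<Longrightarrow> \<exists>\<gamma>. tight_ray B p \<gamma> \<and> (\<forall>s\<ge>0. dist (\<gamma> s) (f s) \<le> C * \<kappa> s)"
proof -
  obtain C0 where C0: "1 \<le> C0"
    "\<And>f. scale_ray p \<kappa> A f \<Longrightarrow> \<exists>v. v 0 = p \<and> Lipschitz_ray C0 v \<and> (\<forall>s\<ge>0. dist (v s) (f s) \<le> C0 * \<kappa> s)"
    using tame_ray[OF geo A] by metis
  define C2 where "C2 = 2 * A * C0 + A"
  have C2: "1 \<le> C2" using A C0 mult_mono[of 1 A 1 C0] by (simp add: C2_def)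
  obtain K where K: "0 \<le> K" "\<And>s. 0 \<le> s \<Longrightarrow> \<kappa> s \<le> 1 / (4 * C2) * s + K"
    using scale_small[of "1/(4*C2)"] C2 by auto
  have CK: "C2 * \<kappa> s \<le> s / 4 + C2 * K" if "0 \<le> s" for s
    using K(2)[OF that] C2 mult_left_mono[of "\<kappa> s" "1 / (4 * C2) * s + K" C2] by (simp add: field_simps)
  have C2K: "0 \<le> C2 * K" using C2 K by simp
  define c where "c = 2 + 4 * (C2 * K) + 8 * A"
  have c: "0 \<le> c" using C2K A by (simp add: c_def)
  obtain C3 where C3: "1 \<le> C3" "\<And>s t. 0 \<le> s \<Longrightarrow> 0 \<le> t \<Longrightarrow> t \<le> c * s + c \<Longrightarrow> \<kappa> t \<le> C3 * \<kappa> s"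
    using scale_affine[OF c] by auto
  define C4 where "C4 = 2 * C2 * C3 + 4 * A"
  have C4: "0 \<le> C4" using A C2 C3 by (simp add: C4_def)
  show ?thesis
  proof (rule that[of "2 * C0 * (2 * A)" "2 * C0 * C4 + C0"])
    show "1 \<le> 2 * C0 * (2 * A)" using C0 A mult_mono[of 1 C0 1 A] by simp
    have "0 \<le> C0 * C4" using C0(1) C4 by simp
    then show "1 \<le> 2 * C0 * C4 + C0" using C0(1) by linarith
    fix f assume f: "scale_ray p \<kappa> A f"
    then obtain v where v: "v 0 = p" "Lipschitz_ray C0 v" "\<And>s. 0 \<le> s \<Longrightarrow> dist (v s) (f s) \<le> C0 * \<kappa> s"
      using C0(2) by blast
    have est: "b - a \<le> A * dist (v a) (v b) + C2 * \<kappa> b" if ab: "0 \<le> a" "a \<le> b" for a b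
    proof -
      have b: "0 \<le> b" using ab by simp
      have "b - a \<le> A * dist (f a) (f b) + A * \<kappa> b" using scale_rayD(4)[OF f ab(1) b] ab by simp
      moreover have "dist (f a) (f b) \<le> dist (v a) (v b) + C0 * \<kappa> b + C0 * \<kappa> b"
      proof -
        have "C0 * \<kappa> a \<le> C0 * \<kappa> b" using scale_mono[OF ab] C0 by (intro mult_left_mono) auto
        then show ?thesis using v(3)[OF ab(1)] v(3)[OF b] dist_triangle[of "f a" "f b" "v a"]
            dist_triangle[of "v a" "f b" "v b"] by (simp add: dist_commute)
      qed
      then have "A * dist (f a) (f b) \<le> A * (dist (v a) (v b) + C0 * \<kappa> b + C0 * \<kappa> b)" using A by (intro mult_left_mono) auto
      ultimately show ?thesis by (simp add: C2_def algebra_simps)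
    qed
    \<comment> \<open>A fraction of \<open>b\<close> absorbs the error at \<open>b\<close>, at the
      price of doubling \<open>A\<close> and of an additive error that depends on
      \<open>a\<close>.\<close>
    have coarse: "\<exists>E. \<forall>b\<ge>a. b - a \<le> (2 * A) * dist (v a) (v b) + E" if a: "0 \<le> a" for a
    proof (intro exI allI impI)
      fix b assume "a \<le> b"
      then show "b - a \<le> (2 * A) * dist (v a) (v b) + (a + 2 * (C2 * K))" using est[OF a, of b] CK[of b] a by (simp add: algebra_simps)
    qed
    have "1 \<le> 2 * A" using A by simp
    from greedy_straighten[OF geo v(1,2) C0(1) this coarse]
    obtain \<gamma> where g: "tight_ray (2 * C0 * (2 * A)) p \<gamma>"
      "\<And>s. 0 \<le> s \<Longrightarrow> \<exists>a b. 0 \<le> a \<and> a \<le> s \<and> s \<le> b \<and> 2 * (2 * A) * (dist (v a) (v b) - 1) \<le> b - a \<and>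
        dist (\<gamma> s) (v s) \<le> 2 * C0 * (b - a)" by metis
    have "dist (\<gamma> s) (f s) \<le> (2 * C0 * C4 + C0) * \<kappa> s" if s: "0 \<le> s" for s
    proof -
      obtain a b where ab: "0 \<le> a" "a \<le> s" "s \<le> b" "2 * (2 * A) * (dist (v a) (v b) - 1) \<le> b - a"
        "dist (\<gamma> s) (v s) \<le> 2 * C0 * (b - a)" using g(2)[OF s] by blast
      have 1: "b - a \<le> A * dist (v a) (v b) + C2 * \<kappa> b" using est[of a b] ab by simp
      have 2: "4 * (A * dist (v a) (v b)) - 4 * A \<le> b - a" using ab(4) by (simp add: algebra_simps)
      have 3: "0 \<le> C2 * \<kappa> b" using C2 scale_pos[of b] ab by simp
      have 4: "b - a \<le> 2 * (C2 * \<kappa> b) + 4 * A" using 1 2 3 A by linarith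
      \<comment> \<open>So far the jump is bounded by \<open>\<kappa>\<close> at its end
        \<open>b\<close>. With slope \<open>1 / 4\<close> this bound gives that \<open>b\<close> is
        at most \<open>2 * a\<close> plus a constant, hence linear in \<open>s\<close>, and
        \<open>\<kappa> b\<close> becomes \<open>O(\<kappa> s)\<close>.\<close>
      have "C2 * \<kappa> b \<le> b / 4 + C2 * K" using CK[of b] ab by simp
      then have "b \<le> 2 * a + 4 * (C2 * K) + 8 * A" using 4 by linarith
      also have "\<dots> \<le> c * s + c"
      proof -
        have "2 * a \<le> c * s" using ab c C2K A by (intro mult_mono) (auto simp: c_def)
        then show ?thesis by (simp add: c_def)
      qed
      finally have "\<kappa> b \<le> C3 * \<kappa> s" using C3(2)[OF s] ab s by simp
      then have "2 * C2 * \<kappa> b \<le> 2 * C2 * (C3 * \<kappa> s)" using C2 by (intro mult_left_mono) auto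
      moreover have "4 * A \<le> 4 * A * \<kappa> s" using A scale_ge_1[OF s] by simp
      ultimately have "b - a \<le> C4 * \<kappa> s" using 4 by (simp add: C4_def algebra_simps)
      then have "2 * C0 * (b - a) \<le> 2 * C0 * (C4 * \<kappa> s)" using C0 by (intro mult_left_mono) auto
      then show ?thesis using ab(5) v(3)[OF s] dist_triangle[of "\<gamma> s" "f s" "v s"] by (simp add: algebra_simps)
    qed
    then show "\<exists>\<gamma>. tight_ray (2 * C0 * (2 * A)) p \<gamma> \<and> (\<forall>s\<ge>0. dist (\<gamma> s) (f s) \<le> (2 * C0 * C4 + C0) * \<kappa> s)"
      using g(1) by blast
  qed
qed

end

section \<open>Sublinearly close rays\<close>

text \<open>Only \<open>f\<close> is asked to stay near \<open>g\<close>, without control of the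
  parameters. For coarse rays from a common basepoint the parameters turn out comparable
  (\<open>sublinearly_close_witness\<close>) and the relation symmetric
  (\<open>sublinearly_close_sym\<close>).\<close>

definition sublinearly_close :: "(real \<Rightarrow> real) \<Rightarrow> (real \<Rightarrow> 'a::metric_space) \<Rightarrow> (real \<Rightarrow> 'a) \<Rightarrow> bool" where
  "sublinearly_close \<kappa> f g \<longleftrightarrow> (\<exists>M. \<forall>s\<ge>0. infdist (f s) (ray_image g) \<le> M * \<kappa> s)"

lemma infdist_ray_image_le: "0 \<le> u \<Longrightarrow> infdist x (ray_image g) \<le> dist x (g u)"
  by (rule infdist_le) (simp add: ray_image_def)

lemma infdist_ray_image_approx:
  assumes "0 < e"
  obtains u where "0 \<le> u" "dist x (g u) \<le> infdist x (ray_image g) + e"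
proof -
  have ne: "ray_image g \<noteq> {}" by (auto simp: ray_image_def)
  have "(INF y\<in>ray_image g. dist x y) < infdist x (ray_image g) + e"
    using ne assms by (simp add: infdist_notempty)
  then have "\<exists>y\<in>ray_image g. dist x y < infdist x (ray_image g) + e"
    using ne by (subst (asm) cINF_less_iff) auto
  then show ?thesis using that by (force simp: ray_image_def)
qed

lemma sublinearly_closeI:
  assumes "\<And>s. 0 \<le> s \<Longrightarrow> \<exists>u\<ge>0. dist (f s) (g u) \<le> M * \<kappa> s"
  shows "sublinearly_close \<kappa> f g"
  unfolding sublinearly_close_def using assms infdist_ray_image_le order_trans by metis

context sublinear_scale
begin

lemma tight_ray_scale_ray:
  assumes "tight_ray B p f"
  shows "scale_ray p \<kappa> (2 * B) f"
  using quasi_geodesic_scale_ray[OF tight_ray_quasi_geodesic[OF assms], of "2 * B"] by simp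

text \<open>The points \<open>f s\<close> and \<open>g u\<close> have comparable norms, their
  distance \<open>O(\<kappa> s)\<close> being absorbed by a fraction of \<open>s\<close>; on coarse
  rays, norms determine times up to affine distortion.\<close>

lemma sublinearly_close_witness:
  assumes f: "scale_ray p \<kappa> A f" and g: "scale_ray p \<kappa> A' g" and fg: "sublinearly_close \<kappa> f g"
  obtains C where "1 \<le> C"
    "\<And>s. 0 \<le> s \<Longrightarrow> \<exists>u\<ge>0. dist (f s) (g u) \<le> C * \<kappa> s \<and> u \<le> C * s + C \<and> s \<le> C * u + C \<and> \<kappa> u \<le> C * \<kappa> s \<and> \<kappa> s \<le> C * \<kappa> u"
proof -
  obtain M0 where M0: "\<And>s. 0 \<le> s \<Longrightarrow> infdist (f s) (ray_image g) \<le> M0 * \<kappa> s"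
    using fg by (auto simp: sublinearly_close_def)
  define M where "M = \<bar>M0\<bar> + 1"
  have M: "1 \<le> M" by (simp add: M_def)
  define A0 where "A0 = max A A'"
  have f': "scale_ray p \<kappa> A0 f" and g': "scale_ray p \<kappa> A0 g"
    using scale_ray_mono[OF f] scale_ray_mono[OF g] by (auto simp: A0_def)
  obtain C0 where C0: "1 \<le> C0"
    "\<And>p::'a. \<And>f s. scale_ray p \<kappa> A0 f \<Longrightarrow> 0 \<le> s \<Longrightarrow> dist (f s) p \<le> C0 * s + C0"
    "\<And>p::'a. \<And>f s. scale_ray p \<kappa> A0 f \<Longrightarrow> 0 \<le> s \<Longrightarrow> s \<le> C0 * dist (f s) p + C0"
    using scale_ray_norm[OF scale_rayD(1)[OF f']] by metis
  have CM: "1 \<le> C0 * M" using C0(1) M mult_mono[of 1 C0 1 M] by simp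
  obtain K where K: "0 \<le> K" "\<And>s. 0 \<le> s \<Longrightarrow> \<kappa> s \<le> 1 / (2 * (C0 * M)) * s + K"
    using scale_small[of "1 / (2 * (C0 * M))"] CM by auto
  have KC: "C0 * (M * \<kappa> s) \<le> s / 2 + C0 * M * K" if "0 \<le> s" for s
  proof -
    have "D * x \<le> s / 2 + D * K" if "x \<le> 1 / (2 * D) * s + K" "1 \<le> D" for D x
      using that mult_left_mono[of x "1 / (2 * D) * s + K" D] by (simp add: field_simps)
    from this[OF K(2)[OF that] CM] show ?thesis by (simp add: mult.assoc)
  qed
  define c where "c = 2 * C0 * C0 + 2 * C0 + 2 * (C0 * M * K) + 1"
  have CC: "0 \<le> C0 * C0" "0 \<le> C0 * M * K" using C0(1) CM K by auto
  have c: "1 \<le> c" "C0 * C0 + 1 \<le> c" "2 * C0 * C0 \<le> c" "2 * (C0 * C0) + 2 * C0 + 2 * (C0 * M * K) \<le> c"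
    "C0 * C0 + C0 + C0 * M * K \<le> c"
    unfolding c_def using CC C0(1) by linarith+
  obtain C1 where C1: "1 \<le> C1" "\<And>s t. 0 \<le> s \<Longrightarrow> 0 \<le> t \<Longrightarrow> t \<le> c * s + c \<Longrightarrow> \<kappa> t \<le> C1 * \<kappa> s"
    using scale_affine[of c] c by auto
  define C where "C = max M (max c C1)"
  have C: "M \<le> C" "c \<le> C" "C1 \<le> C" "1 \<le> C" using M by (auto simp: C_def)
  show ?thesis
  proof (rule that[OF C(4)])
    fix s :: real assume s: "0 \<le> s"
    have k: "1 \<le> \<kappa> s" by (rule scale_ge_1[OF s])
    obtain u where u: "0 \<le> u" "dist (f s) (g u) \<le> infdist (f s) (ray_image g) + 1"
      by (rule infdist_ray_image_approx[of 1]) auto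
    have "infdist (f s) (ray_image g) \<le> \<bar>M0\<bar> * \<kappa> s" using k by (intro order_trans[OF M0[OF s]] mult_right_mono) auto
    then have d: "dist (f s) (g u) \<le> M * \<kappa> s" using u(2) k by (simp add: M_def algebra_simps)
    then have Cd: "C0 * dist (f s) (g u) \<le> s / 2 + C0 * M * K"
      using KC[OF s] C0(1) mult_left_mono[OF d, of C0] by linarith
    have "u \<le> C0 * dist (g u) p + C0" using C0(3)[OF g' u(1)] .
    also have "C0 * dist (g u) p \<le> C0 * (dist (f s) p + dist (f s) (g u))"
      using C0(1) dist_triangle[of "g u" p "f s"] by (intro mult_left_mono) (auto simp: dist_commute)
    also have "\<dots> \<le> C0 * (C0 * s + C0) + (s / 2 + C0 * M * K)"
      using Cd C0(2)[OF f' s] C0(1) mult_left_mono[of "dist (f s) p" "C0 * s + C0" C0] by (simp add: algebra_simps)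
    finally have "u \<le> (C0 * C0 + 1) * s + (C0 * C0 + C0 + C0 * M * K)" using s by (simp add: algebra_simps)
    also have "\<dots> \<le> c * s + c" using c s by (intro add_mono mult_right_mono) auto
    finally have us: "u \<le> c * s + c" .
    have "s \<le> C0 * dist (f s) p + C0" using C0(3)[OF f' s] .
    also have "C0 * dist (f s) p \<le> C0 * (dist (g u) p + dist (f s) (g u))"
      using C0(1) dist_triangle[of "f s" p "g u"] by (intro mult_left_mono) (auto simp: dist_commute)
    also have "\<dots> \<le> C0 * (C0 * u + C0) + (s / 2 + C0 * M * K)"
      using Cd C0(2)[OF g' u(1)] C0(1) mult_left_mono[of "dist (g u) p" "C0 * u + C0" C0] by (simp add: algebra_simps)
    finally have "s \<le> 2 * C0 * C0 * u + (2 * (C0 * C0) + 2 * C0 + 2 * (C0 * M * K))" by (simp add: algebra_simps)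
    also have "\<dots> \<le> c * u + c" using c u by (intro add_mono mult_right_mono) auto
    finally have su: "s \<le> c * u + c" .
    have m: "c * x + c \<le> C * x + C" if "0 \<le> x" for x using C that by (intro add_mono mult_right_mono) auto
    have m1: "C1 * \<kappa> x \<le> C * \<kappa> x" if "0 \<le> x" for x using C scale_pos[OF that] by (intro mult_right_mono) auto
    have "dist (f s) (g u) \<le> C * \<kappa> s" using d C k mult_right_mono[of M C "\<kappa> s"] by linarith
    moreover have "u \<le> C * s + C" "s \<le> C * u + C" using us su m[OF s] m[OF u(1)] by auto
    moreover have "\<kappa> u \<le> C * \<kappa> s" "\<kappa> s \<le> C * \<kappa> u"
      using C1(2)[OF s u(1) us] C1(2)[OF u(1) s su] m1[OF s] m1[OF u(1)] by auto
    ultimately show "\<exists>u\<ge>0. dist (f s) (g u) \<le> C * \<kappa> s \<and> u \<le> C * s + C \<and> s \<le> C * u + C \<and> \<kappa> u \<le> C * \<kappa> s \<and> \<kappa> s \<le> C * \<kappa> u"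
      using u(1) by blast
  qed
qed

lemma sublinearly_close_refl: "sublinearly_close \<kappa> f f"
proof (rule sublinearly_closeI[where M = 0])
  show "\<exists>u\<ge>0. dist (f s) (f u) \<le> 0 * \<kappa> s" if "0 \<le> s" for s using that by (intro exI[of _ s]) auto
qed

lemma sublinearly_close_trans:
  assumes f: "scale_ray p \<kappa> A f" and g: "scale_ray p \<kappa> A' g"
    and fg: "sublinearly_close \<kappa> f g" and gh: "sublinearly_close \<kappa> g h"
  shows "sublinearly_close \<kappa> f h"
proof -
  obtain C where C: "1 \<le> C"
    "\<And>s. 0 \<le> s \<Longrightarrow> \<exists>u\<ge>0. dist (f s) (g u) \<le> C * \<kappa> s \<and> u \<le> C * s + C \<and> s \<le> C * u + C \<and> \<kappa> u \<le> C * \<kappa> s \<and> \<kappa> s \<le> C * \<kappa> u"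
    by (rule sublinearly_close_witness[OF f g fg]) blast
  obtain M where M: "\<And>s. 0 \<le> s \<Longrightarrow> infdist (g s) (ray_image h) \<le> M * \<kappa> s"
    using gh by (auto simp: sublinearly_close_def)
  have "infdist (f s) (ray_image h) \<le> (\<bar>M\<bar> * C + C) * \<kappa> s" if s: "0 \<le> s" for s
  proof -
    obtain u where u: "0 \<le> u" "dist (f s) (g u) \<le> C * \<kappa> s" "\<kappa> u \<le> C * \<kappa> s" using C(2)[OF s] by blast
    have "infdist (g u) (ray_image h) \<le> \<bar>M\<bar> * \<kappa> u"
      using M[OF u(1)] mult_right_mono[OF abs_ge_self[of M] less_imp_le[OF scale_pos[OF u(1)]]] by linarith
    also have "\<dots> \<le> \<bar>M\<bar> * (C * \<kappa> s)" using u by (intro mult_left_mono) auto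
    finally show ?thesis using u(2) infdist_triangle[of "f s" "ray_image h" "g u"] by (simp add: algebra_simps)
  qed
  then show ?thesis by (auto simp: sublinearly_close_def)
qed

text \<open>A discrete intermediate value argument. The parameters \<open>U n\<close> shadowing the
  integer times tend to infinity, and consecutive ones differ by \<open>O(\<kappa> n)\<close>
  because the corresponding points of \<open>g\<close> do. Hence every \<open>u\<close> beyond
  \<open>U 0\<close> lies just below some \<open>U n\<close>, and \<open>g u\<close> is
  \<open>O(\<kappa> n)\<close>-close to \<open>f n\<close>.\<close>

lemma sublinearly_close_sym:
  assumes f: "scale_ray p \<kappa> A f" and g: "scale_ray p \<kappa> A' g"
    and fg: "sublinearly_close \<kappa> f g"
  shows "sublinearly_close \<kappa> g f"
proof -
  have A: "1 \<le> A" "1 \<le> A'" using scale_rayD(1) f g by auto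
  obtain C where C: "1 \<le> C"
    "\<And>s. 0 \<le> s \<Longrightarrow> \<exists>u\<ge>0. dist (f s) (g u) \<le> C * \<kappa> s \<and> u \<le> C * s + C \<and> s \<le> C * u + C \<and> \<kappa> u \<le> C * \<kappa> s \<and> \<kappa> s \<le> C * \<kappa> u"
    by (rule sublinearly_close_witness[OF f g fg]) blast
  then have "\<forall>n::nat. \<exists>u\<ge>0. dist (f n) (g u) \<le> C * \<kappa> n \<and> n \<le> C * u + C \<and> \<kappa> u \<le> C * \<kappa> n"
    by (meson of_nat_0_le_iff)
  then obtain U where U: "\<And>n::nat. 0 \<le> U n" "\<And>n::nat. dist (f n) (g (U n)) \<le> C * \<kappa> n"
    "\<And>n::nat. n \<le> C * U n + C" "\<And>n::nat. \<kappa> (U n) \<le> C * \<kappa> n" by metis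
  obtain C5 where C5: "1 \<le> C5" "\<And>s t. 0 \<le> s \<Longrightarrow> 0 \<le> t \<Longrightarrow> t \<le> (C + 1) * s + (C + 1) \<Longrightarrow> \<kappa> t \<le> C5 * \<kappa> s"
    using scale_affine[of "C+1"] C(1) by auto
  define C6 where "C6 = A' * (A' * (2 * C + 2 * A) + A' * C) + A' * C + C"
  have C6: "0 \<le> C6" using A C(1) by (simp add: C6_def)
  define D where "D = A' * U 0 + A' * (C * \<kappa> 0) + C * \<kappa> 0"
  have D: "0 \<le> D" using A C(1) U(1)[of 0] scale_pos[of 0] by (simp add: D_def)
  show ?thesis
  proof (rule sublinearly_closeI[where M = "C6 * C5 + D"])
    fix u :: real assume u: "0 \<le> u"
    have k: "1 \<le> \<kappa> u" by (rule scale_ge_1[OF u])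
    obtain n0 :: nat where "C * u + C \<le> n0" using real_arch_simple by blast
    then have "C * u + C \<le> C * U n0 + C" using U(3)[of n0] by linarith
    then have ex: "u \<le> U n0" using C(1) by simp
    define n where "n = (LEAST n. u \<le> U n)"
    have n: "u \<le> U n" unfolding n_def using ex by (rule LeastI)
    show "\<exists>s\<ge>0. dist (g u) (f s) \<le> (C6 * C5 + D) * \<kappa> u"
    proof (cases n)
      case 0
      \<comment> \<open>Nothing precedes \<open>U 0\<close>, so there is no gap to estimate;
        \<open>U 0\<close> is a fixed number, which \<open>D\<close> accounts for.\<close>
      have "dist (g u) (g (U 0)) \<le> A' * (U 0 - u) + A' * \<kappa> (U 0)"
        using scale_rayD(3)[OF g u U(1), of 0] n 0 by (simp add: max_def)
      also have "A' * (U 0 - u) \<le> A' * U 0" using A u by (intro mult_left_mono) auto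
      also have "A' * \<kappa> (U 0) \<le> A' * (C * \<kappa> 0)" using A U(4)[of 0] by (intro mult_left_mono) auto
      finally have "dist (g u) (f 0) \<le> D"
        using U(2)[of 0] dist_triangle[of "g u" "f 0" "g (U 0)"] by (simp add: D_def dist_commute)
      also have "D \<le> D * \<kappa> u" using D k mult_left_mono[OF k D] by simp
      also have "\<dots> \<le> (C6 * C5 + D) * \<kappa> u" using C6 C5 k by (intro mult_right_mono) auto
      finally show ?thesis by (intro exI[of _ 0]) simp
    next
      case (Suc m)
      have um: "U m < u" using not_less_Least[of m "\<lambda>n. u \<le> U n"] Suc by (simp add: n_def)
      have kn: "\<kappa> n \<le> C5 * \<kappa> u"
      proof (rule C5(2)[OF u])
        have "C * U m \<le> C * u" using um C(1) by simp
        then show "real n \<le> (C + 1) * u + (C + 1)" using U(3)[of m] Suc u by (simp add: algebra_simps)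
      qed simp
      have km: "\<kappa> m \<le> \<kappa> n" using Suc by (intro scale_mono) auto
      have kn1: "1 \<le> \<kappa> n" by (rule scale_ge_1) simp
      have "dist (f n) (f m) \<le> A * 1 + A * \<kappa> n" using scale_rayD(3)[OF f, of n m] Suc by (simp add: max_def)
      moreover have "A * 1 \<le> A * \<kappa> n" using A kn1 by (intro mult_left_mono) auto
      moreover have "C * \<kappa> m \<le> C * \<kappa> n" using C(1) km by (intro mult_left_mono) auto
      ultimately have dU: "dist (g (U n)) (g (U m)) \<le> (2 * C + 2 * A) * \<kappa> n"
        using U(2)[of n] U(2)[of m] dist_triangle[of "g (U n)" "g (U m)" "f n"] dist_triangle[of "f n" "g (U m)" "f m"]
        by (simp add: dist_commute algebra_simps)
      have kU: "A' * \<kappa> (U n) \<le> A' * (C * \<kappa> n)" using A U(4)[of n] by (intro mult_left_mono) auto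
      have "U n - u \<le> U n - U m" using um by simp
      also have "\<dots> \<le> A' * dist (g (U n)) (g (U m)) + A' * \<kappa> (U n)"
        using scale_rayD(4)[OF g U(1) U(1), of n m] um n by (simp add: max_def)
      also have "A' * dist (g (U n)) (g (U m)) \<le> A' * ((2 * C + 2 * A) * \<kappa> n)" using A dU by (intro mult_left_mono) auto
      finally have Un: "U n - u \<le> (A' * (2 * C + 2 * A) + A' * C) * \<kappa> n" using kU by (simp add: algebra_simps)
      have "dist (g u) (g (U n)) \<le> A' * (U n - u) + A' * \<kappa> (U n)"
        using scale_rayD(3)[OF g u U(1), of n] n by (simp add: max_def)
      also have "A' * (U n - u) \<le> A' * ((A' * (2 * C + 2 * A) + A' * C) * \<kappa> n)" using A Un by (intro mult_left_mono) auto
      finally have "dist (g u) (f n) \<le> C6 * \<kappa> n"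
        using kU U(2)[of n] dist_triangle[of "g u" "f n" "g (U n)"] by (simp add: C6_def dist_commute algebra_simps)
      also have "\<dots> \<le> C6 * (C5 * \<kappa> u)" using C6 kn by (intro mult_left_mono) auto
      also have "\<dots> \<le> (C6 * C5 + D) * \<kappa> u" using D k by (simp add: algebra_simps)
      finally show ?thesis by (intro exI[of _ "real n"]) simp
    qed
  qed
qed

end

section \<open>Joining a ray to a second ray that it approaches\<close>

lemma Lipschitz_glue:
  fixes v :: "real \<Rightarrow> 'a::metric_space"
  assumes "\<And>s t. 0 \<le> s \<Longrightarrow> s \<le> t \<Longrightarrow> t \<le> c \<Longrightarrow> dist (v s) (v t) \<le> B * (t - s)"
    and "\<And>s t. c \<le> s \<Longrightarrow> s \<le> t \<Longrightarrow> t \<le> c' \<Longrightarrow> dist (v s) (v t) \<le> B * (t - s)"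
    and "0 \<le> s" "s \<le> t" "t \<le> c'"
  shows "dist (v s) (v t) \<le> B * (t - s)"
proof -
  consider "t \<le> c" | "c \<le> s" | "s \<le> c" "c \<le> t" by linarith
  then show ?thesis
  proof cases
    case 3
    then have "dist (v s) (v c) \<le> B * (c - s)" "dist (v c) (v t) \<le> B * (t - c)" using assms by auto
    then show ?thesis using dist_triangle[of "v s" "v t" "v c"] by (simp add: algebra_simps)
  qed (use assms in auto)
qed

lemma tight_rayD:
  assumes "tight_ray B p f"
  shows "1 \<le> B" "f 0 = p" "Lipschitz_ray B f"
    "0 \<le> s \<Longrightarrow> 0 \<le> t \<Longrightarrow> dist (f s) (f t) \<le> B * \<bar>s - t\<bar>"
    "0 \<le> s \<Longrightarrow> 0 \<le> t \<Longrightarrow> \<bar>s - t\<bar> \<le> B * dist (f s) (f t) + B"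
    "0 \<le> s \<Longrightarrow> dist (f s) p \<le> B * s"
    "0 \<le> s \<Longrightarrow> s \<le> B * dist (f s) p + B"
proof -
  show 1: "1 \<le> B" "f 0 = p" "Lipschitz_ray B f"
    "0 \<le> s \<Longrightarrow> 0 \<le> t \<Longrightarrow> dist (f s) (f t) \<le> B * \<bar>s - t\<bar>"
    "0 \<le> s \<Longrightarrow> 0 \<le> t \<Longrightarrow> \<bar>s - t\<bar> \<le> B * dist (f s) (f t) + B" for s t
    using assms by (auto simp: tight_ray_def Lipschitz_ray_def)
  show "0 \<le> s \<Longrightarrow> dist (f s) p \<le> B * s" "0 \<le> s \<Longrightarrow> s \<le> B * dist (f s) p + B"
    using 1(4)[of s 0] 1(5)[of s 0] 1(2) by auto
qed

text \<open>The path \<open>v\<close> follows \<open>f\<close> up to \<open>t\<close>, a geodesic to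
  \<open>\<eta> u\<close>, and then \<open>\<eta>\<close>. It may backtrack near the junction, so
  its additive error is not uniform, but the tightness constant obtained by straightening does not
  see this error. A uniform error is needed only from starting points
  \<open>a \<le> \<delta> * t\<close>, well before the junction, and there it holds because the
  junction is far from the basepoint. Beyond, \<open>\<gamma>\<close> stays near
  \<open>\<eta>\<close> with an uncontrolled constant \<open>C'\<close>.\<close>

lemma join_tight_rays:
  fixes p :: "'a::metric_space"
  assumes geo: "\<And>x y::'a. \<exists>g. geodesic_segment g x y" and B: "1 \<le> B"
  obtains \<epsilon> \<delta> W C where "0 < \<epsilon>" "0 < \<delta>" "1 \<le> W" "0 \<le> C"
    "\<And>f \<eta> t u. \<lbrakk>tight_ray B p f; tight_ray B p \<eta>; 0 \<le> t; 0 \<le> u; dist (f t) (\<eta> u) \<le> \<epsilon> * t\<rbrakk> \<Longrightarrow>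
       \<exists>\<gamma> C'. tight_ray W p \<gamma> \<and> (\<forall>s\<ge>0. s \<le> \<delta> * t \<longrightarrow> dist (\<gamma> s) (f s) \<le> C) \<and>
         (\<forall>s\<ge>0. infdist (\<gamma> s) (ray_image \<eta>) \<le> C')"
proof -
  \<comment> \<open>The factor \<open>2 * B\<close> converts a distance into the parameter
    \<open>w\<close> reached on \<open>\<eta>\<close>; the factor \<open>1 + 4 * (B * B)\<close>
    passes from \<open>w\<close> to the total elapsed time, which includes \<open>t\<close>.\<close>
  define q where "q = (1 + 4 * (B * B)) * (2 * B)"
  have BB: "B \<le> B * B" "1 \<le> B * B" using B mult_left_mono[OF B, of B] by (simp, linarith)
  have q: "10 * B \<le> q"
    unfolding q_def using B BB mult_right_mono[of 5 "1 + 4 * (B*B)" "2 * B"] by simp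
  have q1: "1 \<le> q" "B \<le> q" "4 * B \<le> q" using q B by auto
  \<comment> \<open>Small enough that \<open>B * (B * a)\<close> is at most half of \<open>u\<close>
    plus a constant in the last case of \<open>U\<close>, given \<open>a \<le> \<delta> * t\<close>
    and \<open>t_le\<close>.\<close>
  define \<delta> where "\<delta> = 1 / (4 * (B * B) * (B * B))"
  have \<delta>: "0 < \<delta>" "\<delta> \<le> 1 / 4" "B * B * \<delta> * (B * B) = 1 / 4"
    using BB mult_mono[of 1 "B*B" 1 "B*B"] by (auto simp: \<delta>_def field_simps)
  show ?thesis
  proof (rule that[of "1 / (4 * B)" \<delta> "2 * B * q" "2 * B * (10 * q)"])
    show "0 < 1 / (4 * B)" "0 < \<delta>" using B \<delta> by auto
    show "1 \<le> 2 * B * q" using B q1 mult_mono[of 1 B 1 q] by simp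
    show "0 \<le> 2 * B * (10 * q)" using B q1 by simp
    fix f \<eta> t u
    assume f: "tight_ray B p f" and \<eta>: "tight_ray B p \<eta>" and t: "0 \<le> t" and u: "0 \<le> u"
      and d: "dist (f t) (\<eta> u) \<le> 1 / (4 * B) * t"
    define l where "l = dist (f t) (\<eta> u)"
    have l: "0 \<le> l" "B * l \<le> t / 4" using d B by (auto simp: l_def field_simps)
    have l4: "l \<le> t / 4" using l B mult_right_mono[of 1 B l] by simp
    obtain g where g: "geodesic_segment g (f t) (\<eta> u)" using geo by blast
    define c where "c = t + l"
    have c: "0 \<le> c" "t \<le> c" using t l by (auto simp: c_def)
    define v where "v s = (if s \<le> t then f s else if s \<le> c then g (s - t) else \<eta> (u + s - c))" for s
    have v1: "v s = f s" if "s \<le> t" for s using that by (simp add: v_def)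
    have v2: "v s = g (s - t)" if "t \<le> s" "s \<le> c" for s
      using that g by (cases "s = t") (auto simp: v_def geodesic_segment_def)
    have v3: "v s = \<eta> (u + s - c)" if "c \<le> s" for s
    proof (cases "s = c")
      case True
      have "v s = g l" using v2[of s] True c by (simp add: c_def)
      then show ?thesis using g True by (simp add: geodesic_segment_def l_def)
    qed (use that c in \<open>auto simp: v_def\<close>)
    have v0: "v 0 = p" using v1[of 0] t tight_rayD(2)[OF f] by simp
    have L1: "dist (v s) (v s') \<le> B * (s' - s)" if "0 \<le> s" "s \<le> s'" "s' \<le> t" for s s'
      using tight_rayD(4)[OF f, of s s'] v1 that by simp
    have L2: "dist (v s) (v s') = s' - s" if "t \<le> s" "s \<le> s'" "s' \<le> c" for s s'
      using g that v2[of s] v2[of s'] unfolding geodesic_segment_def c_def l_def by auto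
    have L2': "dist (v s) (v s') \<le> B * (s' - s)" if "t \<le> s" "s \<le> s'" "s' \<le> c" for s s'
      using L2[OF that] that B mult_right_mono[of 1 B "s' - s"] by simp
    have L3: "dist (v s) (v s') \<le> B * (s' - s)" if "c \<le> s" "s \<le> s'" for s s'
      using tight_rayD(4)[OF \<eta>, of "u + s - c" "u + s' - c"] v3 that u by simp
    have L12: "dist (v s) (v s') \<le> B * (s' - s)" if "0 \<le> s" "s \<le> s'" "s' \<le> c" for s s'
      by (rule Lipschitz_glue[where c = t and c' = c]) (use L1 L2' that in auto)
    have L: "dist (v s) (v s') \<le> B * (s' - s)" if "0 \<le> s" "s \<le> s'" for s s'
      by (rule Lipschitz_glue[where c = c and c' = s']) (use L12 L3 that in auto)
    have lip: "Lipschitz_ray B v" unfolding Lipschitz_ray_def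
    proof (intro allI impI)
      fix s s' :: real assume "0 \<le> s" "0 \<le> s'"
      then show "dist (v s) (v s') \<le> B * \<bar>s - s'\<bar>"
        using L[of s s'] L[of s' s] by (cases "s \<le> s'") (auto simp: dist_commute)
    qed
    have norm_v: "dist (v s) p \<le> B * s" if "0 \<le> s" for s using L[of 0 s] that v0 by (simp add: dist_commute)
    define E where "E = B + B * (B * c) + c"
    have E0: "0 \<le> B * (B * c)" using B c by simp
    \<comment> \<open>A crude bound for every pair, with an error governed by the junction parameter
      \<open>c\<close>; it makes the jumps finite and gives the uncontrolled constant.\<close>
    have E: "b - a \<le> q * dist (v a) (v b) + E" if ab: "0 \<le> a" "a \<le> b" for a b
    proof -
      have qd: "B * dist (v a) (v b) \<le> q * dist (v a) (v b)" using q1 by (intro mult_right_mono) auto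
      consider "c \<le> a" | "b \<le> c" | "a \<le> c" "c \<le> b" by linarith
      then have "b - a \<le> B * dist (v a) (v b) + E"
      proof cases
        case 1
        then have "b - a \<le> B * dist (v a) (v b) + B"
          using tight_rayD(5)[OF \<eta>, of "u + a - c" "u + b - c"] v3 ab u by simp
        then show ?thesis using E0 c by (simp add: E_def)
      next
        case 2
        have "0 \<le> B * dist (v a) (v b)" using B by simp
        then show ?thesis using 2 ab B c E0 unfolding E_def by linarith
      next
        case 3
        have "u + b - c \<le> B * dist (v b) p + B" using tight_rayD(7)[OF \<eta>, of "u + b - c"] v3[OF 3(2)] u 3 by simp
        also have "B * dist (v b) p \<le> B * (dist (v a) (v b) + B * c)"
        proof -
          have "B * a \<le> B * c" using B 3 by simp
          then have "dist (v b) p \<le> dist (v a) (v b) + B * c"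
            using norm_v[OF ab(1)] dist_triangle[of "v b" p "v a"] dist_commute[of "v a" "v b"] by linarith
          then show ?thesis using B by (intro mult_left_mono) auto
        qed
        finally show ?thesis using u ab(1) by (simp add: E_def algebra_simps)
      qed
      then show ?thesis using qd by linarith
    qed
    \<comment> \<open>A start before \<open>t / 4\<close> stays well away from the connecting
      geodesic, whose length is at most \<open>t / 4\<close>; this is what makes the error
      \<open>4 * q\<close> independent of the junction.\<close>
    have U: "b - a \<le> q * dist (v a) (v b) + 4 * q" if ab: "0 \<le> a" "a \<le> \<delta> * t" "a \<le> b" for a b
    proof -
      have at: "a \<le> t / 4" using ab \<delta> t mult_right_mono[of \<delta> "1/4" t] by simp
      have d0: "0 \<le> dist (v a) (v b)" by simp
      have qd: "4 * (B * dist (v a) (v b)) \<le> q * dist (v a) (v b)" using q1(3) mult_right_mono[OF _ d0] by (simp flip: mult.assoc)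
      have Bd: "0 \<le> B * dist (v a) (v b)" using B by simp
      consider "b \<le> t" | "t \<le> b" "b \<le> c" | "c \<le> b" by linarith
      then show ?thesis
      proof cases
        case 1
        then have "b - a \<le> B * dist (v a) (v b) + B"
          using tight_rayD(5)[OF f, of a b] v1 ab by simp
        then show ?thesis using qd q1 Bd by linarith
      next
        case 2
        have "t - a \<le> B * dist (v a) (v t) + B" using tight_rayD(5)[OF f, of a t] v1[of a] v1[of t] ab at t by simp
        also have "B * dist (v a) (v t) \<le> B * (dist (v a) (v b) + l)"
          using B L2[of t b] 2 dist_triangle[of "v a" "v t" "v b"]
          by (intro mult_left_mono) (auto simp: dist_commute c_def)
        finally have "t - a \<le> B * dist (v a) (v b) + t / 4 + B" using l(2) by (simp add: algebra_simps)
        then have "t \<le> 2 * (B * dist (v a) (v b)) + 2 * B" using at by linarith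
        then show ?thesis using qd q1 2 ab(1) l4 t unfolding c_def by linarith
      next
        case 3
        \<comment> \<open>The norm of \<open>\<eta> w\<close> is at least about
          \<open>w / B\<close>, while that of \<open>v a\<close> is at most \<open>B * a\<close>, at
          most a fixed fraction of \<open>w\<close> up to constants; so the distance controls
          \<open>w\<close>, and \<open>w\<close> controls \<open>t\<close> through
          \<open>t_le\<close>.\<close>
        define w where "w = u + b - c"
        have w: "u \<le> w" "0 \<le> w" "v b = \<eta> w" using 3 u v3 by (auto simp: w_def)
        have "t \<le> B * dist (f t) p + B" using tight_rayD(7)[OF f t] .
        also have "B * dist (f t) p \<le> B * (B * u + l)"
          using B tight_rayD(6)[OF \<eta> u] dist_triangle[of "f t" p "\<eta> u"] by (intro mult_left_mono) (auto simp: l_def)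
        finally have "t \<le> B * (B * u) + t / 4 + B" using l(2) by (simp add: algebra_simps)
        moreover have BBu: "0 \<le> B * (B * u)" using B u by simp
        ultimately have t_le: "t \<le> 2 * (B * (B * u)) + 2 * B" using B by linarith
        have "w \<le> B * dist (v b) p + B" using tight_rayD(7)[OF \<eta> w(2)] w(3) by simp
        also have "B * dist (v b) p \<le> B * (dist (v a) (v b) + B * a)"
          using B norm_v[OF ab(1)] dist_triangle[of "v b" p "v a"] by (intro mult_left_mono) (auto simp: dist_commute)
        finally have w1: "w \<le> B * dist (v a) (v b) + B * (B * a) + B" by (simp add: algebra_simps)
        have "B * (B * a) \<le> B * (B * (\<delta> * (2 * (B * (B * u)) + 2 * B)))"
        proof -
          have "\<delta> * t \<le> \<delta> * (2 * (B * (B * u)) + 2 * B)" using \<delta> t_le by (intro mult_left_mono) auto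
          then show ?thesis using ab B by (intro mult_left_mono) auto
        qed
        also have "\<dots> = 2 * ((B * B * \<delta> * (B * B)) * u) + 2 * (B * B * \<delta> * B)" by (simp add: algebra_simps)
        also have "B * B * \<delta> * B \<le> B * B * \<delta> * (B * B)" using BB \<delta> B by (intro mult_left_mono) auto
        finally have "B * (B * a) \<le> u / 2 + 1 / 2" using \<delta>(3) by simp
        then have "w \<le> 2 * (B * dist (v a) (v b)) + 4 * B" using w1 w(1) B by linarith
        then have "(1 + 4 * (B * B)) * w \<le> (1 + 4 * (B * B)) * (2 * (B * dist (v a) (v b)) + 4 * B)" using BB by (intro mult_left_mono) auto
        then have "(1 + 4 * (B * B)) * w \<le> q * dist (v a) (v b) + 2 * q" by (simp add: q_def algebra_simps)
        moreover have "b - a \<le> (1 + 4 * (B * B)) * w + 4 * B"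
        proof -
          have "b - a \<le> w + 2 * t" using ab(1) l4 t u by (simp add: w_def c_def)
          also have "2 * t \<le> 4 * (B * (B * u)) + 4 * B" using t_le by simp
          also have "B * (B * u) \<le> B * (B * w)" using B w by (intro mult_left_mono) auto
          finally show ?thesis by (simp add: algebra_simps)
        qed
        ultimately show ?thesis using q1 by linarith
      qed
    qed
    have "\<exists>E. \<forall>b\<ge>a. b - a \<le> q * dist (v a) (v b) + E" if "0 \<le> a" for a using E[OF that] by blast
    from greedy_straighten[OF geo v0 lip B q1(1) this]
    obtain \<gamma> where \<gamma>: "tight_ray (2 * B * q) p \<gamma>"
      "\<And>s. 0 \<le> s \<Longrightarrow> \<exists>a b. 0 \<le> a \<and> a \<le> s \<and> s \<le> b \<and> 2 * q * (dist (v a) (v b) - 1) \<le> b - a \<and>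
        dist (\<gamma> s) (v s) \<le> 2 * B * (b - a)" by metis
    \<comment> \<open>A lower bound with error \<open>e\<close> and the jump condition together
      bound the jump; \<open>U\<close> then gives the uniform estimate \<open>near\<close>, and
      \<open>E\<close> the nonuniform estimate \<open>far\<close>.\<close>
    have gap: "b - a \<le> 2 * q + 2 * e" if "b - a \<le> q * x + e" "2 * q * (x - 1) \<le> b - a" for a b x e :: real
      using that by (simp add: algebra_simps)
    have near: "dist (\<gamma> s) (f s) \<le> 2 * B * (10 * q)" if s: "0 \<le> s" "s \<le> \<delta> * t" for s
    proof -
      obtain a b where ab: "0 \<le> a" "a \<le> s" "s \<le> b" "2 * q * (dist (v a) (v b) - 1) \<le> b - a"
        "dist (\<gamma> s) (v s) \<le> 2 * B * (b - a)" using \<gamma>(2)[OF s(1)] by blast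
      have "b - a \<le> 2 * q + 2 * (4 * q)" by (rule gap[OF U ab(4)]) (use ab s in auto)
      then have "2 * B * (b - a) \<le> 2 * B * (10 * q)" using B by (intro mult_left_mono) auto
      moreover have "s \<le> t" using s \<delta> t mult_right_mono[of \<delta> 1 t] by simp
      ultimately show ?thesis using ab(5) v1 by simp
    qed
    have far: "infdist (\<gamma> s) (ray_image \<eta>) \<le> 2 * B * (2 * q + 2 * E) + B * c" if s: "0 \<le> s" for s
    proof -
      obtain a b where ab: "0 \<le> a" "a \<le> s" "s \<le> b" "2 * q * (dist (v a) (v b) - 1) \<le> b - a"
        "dist (\<gamma> s) (v s) \<le> 2 * B * (b - a)" using \<gamma>(2)[OF s(1)] by blast
      have "b - a \<le> 2 * q + 2 * E" by (rule gap[OF E ab(4)]) (use ab s in auto)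
      then have "2 * B * (b - a) \<le> 2 * B * (2 * q + 2 * E)" using B by (intro mult_left_mono) auto
      moreover have "infdist (v s) (ray_image \<eta>) \<le> B * c"
      proof (cases "c \<le> s")
        case True
        have "0 \<le> B * c" using B c by simp
        then show ?thesis using True v3[OF True] infdist_ray_image_le[of "u + s - c" "v s" \<eta>] u by simp
      next
        case False
        then have "dist (v s) p \<le> B * c" using norm_v[OF s] B mult_left_mono[of s c B] by linarith
        then show ?thesis using infdist_ray_image_le[of 0 "v s" \<eta>] tight_rayD(2)[OF \<eta>] by simp
      qed
      ultimately show ?thesis using ab(5) infdist_triangle[of "\<gamma> s" "ray_image \<eta>" "v s"] by linarith
    qed
    show "\<exists>\<gamma> C'. tight_ray (2 * B * q) p \<gamma> \<and> (\<forall>s\<ge>0. s \<le> \<delta> * t \<longrightarrow> dist (\<gamma> s) (f s) \<le> 2 * B * (10 * q)) \<and>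
         (\<forall>s\<ge>0. infdist (\<gamma> s) (ray_image \<eta>) \<le> C')" using \<gamma>(1) near far by blast
  qed
qed

context sublinear_scale
begin

text \<open>Both rays are straightened before joining; the threshold \<open>T\<close> makes the
  \<open>O(\<kappa>)\<close> displacements smaller than half of the linear distance
  \<open>e * t\<close> allowed for tight rays.\<close>

lemma join_rays:
  fixes p :: "'a::metric_space"
  assumes geo: "\<And>x y::'a. \<exists>g. geodesic_segment g x y" and A: "1 \<le> A"
  obtains \<epsilon> \<delta> T W C where "0 < \<epsilon>" "0 < \<delta>" "1 \<le> T" "1 \<le> W" "1 \<le> C"
    "\<And>f \<eta> t. \<lbrakk>scale_ray p \<kappa> A f; scale_ray p \<kappa> A \<eta>; T \<le> t; infdist (f t) (ray_image \<eta>) \<le> \<epsilon> * t\<rbrakk> \<Longrightarrow>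
       \<exists>\<gamma>. tight_ray W p \<gamma> \<and> (\<forall>s\<ge>0. s \<le> \<delta> * t \<longrightarrow> dist (\<gamma> s) (f s) \<le> C * \<kappa> s) \<and> sublinearly_close \<kappa> \<gamma> \<eta>"
proof -
  obtain B Cs where B: "1 \<le> B" "1 \<le> Cs"
    "\<And>f. scale_ray p \<kappa> A f \<Longrightarrow> \<exists>\<gamma>. tight_ray B p \<gamma> \<and> (\<forall>s\<ge>0. dist (\<gamma> s) (f s) \<le> Cs * \<kappa> s)"
    using straighten_ray[OF geo A] by metis
  obtain e \<delta> W C where J: "0 < e" "0 < \<delta>" "1 \<le> W" "0 \<le> C"
    "\<And>f \<eta> t u. \<lbrakk>tight_ray B p f; tight_ray B p \<eta>; 0 \<le> t; 0 \<le> u; dist (f t) (\<eta> u) \<le> e * t\<rbrakk> \<Longrightarrow>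
       \<exists>\<gamma> C'. tight_ray W p \<gamma> \<and> (\<forall>s\<ge>0. s \<le> \<delta> * t \<longrightarrow> dist (\<gamma> s) (f s) \<le> C) \<and>
         (\<forall>s\<ge>0. infdist (\<gamma> s) (ray_image \<eta>) \<le> C')"
    by (rule join_tight_rays[OF geo B(1), of p]) blast
  obtain C0 where C0: "1 \<le> C0"
    "\<And>p::'a. \<And>f s. scale_ray p \<kappa> A f \<Longrightarrow> 0 \<le> s \<Longrightarrow> dist (f s) p \<le> C0 * s + C0"
    "\<And>p::'a. \<And>f s. scale_ray p \<kappa> A f \<Longrightarrow> 0 \<le> s \<Longrightarrow> s \<le> C0 * dist (f s) p + C0"
    using scale_ray_norm[OF A] by metis
  define c where "c = C0 * (C0 + 1) + C0"
  have c: "0 \<le> c" using C0(1) by (simp add: c_def)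
  obtain C2 where C2: "1 \<le> C2" "\<And>s t. 0 \<le> s \<Longrightarrow> 0 \<le> t \<Longrightarrow> t \<le> c * s + c \<Longrightarrow> \<kappa> t \<le> C2 * \<kappa> s"
    using scale_affine[OF c] by auto
  obtain T where T: "1 \<le> T" "\<And>t. T \<le> t \<Longrightarrow> (Cs + Cs * C2) * \<kappa> t + 1 \<le> (e/2) * t"
    using scale_eventually_le[of "e/2" "Cs + Cs * C2" 1] J by auto
  define \<epsilon> where "\<epsilon> = min 1 (e / 2)"
  have \<epsilon>: "0 < \<epsilon>" "\<epsilon> \<le> 1" "\<epsilon> \<le> e/2" using J by (auto simp: \<epsilon>_def)
  show ?thesis
  proof (rule that[of \<epsilon> \<delta> T W "C + Cs"])
    show "0 < \<epsilon>" "0 < \<delta>" "1 \<le> T" "1 \<le> W" "1 \<le> C + Cs" using \<epsilon> J T B by auto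
    fix f \<eta> t assume f: "scale_ray p \<kappa> A f" and \<eta>: "scale_ray p \<kappa> A \<eta>" and t: "T \<le> t"
      and near: "infdist (f t) (ray_image \<eta>) \<le> \<epsilon> * t"
    have t0: "0 \<le> t" using t T by simp
    obtain f' where f': "tight_ray B p f'" "\<And>s. 0 \<le> s \<Longrightarrow> dist (f' s) (f s) \<le> Cs * \<kappa> s" using B(3)[OF f] by blast
    obtain \<eta>' where \<eta>': "tight_ray B p \<eta>'" "\<And>s. 0 \<le> s \<Longrightarrow> dist (\<eta>' s) (\<eta> s) \<le> Cs * \<kappa> s" using B(3)[OF \<eta>] by blast
    obtain u where u: "0 \<le> u" "dist (f t) (\<eta> u) \<le> infdist (f t) (ray_image \<eta>) + 1"
      by (rule infdist_ray_image_approx[of 1]) auto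
    have du: "dist (f t) (\<eta> u) \<le> \<epsilon> * t + 1" using u near by simp
    have et: "\<epsilon> * t \<le> t" "\<epsilon> * t \<le> e / 2 * t" using \<epsilon> t0 mult_right_mono[of \<epsilon> 1 t] mult_right_mono[of \<epsilon> "e/2" t] by auto
    have "u \<le> C0 * dist (\<eta> u) p + C0" by (rule C0(3)[OF \<eta> u(1)])
    also have "C0 * dist (\<eta> u) p \<le> C0 * ((C0 * t + C0) + (t + 1))"
      using C0(1) C0(2)[OF f t0] du et dist_triangle[of "\<eta> u" p "f t"] by (intro mult_left_mono) (auto simp: dist_commute)
    finally have "u \<le> C0 * (C0 + 1) * t + c" by (simp add: c_def algebra_simps)
    also have "\<dots> \<le> c * t + c" using t0 C0(1) by (simp add: c_def algebra_simps)
    finally have "\<kappa> u \<le> C2 * \<kappa> t" by (rule C2(2)[OF t0 u(1)])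
    then have "Cs * \<kappa> u \<le> Cs * (C2 * \<kappa> t)" using B by (intro mult_left_mono) auto
    then have "dist (f' t) (\<eta>' u) \<le> Cs * \<kappa> t + (\<epsilon> * t + 1) + Cs * (C2 * \<kappa> t)"
      using f'(2)[OF t0] \<eta>'(2)[OF u(1)] du dist_triangle[of "f' t" "\<eta>' u" "f t"] dist_triangle[of "f t" "\<eta>' u" "\<eta> u"]
      by (simp add: dist_commute)
    also have "\<dots> \<le> e * t" using T(2)[OF t] et by (simp add: algebra_simps)
    finally have "dist (f' t) (\<eta>' u) \<le> e * t" .
    from J(5)[OF f'(1) \<eta>'(1) t0 u(1) this] obtain \<gamma> C' where
      \<gamma>: "tight_ray W p \<gamma>" "\<And>s. 0 \<le> s \<Longrightarrow> s \<le> \<delta> * t \<Longrightarrow> dist (\<gamma> s) (f' s) \<le> C"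
         "\<And>s. 0 \<le> s \<Longrightarrow> infdist (\<gamma> s) (ray_image \<eta>') \<le> C'" by blast
    have "dist (\<gamma> s) (f s) \<le> (C + Cs) * \<kappa> s" if s: "0 \<le> s" "s \<le> \<delta> * t" for s
    proof -
      have "C \<le> C * \<kappa> s" using mult_left_mono[OF scale_ge_1[OF s(1)] J(4)] by simp
      then show ?thesis using \<gamma>(2)[OF s] f'(2)[OF s(1)] dist_triangle[of "\<gamma> s" "f s" "f' s"] by (simp add: algebra_simps)
    qed
    moreover have "sublinearly_close \<kappa> \<gamma> \<eta>"
    proof (rule sublinearly_close_trans)
      show "scale_ray p \<kappa> (2 * W) \<gamma>" "scale_ray p \<kappa> (2 * B) \<eta>'" using tight_ray_scale_ray \<gamma> \<eta>' by auto
      have C'0: "0 \<le> C'" using \<gamma>(3)[of 0] infdist_nonneg[of "\<gamma> 0"] by (meson order_refl order_trans)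
      have "infdist (\<gamma> s) (ray_image \<eta>') \<le> C' * \<kappa> s" if s: "0 \<le> s" for s
        using \<gamma>(3)[OF s] mult_left_mono[OF scale_ge_1[OF s] C'0] by simp
      then show "sublinearly_close \<kappa> \<gamma> \<eta>'" by (auto simp: sublinearly_close_def)
      show "sublinearly_close \<kappa> \<eta>' \<eta>" using \<eta>'(2) by (intro sublinearly_closeI[where M = Cs]) auto
    qed
    ultimately show "\<exists>\<gamma>. tight_ray W p \<gamma> \<and> (\<forall>s\<ge>0. s \<le> \<delta> * t \<longrightarrow> dist (\<gamma> s) (f s) \<le> (C + Cs) * \<kappa> s) \<and> sublinearly_close \<kappa> \<gamma> \<eta>"
      using \<gamma>(1) by blast
  qed
qed

end

section \<open>The Morse property for coarse rays\<close>

text \<open>The set of times at norm \<open>r\<close> is closed, and nonempty by the intermediate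
  value theorem, so \<open>LEAST\<close> is attained although it ranges over the reals.\<close>

lemma hit_time:
  assumes qg: "quasi_geodesic_ray p q Q \<beta>" and r: "0 \<le> r"
  shows "0 \<le> hit_time p \<beta> r" "dist (\<beta> (hit_time p \<beta> r)) p = r"
    "hit_time p \<beta> r \<le> q * (r + Q)" "r \<le> q * hit_time p \<beta> r + Q"
proof -
  have q: "1 \<le> q" "0 \<le> Q" and b0: "\<beta> 0 = p" and cont: "continuous_on {0..} \<beta>" using qg by (auto simp: quasi_geodesic_ray_def)
  define S where "S = {t \<in> {0..}. dist (\<beta> t) p = r}"
  \<comment> \<open>A time at which the lower quasi-geodesic bound forces norm at least
    \<open>r\<close>.\<close>
  define T where "T = q * (r + Q)"
  have T: "0 \<le> T" using q r by (simp add: T_def)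
  have c: "continuous_on {0..} (\<lambda>t. dist (\<beta> t) p)" by (intro continuous_intros cont)
  have "1 / q * T - Q \<le> dist (\<beta> T) (\<beta> 0)" using qg T unfolding quasi_geodesic_ray_def by force
  then have "r \<le> dist (\<beta> T) p" using q b0 by (simp add: T_def)
  then obtain t where "0 \<le> t" "t \<le> T" "dist (\<beta> t) p = r"
    using IVT'[of "\<lambda>t. dist (\<beta> t) p" 0 r T] T r b0 continuous_on_subset[OF c, of "{0..T}"] by auto
  then have ne: "S \<noteq> {}" by (auto simp: S_def)
  have "closed S"
    unfolding S_def using continuous_closed_preimage_constant[OF c, of r] by simp
  moreover have bdd: "bdd_below S" by (auto simp: S_def)
  ultimately have Inf: "Inf S \<in> S" using ne by (intro closed_contains_Inf)
  have "hit_time p \<beta> r = Inf S"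
    unfolding hit_time_def
  proof (rule Least_equality)
    show "0 \<le> Inf S \<and> dist (\<beta> (Inf S)) p = r" using Inf by (simp add: S_def)
    show "Inf S \<le> y" if "0 \<le> y \<and> dist (\<beta> y) p = r" for y
      using that bdd by (intro cInf_lower) (auto simp: S_def)
  qed
  with Inf show h: "0 \<le> hit_time p \<beta> r" "dist (\<beta> (hit_time p \<beta> r)) p = r" by (auto simp: S_def)
  have "1 / q * hit_time p \<beta> r - Q \<le> r \<and> r \<le> q * hit_time p \<beta> r + Q"
    using qg h b0 unfolding quasi_geodesic_ray_def by (metis abs_of_nonneg diff_zero order_refl)
  then show "hit_time p \<beta> r \<le> q * (r + Q)" "r \<le> q * hit_time p \<beta> r + Q"
    using q by (auto simp: field_simps)
qed

text \<open>Since \<open>\<epsilon> * t\<close> eventually exceeds \<open>n * \<kappa>' t\<close>,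
  linear closeness subsumes every test function of \<open>morse_gauge\<close>; moreover it is
  preserved, up to constants, by maps with sublinear error.\<close>

definition robustly_morse :: "'a::metric_space \<Rightarrow> (real \<Rightarrow> real) \<Rightarrow> 'a set \<Rightarrow> bool" where
  "robustly_morse p \<kappa> Z \<longleftrightarrow> (\<forall>A\<ge>1. \<exists>\<epsilon>>0. \<exists>\<delta>>0. \<exists>T\<ge>1. \<exists>M\<ge>1. \<forall>f t.
     scale_ray p \<kappa> A f \<longrightarrow> T \<le> t \<longrightarrow> infdist (f t) Z \<le> \<epsilon> * t \<longrightarrow>
     (\<forall>s\<ge>0. s \<le> \<delta> * t \<longrightarrow> infdist (f s) Z \<le> M * \<kappa> s))"

lemma robustly_morseE:
  assumes "robustly_morse p \<kappa> Z" "1 \<le> A"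
  obtains \<epsilon> \<delta> T M where "0 < \<epsilon>" "0 < \<delta>" "1 \<le> T" "1 \<le> M"
    "\<And>f t s. scale_ray p \<kappa> A f \<Longrightarrow> T \<le> t \<Longrightarrow> infdist (f t) Z \<le> \<epsilon> * t \<Longrightarrow> 0 \<le> s \<Longrightarrow> s \<le> \<delta> * t \<Longrightarrow>
       infdist (f s) Z \<le> M * \<kappa> s"
proof -
  have "\<exists>\<epsilon>>0. \<exists>\<delta>>0. \<exists>T\<ge>1. \<exists>M\<ge>1. \<forall>f t. scale_ray p \<kappa> A f \<longrightarrow> T \<le> t \<longrightarrow> infdist (f t) Z \<le> \<epsilon> * t \<longrightarrow>
     (\<forall>s\<ge>0. s \<le> \<delta> * t \<longrightarrow> infdist (f s) Z \<le> M * \<kappa> s)"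
    using assms by (simp add: robustly_morse_def)
  then show ?thesis using that by (elim exE conjE) presburger
qed

lemma morse_gaugeE:
  assumes m: "morse_gauge p \<kappa> m Z" and "strictly_sublinear \<kappa>'" "0 < r" "0 < n"
  obtains R where "0 < R" "\<And>q Q \<beta>. quasi_geodesic_ray p q Q \<beta> \<Longrightarrow> small_wrt \<kappa> (m (q, Q)) r \<Longrightarrow>
       infdist (ray_point p \<beta> R) Z \<le> n * \<kappa>' R \<Longrightarrow> ray_upto p \<beta> r \<subseteq> nbhd p \<kappa> Z (m (q, Q))"
proof -
  have "\<exists>R>0. \<forall>q Q \<beta>. quasi_geodesic_ray p q Q \<beta> \<and> small_wrt \<kappa> (m (q, Q)) r \<longrightarrow>
       infdist (ray_point p \<beta> R) Z \<le> n * \<kappa>' R \<longrightarrow> ray_upto p \<beta> r \<subseteq> nbhd p \<kappa> Z (m (q, Q))"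
    using m assms(2-) by (simp add: morse_gauge_def)
  then show ?thesis using that by (elim exE conjE) presburger
qed

text \<open>For the Morse gauge built below: properness is secured by continuity and growth, whereas
  the estimates come as one number per integer. The bound by \<open>\<bar>x\<bar> + 1\<close>
  supplies the growth and the positivity.\<close>

lemma continuous_dominating_sequence:
  fixes c :: "nat \<Rightarrow> real"
  obtains g :: "real \<Rightarrow> real" where "continuous_on UNIV g" "\<And>x. \<bar>x\<bar> + 1 \<le> g x"
    "\<And>x. 0 \<le> x \<Longrightarrow> c (nat \<lceil>x\<rceil>) \<le> g x"
proof -
  \<comment> \<open>Each ramp rises from 0 at \<open>k - 2\<close> to full height at
    \<open>k - 1\<close>, so it is at full height wherever \<open>nat \<lceil>x\<rceil> = k\<close>,
    and only finitely many ramps are nonzero near a given point.\<close>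
  define b where "b k x = \<bar>c k\<bar> * max 0 (min 1 (x - real k + 2))" for k x
  define g where "g x = \<bar>x\<bar> + 1 + (\<Sum>k<nat \<lceil>\<bar>x\<bar>\<rceil> + 3. b k x)" for x
  have b0: "0 \<le> b k x" for k x by (simp add: b_def)
  have eq: "g x = \<bar>x\<bar> + 1 + (\<Sum>k<n + 3. b k x)" if "\<bar>x\<bar> \<le> real n" for x n
  proof -
    have le: "nat \<lceil>\<bar>x\<bar>\<rceil> \<le> n" using that by (simp add: ceiling_le)
    have "(\<Sum>k<nat \<lceil>\<bar>x\<bar>\<rceil> + 3. b k x) = (\<Sum>k<n + 3. b k x)"
    proof (rule sum.mono_neutral_left)
      show "\<forall>k\<in>{..<n + 3} - {..<nat \<lceil>\<bar>x\<bar>\<rceil> + 3}. b k x = 0"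
      proof
        fix k assume "k \<in> {..<n + 3} - {..<nat \<lceil>\<bar>x\<bar>\<rceil> + 3}"
        then have "nat \<lceil>\<bar>x\<bar>\<rceil> + 3 \<le> k" by auto
        then have "x - real k + 2 \<le> 0" by linarith
        then show "b k x = 0" by (simp add: b_def)
      qed
    qed (use le in auto)
    then show ?thesis by (simp add: g_def)
  qed
  show ?thesis
  proof (rule that[of g])
    have "isCont g x" for x
    proof -
      obtain n :: nat where n: "\<bar>x\<bar> < real n" using reals_Archimedean2 by blast
      have "open {y :: real. \<bar>y\<bar> < real n}" by (intro open_Collect_less continuous_intros)
      then have "eventually (\<lambda>y. y \<in> {y :: real. \<bar>y\<bar> < real n}) (nhds x)" using n by (intro eventually_nhds_in_open) auto
      then have "eventually (\<lambda>y. g y = \<bar>y\<bar> + 1 + (\<Sum>k<n + 3. b k y)) (nhds x)"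
        by eventually_elim (use eq in auto)
      then have "isCont g x \<longleftrightarrow> isCont (\<lambda>y. \<bar>y\<bar> + 1 + (\<Sum>k<n + 3. b k y)) x" by (rule isCont_cong)
      then show ?thesis by (auto simp: b_def intro!: continuous_intros)
    qed
    then show "continuous_on UNIV g" by (simp add: continuous_at_imp_continuous_on)
    show "\<bar>x\<bar> + 1 \<le> g x" for x using b0 by (simp add: g_def sum_nonneg)
    fix x :: real assume x: "0 \<le> x"
    have "x > real (nat \<lceil>x\<rceil>) - 1" using x by linarith
    then have "c (nat \<lceil>x\<rceil>) \<le> b (nat \<lceil>x\<rceil>) x" by (simp add: b_def)
    also have "\<dots> \<le> (\<Sum>k<nat \<lceil>\<bar>x\<bar>\<rceil> + 3. b k x)" using b0 x by (intro member_le_sum) auto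
    finally show "c (nat \<lceil>x\<rceil>) \<le> g x" by (simp add: g_def)
  qed
qed

context sublinear_scale
begin

text \<open>Bootstrapping: closeness with an arbitrary constant \<open>C\<close> improves to the
  gauge constant. The test function is \<open>\<kappa>\<close> itself, with a factor
  \<open>n\<close> that depends on \<open>C\<close>; since \<open>\<gamma>\<close> is near
  \<open>Z\<close> at every time, the premise holds at whatever \<open>R\<close> the Morse property
  returns.\<close>

lemma morse_gauge_near:
  assumes m: "morse_gauge p \<kappa> m Z" and g: "tight_ray W p \<gamma>"
    and near: "\<And>s. 0 \<le> s \<Longrightarrow> infdist (\<gamma> s) Z \<le> C * \<kappa> s" and s: "0 \<le> s"
  shows "infdist (\<gamma> s) Z \<le> m (W, 1) * \<kappa> (dist (\<gamma> s) p)"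
proof -
  have W: "1 \<le> W" by (rule tight_rayD(1)[OF g])
  then have W2: "1 \<le> 2 * W" by simp
  have qg: "quasi_geodesic_ray p W 1 \<gamma>" by (rule tight_ray_quasi_geodesic[OF g])
  have sg: "scale_ray p \<kappa> (2 * W) \<gamma>" by (rule tight_ray_scale_ray[OF g])
  obtain C0 where C0: "1 \<le> C0" "\<And>f s. scale_ray p \<kappa> (2 * W) f \<Longrightarrow> 0 \<le> s \<Longrightarrow> \<kappa> s \<le> C0 * \<kappa> (dist (f s) p)"
    using scale_ray_norm[OF W2] by metis
  define n where "n = \<bar>C\<bar> * C0 + 1"
  have n: "0 < n" using C0(1) by (simp add: n_def add_nonneg_pos)
  have "eventually (\<lambda>r. m (W, 1) \<le> r / (2 * \<kappa> r)) at_top"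
    using strictly_sublinear_ratio_at_top[OF strict] by (simp add: filterlim_at_top)
  then obtain r0 where r0: "\<And>r. r0 \<le> r \<Longrightarrow> m (W, 1) \<le> r / (2 * \<kappa> r)" by (auto simp: eventually_at_top_linorder)
  \<comment> \<open>Large enough for the gauge value to be \<open>small_wrt\<close>, and for the ray
    not to reach norm \<open>r\<close> before time \<open>s\<close>.\<close>
  define r where "r = max r0 (W * s + 2)"
  have "0 \<le> W * s" using W s by simp
  moreover have r: "W * s + 2 \<le> r" "r0 \<le> r" unfolding r_def by simp_all
  ultimately have r: "0 < r" "W * s + 2 \<le> r" "small_wrt \<kappa> (m (W, 1)) r"
    using r0[OF r(2)] unfolding small_wrt_def by linarith+
  obtain R where R: "0 < R" "\<And>q Q \<beta>. quasi_geodesic_ray p q Q \<beta> \<Longrightarrow> small_wrt \<kappa> (m (q, Q)) r \<Longrightarrow>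
       infdist (ray_point p \<beta> R) Z \<le> n * \<kappa> R \<Longrightarrow> ray_upto p \<beta> r \<subseteq> nbhd p \<kappa> Z (m (q, Q))"
    by (rule morse_gaugeE[OF m strict r(1) n]) blast
  have h: "0 \<le> hit_time p \<gamma> R" "dist (\<gamma> (hit_time p \<gamma> R)) p = R" using hit_time[OF qg, of R] R(1) by auto
  have "infdist (ray_point p \<gamma> R) Z \<le> C * \<kappa> (hit_time p \<gamma> R)" using near[OF h(1)] by (simp add: ray_point_def)
  also have "\<dots> \<le> \<bar>C\<bar> * \<kappa> (hit_time p \<gamma> R)" using scale_pos[OF h(1)] by (intro mult_right_mono) auto
  also have "\<dots> \<le> \<bar>C\<bar> * (C0 * \<kappa> R)" using C0(2)[OF sg h(1)] h(2) by (intro mult_left_mono) auto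
  also have "\<dots> \<le> n * \<kappa> R" using scale_pos[of R] R(1) by (simp add: n_def algebra_simps)
  finally have "ray_upto p \<gamma> r \<subseteq> nbhd p \<kappa> Z (m (W, 1))" using R(2)[OF qg r(3)] by blast
  moreover have "s \<le> hit_time p \<gamma> r"
  proof (rule ccontr)
    assume "\<not> ?thesis"
    then have "W * hit_time p \<gamma> r \<le> W * s" using W by (intro mult_left_mono) auto
    then show False using hit_time(4)[OF qg, of r] r by simp
  qed
  ultimately have "\<gamma> s \<in> nbhd p \<kappa> Z (m (W, 1))" using s by (auto simp: ray_upto_def)
  then show ?thesis by (simp add: nbhd_def)
qed

text \<open>The joined ray is near \<open>\<zeta>\<close> with a constant of its own;
  \<open>morse_gauge_near\<close> replaces that constant by \<open>m (W, 1)\<close>, which is the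
  same for all rays \<open>f\<close> with constant \<open>A\<close>.\<close>

lemma morse_imp_robustly_morse:
  fixes p :: "'a::metric_space"
  assumes geo: "\<And>x y::'a. \<exists>g. geodesic_segment g x y"
    and qg: "quasi_geodesic_ray p q Q \<zeta>" and morse: "morse_set p \<kappa> (ray_image \<zeta>)"
  shows "robustly_morse p \<kappa> (ray_image \<zeta>)"
  unfolding robustly_morse_def
proof (intro allI impI)
  fix A :: real assume A: "1 \<le> A"
  obtain m where m: "morse_gauge p \<kappa> m (ray_image \<zeta>)" using morse by (auto simp: morse_set_def)
  define A' where "A' = max A (q * (Q + 1))"
  have A': "1 \<le> A'" "A \<le> A'" using A by (auto simp: A'_def)
  have \<zeta>: "scale_ray p \<kappa> A' \<zeta>" using qg by (rule quasi_geodesic_scale_ray) (simp add: A'_def)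
  obtain \<epsilon> \<delta> T W C where J: "0 < \<epsilon>" "0 < \<delta>" "1 \<le> T" "1 \<le> W" "1 \<le> C"
    "\<And>f \<eta> t. \<lbrakk>scale_ray p \<kappa> A' f; scale_ray p \<kappa> A' \<eta>; T \<le> t; infdist (f t) (ray_image \<eta>) \<le> \<epsilon> * t\<rbrakk> \<Longrightarrow>
       \<exists>\<gamma>. tight_ray W p \<gamma> \<and> (\<forall>s\<ge>0. s \<le> \<delta> * t \<longrightarrow> dist (\<gamma> s) (f s) \<le> C * \<kappa> s) \<and> sublinearly_close \<kappa> \<gamma> \<eta>"
    by (rule join_rays[OF geo A'(1), of p]) blast
  have W2: "1 \<le> 2 * W" using J by simp
  obtain C0 where C0: "1 \<le> C0" "\<And>f s. scale_ray p \<kappa> (2 * W) f \<Longrightarrow> 0 \<le> s \<Longrightarrow> \<kappa> (dist (f s) p) \<le> C0 * \<kappa> s"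
    using scale_ray_norm[OF W2] by metis
  have m0: "0 < m (W, 1)" using m J by (simp add: morse_gauge_def)
  have "infdist (f s) (ray_image \<zeta>) \<le> (C + m (W, 1) * C0) * \<kappa> s"
    if f: "scale_ray p \<kappa> A f" and t: "T \<le> t" "infdist (f t) (ray_image \<zeta>) \<le> \<epsilon> * t" and s: "0 \<le> s" "s \<le> \<delta> * t" for f t s
  proof -
    obtain \<gamma> where g: "tight_ray W p \<gamma>" "dist (\<gamma> s) (f s) \<le> C * \<kappa> s" "sublinearly_close \<kappa> \<gamma> \<zeta>"
      using J(6)[OF scale_ray_mono[OF f A'(2)] \<zeta> t] s by blast
    obtain M where "\<And>s. 0 \<le> s \<Longrightarrow> infdist (\<gamma> s) (ray_image \<zeta>) \<le> M * \<kappa> s"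
      using g(3) unfolding sublinearly_close_def by blast
    from morse_gauge_near[OF m g(1) this s(1)]
    have "infdist (\<gamma> s) (ray_image \<zeta>) \<le> m (W, 1) * \<kappa> (dist (\<gamma> s) p)" .
    also have "\<dots> \<le> m (W, 1) * (C0 * \<kappa> s)" using C0(2)[OF tight_ray_scale_ray[OF g(1)] s(1)] m0 by (intro mult_left_mono) auto
    finally show ?thesis using g(2) infdist_triangle[of "f s" "ray_image \<zeta>" "\<gamma> s"] by (simp add: algebra_simps dist_commute)
  qed
  moreover have "1 \<le> C + m (W, 1) * C0" using J(5) m0 C0(1) by (simp add: add_increasing2)
  ultimately show "\<exists>\<epsilon>>0. \<exists>\<delta>>0. \<exists>T\<ge>1. \<exists>M\<ge>1. \<forall>f t. scale_ray p \<kappa> A f \<longrightarrow> T \<le> t \<longrightarrow>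
     infdist (f t) (ray_image \<zeta>) \<le> \<epsilon> * t \<longrightarrow> (\<forall>s\<ge>0. s \<le> \<delta> * t \<longrightarrow> infdist (f s) (ray_image \<zeta>) \<le> M * \<kappa> s)"
    using J(1-3) by blast
qed

text \<open>The gauge is made to dominate the norm of \<open>(q, Q)\<close>. At a given radius
  \<open>r\<close>, smallness then restricts the quasi-geodesic constants to a bounded set, covered
  by the indices \<open>k \<le> N\<close>, and a single \<open>R\<close> serves these finitely many
  indices.\<close>

lemma robustly_morse_imp_morse:
  assumes "robustly_morse p \<kappa> Z"
  shows "morse_set p \<kappa> Z"
proof -
  \<comment> \<open>Dominates \<open>q * (Q + 1)\<close>, the coarse constant of a quasi-geodesic
    ray, whenever \<open>q\<close> and \<open>Q\<close> are at most \<open>n\<close>.\<close>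
  define A where "A n = (real n + 1) * (real n + 2)" for n :: nat
  have A: "1 \<le> A n" for n using mult_mono[of 1 "real n + 1" 1 "real n + 2"] by (simp add: A_def)
  have "\<forall>n. \<exists>\<epsilon> \<delta> T M. 0 < \<epsilon> \<and> 0 < \<delta> \<and> 1 \<le> M \<and> (\<forall>f t s. scale_ray p \<kappa> (A n) f \<longrightarrow> T \<le> t \<longrightarrow>
     infdist (f t) Z \<le> \<epsilon> * t \<longrightarrow> 0 \<le> s \<longrightarrow> s \<le> \<delta> * t \<longrightarrow> infdist (f s) Z \<le> M * \<kappa> s)"
  proof
    fix n
    obtain \<epsilon> \<delta> T M where "0 < \<epsilon>" "0 < \<delta>" "1 \<le> T" "1 \<le> M"
    "\<And>f t s. scale_ray p \<kappa> (A n) f \<Longrightarrow> T \<le> t \<Longrightarrow> infdist (f t) Z \<le> \<epsilon> * t \<Longrightarrow> 0 \<le> s \<Longrightarrow> s \<le> \<delta> * t \<Longrightarrow>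
       infdist (f s) Z \<le> M * \<kappa> s" by (rule robustly_morseE[OF assms A[of n]]) blast
    then show "\<exists>\<epsilon> \<delta> T M. 0 < \<epsilon> \<and> 0 < \<delta> \<and> 1 \<le> M \<and> (\<forall>f t s. scale_ray p \<kappa> (A n) f \<longrightarrow> T \<le> t \<longrightarrow>
     infdist (f t) Z \<le> \<epsilon> * t \<longrightarrow> 0 \<le> s \<longrightarrow> s \<le> \<delta> * t \<longrightarrow> infdist (f s) Z \<le> M * \<kappa> s)" by blast
  qed
  then obtain \<epsilon> \<delta> T M where P: "\<And>n. 0 < \<epsilon> n" "\<And>n. 0 < \<delta> n" "\<And>n. 1 \<le> M n"
    "\<And>n f t s. scale_ray p \<kappa> (A n) f \<Longrightarrow> T n \<le> t \<Longrightarrow> infdist (f t) Z \<le> \<epsilon> n * t \<Longrightarrow> 0 \<le> s \<Longrightarrow> s \<le> \<delta> n * t \<Longrightarrow>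
       infdist (f s) Z \<le> M n * \<kappa> s" by metis
  have "\<forall>n. \<exists>C. \<forall>f s. scale_ray p \<kappa> (A n) f \<longrightarrow> 0 \<le> s \<longrightarrow> \<kappa> s \<le> C * \<kappa> (dist (f s) p)"
  proof
    fix n show "\<exists>C. \<forall>f s. scale_ray p \<kappa> (A n) f \<longrightarrow> 0 \<le> s \<longrightarrow> \<kappa> s \<le> C * \<kappa> (dist (f s) p)"
      by (rule scale_ray_norm[OF A[of n]]) blast
  qed
  then obtain C where C: "\<And>n f s. scale_ray p \<kappa> (A n) f \<Longrightarrow> 0 \<le> s \<Longrightarrow> \<kappa> s \<le> C n * \<kappa> (dist (f s) p)" by metis
  obtain g :: "real \<Rightarrow> real" where g: "continuous_on UNIV g" "\<And>x. \<bar>x\<bar> + 1 \<le> g x"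
    "\<And>x. 0 \<le> x \<Longrightarrow> M (nat \<lceil>x\<rceil>) * C (nat \<lceil>x\<rceil>) \<le> g x"
    by (rule continuous_dominating_sequence[of "\<lambda>n. M n * C n"]) blast
  define m where "m = (\<lambda>z :: real \<times> real. g (norm z))"
  have proper: "proper_function m"
    unfolding proper_function_def
  proof (intro allI impI)
    fix K :: "real set" assume K: "compact K"
    have "continuous_on UNIV m"
      unfolding m_def by (rule continuous_on_compose2[OF g(1)]) (auto intro: continuous_intros)
    then have "closed (m -` K)" using compact_imp_closed[OF K] by (intro closed_vimage)
    moreover have "bounded (m -` K)"
    proof -
      obtain b where b: "\<And>x. x \<in> K \<Longrightarrow> \<bar>x\<bar> \<le> b" using compact_imp_bounded[OF K] by (auto simp: bounded_iff)
      have "norm z \<le> b" if "m z \<in> K" for z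
      proof -
        have "norm z + 1 \<le> m z" using g(2)[of "norm z"] by (simp add: m_def)
        then show ?thesis using b[OF that] by linarith
      qed
      then show ?thesis unfolding bounded_iff vimage_eq by blast
    qed
    ultimately show "compact (m -` K)" by (simp add: compact_eq_bounded_closed)
  qed
  have "morse_gauge p \<kappa> m Z"
    unfolding morse_gauge_def
  proof (intro conjI allI impI)
    show "proper_function m" by (rule proper)
    show "0 < m (q, Q)" for q Q unfolding m_def using g(2)[of "norm (q, Q)"] norm_ge_zero[of "(q, Q)"] by linarith
    fix \<kappa>' and r n :: real
    assume "strictly_sublinear \<kappa>' \<and> 0 < r \<and> 0 < n"
    then have k': "strictly_sublinear \<kappa>'" and r: "0 < r" and n: "0 < n" by auto
    interpret k': sublinear_scale \<kappa>' using k' by unfold_locales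
    define N where "N = nat \<lceil>r / (2 * \<kappa> r)\<rceil>"
    \<comment> \<open>For rays with constants at most \<open>k\<close>, \<open>(R - k) / k\<close>
      bounds the time of norm \<open>R\<close> from below and \<open>k * (r + k)\<close> bounds the
      time of norm \<open>r\<close> from above. The three conditions put the former in the range of
      the robust Morse property and the latter inside its window.\<close>
    have ev: "eventually (\<lambda>R. n * \<kappa>' R \<le> \<epsilon> k * ((R - k) / k) \<and> T k \<le> (R - k) / k \<and>
        real k * (r + k) \<le> \<delta> k * ((R - k) / k)) at_top" if k: "1 \<le> k" for k :: nat
    proof -
      have ek: "0 < \<epsilon> k / k" using P(1)[of k] k by simp
      obtain T1 where T1: "1 \<le> T1" "\<And>t. T1 \<le> t \<Longrightarrow> n * \<kappa>' t + \<epsilon> k \<le> \<epsilon> k / k * t" using k'.scale_eventually_le[OF ek] by metis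
      have "eventually (\<lambda>R. max T1 (max (T k * k + k) (real k * (r + k) / \<delta> k * k + k)) \<le> R) at_top" by (rule eventually_ge_at_top)
      then show ?thesis
      proof eventually_elim
        case (elim R)
        have "n * \<kappa>' R + \<epsilon> k \<le> \<epsilon> k / k * R" using T1(2)[of R] elim by simp
        moreover have "\<epsilon> k * ((R - k) / k) = \<epsilon> k / k * R - \<epsilon> k" using k by (simp add: field_simps)
        ultimately have 1: "n * \<kappa>' R \<le> \<epsilon> k * ((R - k) / k)" by linarith
        have 2: "T k \<le> (R - k) / k" using elim k by (simp add: field_simps)
        have "real k * (r + k) / \<delta> k \<le> (R - k) / k" using elim k by (simp add: pos_le_divide_eq)
        then have 3: "real k * (r + k) \<le> \<delta> k * ((R - k) / k)" using P(2)[of k] by (simp add: pos_divide_le_eq mult.commute)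
        show ?case using 1 2 3 by blast
      qed
    qed
    define P where "P k R \<longleftrightarrow> n * \<kappa>' R \<le> \<epsilon> k * ((R - k) / k) \<and> T k \<le> (R - k) / k \<and>
        real k * (r + k) \<le> \<delta> k * ((R - k) / k)" for k R
    have "eventually (\<lambda>R. \<forall>k\<in>{1..N}. P k R) at_top"
      using ev unfolding P_def by (intro eventually_ball_finite) auto
    then have "eventually (\<lambda>R. 0 < R \<and> (\<forall>k\<in>{1..N}. P k R)) at_top"
      by (intro eventually_conj eventually_gt_at_top)
    then have "\<exists>R. 0 < R \<and> (\<forall>k\<in>{1..N}. P k R)"
      by (rule eventually_happens'[OF trivial_limit_at_top_linorder])
    then obtain R where R0: "0 < R" "\<And>k. k \<in> {1..N} \<Longrightarrow> P k R" by blast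
    have R: "n * \<kappa>' R \<le> \<epsilon> k * ((R - k) / k) \<and> T k \<le> (R - k) / k \<and>
        real k * (r + k) \<le> \<delta> k * ((R - k) / k)" if "1 \<le> k" "k \<le> N" for k
      using R0(2)[of k] that by (simp add: P_def)
    show "\<exists>R>0. \<forall>q Q \<beta>. quasi_geodesic_ray p q Q \<beta> \<and> small_wrt \<kappa> (m (q, Q)) r \<longrightarrow>
           infdist (ray_point p \<beta> R) Z \<le> n * \<kappa>' R \<longrightarrow> ray_upto p \<beta> r \<subseteq> nbhd p \<kappa> Z (m (q, Q))"
    proof (intro exI[of _ R] conjI allI impI)
      show "0 < R" by (rule R0)
      fix q Q \<beta>
      assume "quasi_geodesic_ray p q Q \<beta> \<and> small_wrt \<kappa> (m (q, Q)) r"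
        and near: "infdist (ray_point p \<beta> R) Z \<le> n * \<kappa>' R"
      then have qg: "quasi_geodesic_ray p q Q \<beta>" and sm: "m (q, Q) \<le> r / (2 * \<kappa> r)" by (auto simp: small_wrt_def)
      have q: "1 \<le> q" "0 \<le> Q" using qg by (auto simp: quasi_geodesic_ray_def)
      define k where "k = nat \<lceil>norm (q, Q)\<rceil>"
      have nk: "norm (q, Q) \<le> k" by (simp add: k_def)
      have qk: "q \<le> k" "Q \<le> k" using nk norm_fst_le[of q Q] norm_snd_le[of Q q] q by auto
      have k1: "1 \<le> k" using qk q by linarith
      have "norm (q, Q) \<le> r / (2 * \<kappa> r)" using sm g(2)[of "norm (q, Q)"] by (simp add: m_def)
      then have kN: "k \<le> N" unfolding k_def N_def by (intro nat_mono ceiling_mono)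
      have "q * (Q + 1) \<le> A k" unfolding A_def using q qk by (intro mult_mono) auto
      then have \<beta>: "scale_ray p \<kappa> (A k) \<beta>" by (rule quasi_geodesic_scale_ray[OF qg])
      note hR = hit_time[OF qg, of R] and hr = hit_time[OF qg, of r]
      define h where "h = hit_time p \<beta> R"
      have "R \<le> q * h + Q" using hR R0(1) by (simp add: h_def)
      also have "\<dots> \<le> k * h + k" using qk hR(1) R0(1) by (intro add_mono mult_right_mono) (auto simp: h_def)
      finally have hk: "(R - k) / k \<le> h" using k1 by (simp add: field_simps)
      have "T k \<le> h" using R[OF k1 kN] hk by linarith
      moreover have "infdist (\<beta> h) Z \<le> \<epsilon> k * h"
        using near R[OF k1 kN] mult_left_mono[OF hk, of "\<epsilon> k"] P(1)[of k] by (simp add: ray_point_def h_def)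
      ultimately have near: "infdist (\<beta> s) Z \<le> M k * \<kappa> s" if "0 \<le> s" "s \<le> \<delta> k * h" for s
        using P(4)[OF \<beta>] that by blast
      have "hit_time p \<beta> r \<le> q * (r + Q)" using hr r by simp
      also have "\<dots> \<le> k * (r + k)" using q qk r by (intro mult_mono) auto
      also have "\<dots> \<le> \<delta> k * h" using R[OF k1 kN] mult_left_mono[OF hk, of "\<delta> k"] P(2)[of k] by linarith
      finally have hh: "hit_time p \<beta> r \<le> \<delta> k * h" .
      show "ray_upto p \<beta> r \<subseteq> nbhd p \<kappa> Z (m (q, Q))"
      proof
        fix x assume "x \<in> ray_upto p \<beta> r"
        then obtain s where s: "0 \<le> s" "s \<le> hit_time p \<beta> r" "x = \<beta> s" by (auto simp: ray_upto_def)
        have "infdist x Z \<le> M k * \<kappa> s" using near[of s] s hh by simp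
        also have "\<dots> \<le> M k * (C k * \<kappa> (dist x p))" using C[OF \<beta> s(1)] s(3) P(3)[of k] by (intro mult_left_mono) auto
        also have "\<dots> = (M k * C k) * \<kappa> (dist x p)" by simp
        also have "\<dots> \<le> m (q, Q) * \<kappa> (dist x p)" using g(3)[of "norm (q, Q)"] scale_pos[of "dist x p"]
          by (intro mult_right_mono) (auto simp: m_def k_def)
        finally show "x \<in> nbhd p \<kappa> Z (m (q, Q))" by (simp add: nbhd_def)
      qed
    qed
  qed
  then show ?thesis by (auto simp: morse_set_def)
qed

text \<open>For every \<open>s\<close> there is a late, linearly close time whose window contains
  \<open>s\<close>, so one bound holds on the whole ray.\<close>

lemma robustly_morse_close:
  assumes Z: "robustly_morse p \<kappa> (ray_image g)" and f: "scale_ray p \<kappa> A f"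
    and lim: "((\<lambda>t. infdist (f t) (ray_image g) / t) \<longlongrightarrow> 0) at_top"
  shows "sublinearly_close \<kappa> f g"
proof -
  obtain \<epsilon> \<delta> T M where P: "0 < \<epsilon>" "0 < \<delta>" "1 \<le> T" "1 \<le> M"
    "\<And>f t s. scale_ray p \<kappa> A f \<Longrightarrow> T \<le> t \<Longrightarrow> infdist (f t) (ray_image g) \<le> \<epsilon> * t \<Longrightarrow> 0 \<le> s \<Longrightarrow> s \<le> \<delta> * t \<Longrightarrow>
       infdist (f s) (ray_image g) \<le> M * \<kappa> s" by (rule robustly_morseE[OF Z scale_rayD(1)[OF f]]) blast
  have "eventually (\<lambda>t. infdist (f t) (ray_image g) / t < \<epsilon>) at_top" using lim P(1) by (auto dest: order_tendstoD)
  then obtain t0 where t0: "\<And>t. t0 \<le> t \<Longrightarrow> infdist (f t) (ray_image g) / t < \<epsilon>" by (auto simp: eventually_at_top_linorder)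
  have "infdist (f s) (ray_image g) \<le> M * \<kappa> s" if s: "0 \<le> s" for s
  proof -
    define t where "t = max t0 (max T (s / \<delta>))"
    have t: "t0 \<le> t" "T \<le> t" and "s / \<delta> \<le> t" unfolding t_def by simp_all
    then have st: "s \<le> \<delta> * t" using P(2) by (simp add: pos_divide_le_eq mult.commute)
    have "infdist (f t) (ray_image g) \<le> \<epsilon> * t" using t0[OF t(1)] t(2) P(3) by (simp add: field_simps)
    then show ?thesis using P(5)[OF f t(2) _ s st] by blast
  qed
  then show ?thesis unfolding sublinearly_close_def by blast
qed

lemma sublinearly_close_limit:
  assumes "sublinearly_close \<kappa> f g"
  shows "((\<lambda>t. infdist (f t) (ray_image g) / t) \<longlongrightarrow> 0) at_top"
proof -
  obtain M where M: "\<And>s. 0 \<le> s \<Longrightarrow> infdist (f s) (ray_image g) \<le> M * \<kappa> s"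
    using assms unfolding sublinearly_close_def by blast
  have "((\<lambda>r. \<kappa> r / r) \<longlongrightarrow> 0) at_top" using strict by (simp add: strictly_sublinear_def)
  then have lim: "((\<lambda>r. M * (\<kappa> r / r)) \<longlongrightarrow> 0) at_top" by (rule tendsto_mult_right_zero)
  show ?thesis
  proof (rule tendsto_sandwich[OF _ _ tendsto_const lim])
    show "eventually (\<lambda>t. 0 \<le> infdist (f t) (ray_image g) / t) at_top"
      using eventually_gt_at_top[of 0] by (rule eventually_mono) (simp add: infdist_nonneg)
    show "eventually (\<lambda>t. infdist (f t) (ray_image g) / t \<le> M * (\<kappa> t / t)) at_top"
      using eventually_gt_at_top[of 0]
    proof eventually_elim
      case (elim t)
      have "infdist (f t) (ray_image g) / t \<le> M * \<kappa> t / t" using M[of t] elim by (intro divide_right_mono) auto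
      then show ?case by simp
    qed
  qed
qed

text \<open>\<open>ray_equiv\<close> is a disjunction of two one-sided limits; the Morse property of
  the respective target turns either into sublinear closeness, which is symmetric.\<close>

lemma ray_equiv_iff_sublinearly_close:
  assumes "scale_ray p \<kappa> A f" "scale_ray p \<kappa> A' g"
    and "robustly_morse p \<kappa> (ray_image f)" "robustly_morse p \<kappa> (ray_image g)"
  shows "ray_equiv f g \<longleftrightarrow> sublinearly_close \<kappa> f g"
proof
  assume "ray_equiv f g"
  then consider "sublinearly_close \<kappa> f g" | "sublinearly_close \<kappa> g f"
    using robustly_morse_close[OF assms(4,1)] robustly_morse_close[OF assms(3,2)] by (auto simp: ray_equiv_def)
  then show "sublinearly_close \<kappa> f g" using sublinearly_close_sym[OF assms(2,1)] by cases
next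
  assume "sublinearly_close \<kappa> f g"
  then show "ray_equiv f g" using sublinearly_close_limit by (auto simp: ray_equiv_def)
qed

end

section \<open>Maps that are bi-Lipschitz up to a sublinear error\<close>

definition scale_map ::
  "'a::metric_space \<Rightarrow> 'b::metric_space \<Rightarrow> (real \<Rightarrow> real) \<Rightarrow> real \<Rightarrow> ('a \<Rightarrow> 'b) \<Rightarrow> bool" where
  "scale_map p q \<kappa> K \<Phi> \<longleftrightarrow> 1 \<le> K \<and> dist (\<Phi> p) q \<le> K \<and>
     (\<forall>x y. dist (\<Phi> x) (\<Phi> y) \<le> K * dist x y + K * \<kappa> (max (dist x p) (dist y p)) \<and>
            dist x y \<le> K * dist (\<Phi> x) (\<Phi> y) + K * \<kappa> (max (dist x p) (dist y p)))"

text \<open>Both compositions are controlled and the two maps play interchangeable roles, so every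
  result about \<open>\<Phi>\<close> can be applied to \<open>\<Psi>\<close> as well.\<close>

definition scale_equivalence ::
  "'a::metric_space \<Rightarrow> 'b::metric_space \<Rightarrow> (real \<Rightarrow> real) \<Rightarrow> real \<Rightarrow> ('a \<Rightarrow> 'b) \<Rightarrow> ('b \<Rightarrow> 'a) \<Rightarrow> bool" where
  "scale_equivalence p q \<kappa> K \<Phi> \<Psi> \<longleftrightarrow> scale_map p q \<kappa> K \<Phi> \<and> scale_map q p \<kappa> K \<Psi> \<and>
     (\<forall>x. dist (\<Psi> (\<Phi> x)) x \<le> K * \<kappa> (dist x p)) \<and> (\<forall>y. dist (\<Phi> (\<Psi> y)) y \<le> K * \<kappa> (dist y q))"

lemma scale_equivalence_sym: "scale_equivalence p q \<kappa> K \<Phi> \<Psi> \<Longrightarrow> scale_equivalence q p \<kappa> K \<Psi> \<Phi>"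
  by (auto simp: scale_equivalence_def)

lemma scale_mapD:
  assumes "scale_map p q \<kappa> K \<Phi>"
  shows "1 \<le> K" "dist (\<Phi> p) q \<le> K"
    "dist (\<Phi> x) (\<Phi> y) \<le> K * dist x y + K * \<kappa> (max (dist x p) (dist y p))"
    "dist x y \<le> K * dist (\<Phi> x) (\<Phi> y) + K * \<kappa> (max (dist x p) (dist y p))"
  using assms by (auto simp: scale_map_def)

context sublinear_scale
begin

lemma scale_max_le:
  assumes "0 \<le> a" "0 \<le> b" "\<kappa> a \<le> M" "\<kappa> b \<le> M"
  shows "\<kappa> (max a b) \<le> M"
  using assms by (simp add: max_def)

lemma scale_nonneg_max: "0 \<le> a \<Longrightarrow> 0 \<le> \<kappa> (max a b)"
  by (rule less_imp_le[OF scale_pos]) (simp add: le_max_iff_disj)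

lemma scale_map_mono:
  assumes "scale_map p q \<kappa> K \<Phi>" "K \<le> K'"
  shows "scale_map p q \<kappa> K' \<Phi>"
  unfolding scale_map_def
proof (intro conjI allI)
  show "1 \<le> K'" "dist (\<Phi> p) q \<le> K'" using scale_mapD(1,2)[OF assms(1)] assms(2) by auto
  fix x y
  have k: "K * \<kappa> (max (dist x p) (dist y p)) \<le> K' * \<kappa> (max (dist x p) (dist y p))"
    using assms(2) by (intro mult_right_mono scale_nonneg_max) auto
  have d: "K * dist x y \<le> K' * dist x y" "K * dist (\<Phi> x) (\<Phi> y) \<le> K' * dist (\<Phi> x) (\<Phi> y)"
    using assms(2) by (auto intro!: mult_right_mono)
  show "dist (\<Phi> x) (\<Phi> y) \<le> K' * dist x y + K' * \<kappa> (max (dist x p) (dist y p))"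
    using scale_mapD(3)[OF assms(1), of x y] k d by linarith
  show "dist x y \<le> K' * dist (\<Phi> x) (\<Phi> y) + K' * \<kappa> (max (dist x p) (dist y p))"
    using scale_mapD(4)[OF assms(1), of x y] k d by linarith
qed

lemma scale_map_norm:
  fixes \<Phi> :: "'a::metric_space \<Rightarrow> 'b::metric_space"
  assumes \<Phi>: "scale_map p q \<kappa> K \<Phi>"
  obtains C where "1 \<le> C" "\<And>x. dist x p \<le> C * dist (\<Phi> x) q + C" "\<And>x. \<kappa> (dist (\<Phi> x) q) \<le> C * \<kappa> (dist x p)"
proof -
  have K: "1 \<le> K" by (rule scale_mapD(1)[OF \<Phi>])
  obtain D where D: "0 \<le> D" "\<And>s. 0 \<le> s \<Longrightarrow> \<kappa> s \<le> 1 / (2 * K) * s + D"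
    using scale_small[of "1/(2*K)"] K by auto
  have KK: "K * \<kappa> s \<le> s / 2 + K * D" if "0 \<le> s" for s
    using D(2)[OF that] K mult_left_mono[of "\<kappa> s" "1 / (2 * K) * s + D" K] by (simp add: field_simps)
  have KD: "0 \<le> K * D" "0 \<le> K * K" using K D by auto
  define c where "c = 2 * K + 2 * (K * K) + 2 * (K * D)"
  have c: "2 * K \<le> c" "2 * (K * K) + 2 * (K * D) \<le> c" "K + 1 \<le> c" "K * D + K \<le> c" "0 \<le> c"
    unfolding c_def using KD K by linarith+
  obtain C1 where C1: "1 \<le> C1" "\<And>s t. 0 \<le> s \<Longrightarrow> 0 \<le> t \<Longrightarrow> t \<le> c * s + c \<Longrightarrow> \<kappa> t \<le> C1 * \<kappa> s"
    using scale_affine[OF c(5)] by auto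
  have n1: "dist x p \<le> c * dist (\<Phi> x) q + c" for x
  proof -
    have "dist x p \<le> K * dist (\<Phi> x) (\<Phi> p) + K * \<kappa> (dist x p)" using scale_mapD(4)[OF \<Phi>, of x p] by simp
    also have "K * dist (\<Phi> x) (\<Phi> p) \<le> K * (dist (\<Phi> x) q + K)"
      using K scale_mapD(2)[OF \<Phi>] dist_triangle[of "\<Phi> x" "\<Phi> p" q] by (intro mult_left_mono) (auto simp: dist_commute)
    finally have "dist x p \<le> K * dist (\<Phi> x) q + K * K + (dist x p / 2 + K * D)"
      using KK[of "dist x p"] by (simp add: algebra_simps)
    then have "dist x p \<le> (2 * K) * dist (\<Phi> x) q + (2 * (K * K) + 2 * (K * D))" by (simp add: algebra_simps)
    also have "\<dots> \<le> c * dist (\<Phi> x) q + c" using c by (intro add_mono mult_right_mono) auto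
    finally show ?thesis .
  qed
  have n2: "\<kappa> (dist (\<Phi> x) q) \<le> C1 * \<kappa> (dist x p)" for x
  proof (rule C1(2))
    have "dist (\<Phi> x) q \<le> K * dist x p + K * \<kappa> (dist x p) + K"
      using scale_mapD(3)[OF \<Phi>, of x p] scale_mapD(2)[OF \<Phi>] dist_triangle[of "\<Phi> x" q "\<Phi> p"] by simp
    also have "\<dots> \<le> (K + 1) * dist x p + (K * D + K)"
      using KK[OF zero_le_dist[of x p]] zero_le_dist[of x p] unfolding distrib_right by linarith
    also have "\<dots> \<le> c * dist x p + c" using c by (intro add_mono mult_right_mono) auto
    finally show "dist (\<Phi> x) q \<le> c * dist x p + c" .
  qed auto
  show ?thesis
  proof (rule that[of "max C1 c"])
    show "1 \<le> max C1 c" using C1 by simp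
    fix x
    show "dist x p \<le> max C1 c * dist (\<Phi> x) q + max C1 c"
      by (rule order_trans[OF n1[of x]]) (intro add_mono mult_right_mono, auto)
    show "\<kappa> (dist (\<Phi> x) q) \<le> max C1 c * \<kappa> (dist x p)"
      using less_imp_le[OF scale_pos[of "dist x p"]] by (intro order_trans[OF n2[of x]] mult_right_mono) auto
  qed
qed

text \<open>On a coarse ray the norm is comparable to time, so the error of \<open>\<Phi>\<close>,
  measured by norm, becomes an error measured by time.\<close>

lemma scale_map_ray:
  fixes \<Phi> :: "'a::metric_space \<Rightarrow> 'b::metric_space"
  assumes \<Phi>: "scale_map p q \<kappa> K \<Phi>" and A: "1 \<le> A"
  obtains A' where "1 \<le> A'" "\<And>f. scale_ray p \<kappa> A f \<Longrightarrow> scale_ray q \<kappa> A' (\<Phi> \<circ> f)"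
proof -
  have K: "1 \<le> K" by (rule scale_mapD(1)[OF \<Phi>])
  obtain C0 where C0: "1 \<le> C0" "\<And>f s. scale_ray p \<kappa> A f \<Longrightarrow> 0 \<le> s \<Longrightarrow> \<kappa> (dist (f s) p) \<le> C0 * \<kappa> s"
    using scale_ray_norm[OF A] by metis
  have pos: "0 < \<kappa> A" using A by (intro scale_pos) auto
  define A' where "A' = K * A + K * C0 + A * K * C0 + A + K * \<kappa> A + K"
  have nn: "0 \<le> K * A" "0 \<le> K * C0" "0 \<le> A * K * C0" "0 \<le> K * \<kappa> A" using K A C0(1) pos by auto
  have A': "1 \<le> A'" "K * A \<le> A'" "K * A + K * C0 \<le> A'" "A * K * C0 + A \<le> A'" "K * A + K * \<kappa> A + K \<le> A'"
    unfolding A'_def using nn A K by linarith+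
  show ?thesis
  proof (rule that[OF A'(1)])
    fix f assume f: "scale_ray p \<kappa> A f"
    show "scale_ray q \<kappa> A' (\<Phi> \<circ> f)"
      unfolding scale_ray_def o_apply
    proof (intro conjI allI impI)
      show "1 \<le> A'" by (rule A')
      have "dist (\<Phi> (f 0)) q \<le> K * dist (f 0) p + K * \<kappa> (dist (f 0) p) + K"
        using scale_mapD(3)[OF \<Phi>, of "f 0" p] scale_mapD(2)[OF \<Phi>] dist_triangle[of "\<Phi> (f 0)" q "\<Phi> p"] by simp
      also have "\<dots> \<le> K * A + K * \<kappa> A + K"
        using scale_rayD(2)[OF f] K by (intro add_mono mult_left_mono scale_mono) auto
      finally show "dist (\<Phi> (f 0)) q \<le> A'" using A' by linarith
      fix s t :: real assume st: "0 \<le> s" "0 \<le> t"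
      let ?k = "\<kappa> (max s t)"
      have k: "0 < ?k" by (rule scale_pos) (use st in auto)
      have "\<kappa> (dist (f s) p) \<le> C0 * ?k" "\<kappa> (dist (f t) p) \<le> C0 * ?k"
        using C0(2)[OF f st(1)] C0(2)[OF f st(2)] C0(1) scale_mono[of s "max s t"] scale_mono[of t "max s t"] st
        by (meson le_max_iff_disj mult_left_mono order_refl order_trans zero_le_one)+
      then have kn: "K * \<kappa> (max (dist (f s) p) (dist (f t) p)) \<le> K * (C0 * ?k)"
        using K by (intro mult_left_mono scale_max_le) auto
      have "dist (\<Phi> (f s)) (\<Phi> (f t)) \<le> K * (A * \<bar>s - t\<bar> + A * ?k) + K * (C0 * ?k)"
        using scale_mapD(3)[OF \<Phi>, of "f s" "f t"] kn K mult_left_mono[OF scale_rayD(3)[OF f st], of K] by linarith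
      also have "\<dots> = (K * A) * \<bar>s - t\<bar> + (K * A + K * C0) * ?k" by (simp add: algebra_simps)
      also have "\<dots> \<le> A' * \<bar>s - t\<bar> + A' * ?k" using A' k by (intro add_mono mult_right_mono) auto
      finally show "dist (\<Phi> (f s)) (\<Phi> (f t)) \<le> A' * \<bar>s - t\<bar> + A' * ?k" .
      have "A * dist (f s) (f t) \<le> A * (K * dist (\<Phi> (f s)) (\<Phi> (f t)) + K * (C0 * ?k))"
        using scale_mapD(4)[OF \<Phi>, of "f s" "f t"] kn A by (intro mult_left_mono) auto
      then have "\<bar>s - t\<bar> \<le> A * (K * dist (\<Phi> (f s)) (\<Phi> (f t)) + K * (C0 * ?k)) + A * ?k"
        using scale_rayD(4)[OF f st] by linarith
      also have "\<dots> = (K * A) * dist (\<Phi> (f s)) (\<Phi> (f t)) + (A * K * C0 + A) * ?k" by (simp add: algebra_simps)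
      also have "\<dots> \<le> A' * dist (\<Phi> (f s)) (\<Phi> (f t)) + A' * ?k" using A' k by (intro add_mono mult_right_mono) auto
      finally show "\<bar>s - t\<bar> \<le> A' * dist (\<Phi> (f s)) (\<Phi> (f t)) + A' * ?k" .
    qed
  qed
qed

text \<open>Distances to rays transform linearly, with an error governed by the time of the moving
  point alone: the nearest parameter \<open>w\<close> on \<open>g\<close> is at most linear in
  \<open>t\<close>, so the errors at \<open>g w\<close> are \<open>O(\<kappa> t)\<close>
  too.\<close>

lemma scale_map_infdist:
  fixes \<Phi> :: "'a::metric_space \<Rightarrow> 'b::metric_space"
  assumes \<Phi>: "scale_map p q \<kappa> K \<Phi>" and g: "scale_ray p \<kappa> A1 g"
    and close: "sublinearly_close \<kappa> (\<Phi> \<circ> g) g'" and A: "1 \<le> A"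
  obtains C where "1 \<le> C"
    "\<And>f t. scale_ray p \<kappa> A f \<Longrightarrow> 0 \<le> t \<Longrightarrow>
       infdist (\<Phi> (f t)) (ray_image g') \<le> C * infdist (f t) (ray_image g) + C * \<kappa> t"
proof -
  have K: "1 \<le> K" by (rule scale_mapD(1)[OF \<Phi>])
  define A0 where "A0 = max A A1"
  have A0: "1 \<le> A0" "A \<le> A0" "A1 \<le> A0" using A by (auto simp: A0_def)
  have g0: "scale_ray p \<kappa> A0 g" by (rule scale_ray_mono[OF g A0(3)])
  obtain C0 where C0: "1 \<le> C0"
    "\<And>f s. scale_ray p \<kappa> A0 f \<Longrightarrow> 0 \<le> s \<Longrightarrow> dist (f s) p \<le> C0 * s + C0"
    "\<And>f s. scale_ray p \<kappa> A0 f \<Longrightarrow> 0 \<le> s \<Longrightarrow> s \<le> C0 * dist (f s) p + C0"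
    "\<And>f s. scale_ray p \<kappa> A0 f \<Longrightarrow> 0 \<le> s \<Longrightarrow> \<kappa> (dist (f s) p) \<le> C0 * \<kappa> s"
    using scale_ray_norm[OF A0(1)] by metis
  obtain M0 where M0: "\<And>s. 0 \<le> s \<Longrightarrow> infdist (\<Phi> (g s)) (ray_image g') \<le> M0 * \<kappa> s"
    using close unfolding sublinearly_close_def by auto
  define c where "c = C0 * (2 * C0 + A1 + 1) + C0"
  have A1: "1 \<le> A1" by (rule scale_rayD(1)[OF g])
  have c: "0 \<le> c" using C0(1) A1 by (simp add: c_def)
  obtain C3 where C3: "1 \<le> C3" "\<And>s t. 0 \<le> s \<Longrightarrow> 0 \<le> t \<Longrightarrow> t \<le> c * s + c \<Longrightarrow> \<kappa> t \<le> C3 * \<kappa> s"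
    using scale_affine[OF c] by auto
  define C where "C = K + K * (C0 * C3) + \<bar>M0\<bar> * C3"
  have nn: "0 \<le> K * (C0 * C3)" "0 \<le> \<bar>M0\<bar> * C3" using K C0(1) C3(1) by auto
  show ?thesis
  proof (rule that[of C])
    show "1 \<le> C" unfolding C_def using nn K by linarith
    fix f t assume fA: "scale_ray p \<kappa> A f" and t: "0 \<le> (t::real)"
    have f: "scale_ray p \<kappa> A0 f" by (rule scale_ray_mono[OF fA A0(2)])
    define I where "I = infdist (f t) (ray_image g)"
    have I0: "0 \<le> I" by (simp add: I_def infdist_nonneg)
    have k: "1 \<le> \<kappa> t" by (rule scale_ge_1[OF t])
    obtain w where w: "0 \<le> w" "dist (f t) (g w) \<le> I + 1"
      unfolding I_def by (rule infdist_ray_image_approx[of 1 "f t" g]) auto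
    \<comment> \<open>The competitor \<open>g 0\<close> bounds the distance to \<open>g\<close>,
      hence the norm of \<open>g w\<close> and then \<open>w\<close> itself, linearly in
      \<open>t\<close>.\<close>
    have "I \<le> dist (f t) (g 0)" unfolding I_def by (rule infdist_ray_image_le) simp
    also have "\<dots> \<le> C0 * t + C0 + A1"
      using C0(2)[OF f t] scale_rayD(2)[OF g] dist_triangle[of "f t" "g 0" p] by (simp add: dist_commute)
    finally have gw: "dist (g w) p \<le> 2 * (C0 * t) + 2 * C0 + A1 + 1"
      using w(2) C0(2)[OF f t] dist_triangle[of "g w" p "f t"] by (simp add: dist_commute)
    have "w \<le> C0 * dist (g w) p + C0" by (rule C0(3)[OF g0 w(1)])
    also have "C0 * dist (g w) p \<le> C0 * (2 * (C0 * t) + 2 * C0 + A1 + 1)" using gw C0(1) by (intro mult_left_mono) auto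
    also have "C0 * (2 * (C0 * t) + 2 * C0 + A1 + 1) + C0 = C0 * (2 * C0) * t + c" by (simp add: c_def algebra_simps)
    also have "\<dots> \<le> c * t + c"
    proof -
      have "C0 * (2 * C0) \<le> C0 * (2 * C0 + A1 + 1)" using C0(1) A1 by (intro mult_left_mono) auto
      then have "C0 * (2 * C0) \<le> c" unfolding c_def using C0(1) by linarith
      then show ?thesis using t by (simp add: mult_right_mono)
    qed
    finally have "w \<le> c * t + c" by simp
    then have kw: "\<kappa> w \<le> C3 * \<kappa> t" by (rule C3(2)[OF t w(1)])
    have "\<kappa> (dist (g w) p) \<le> C0 * \<kappa> w" by (rule C0(4)[OF g0 w(1)])
    also have "\<dots> \<le> C0 * (C3 * \<kappa> t)" using kw C0(1) by (intro mult_left_mono) auto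
    finally have k1: "\<kappa> (dist (g w) p) \<le> C0 * (C3 * \<kappa> t)" .
    have "C0 * \<kappa> t \<le> C0 * (C3 * \<kappa> t)" using C0(1) C3(1) k by (intro mult_left_mono) auto
    then have k2: "\<kappa> (dist (f t) p) \<le> C0 * (C3 * \<kappa> t)" using C0(4)[OF f t] by linarith
    have "K * \<kappa> (max (dist (f t) p) (dist (g w) p)) \<le> K * (C0 * (C3 * \<kappa> t))"
      using K k1 k2 by (intro mult_left_mono scale_max_le) auto
    then have "dist (\<Phi> (f t)) (\<Phi> (g w)) \<le> K * (I + 1) + K * (C0 * (C3 * \<kappa> t))"
      using scale_mapD(3)[OF \<Phi>, of "f t" "g w"] mult_left_mono[OF w(2), of K] K by linarith
    moreover have "infdist (\<Phi> (g w)) (ray_image g') \<le> \<bar>M0\<bar> * (C3 * \<kappa> t)"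
    proof -
      have "infdist (\<Phi> (g w)) (ray_image g') \<le> M0 * \<kappa> w" by (rule M0[OF w(1)])
      also have "\<dots> \<le> \<bar>M0\<bar> * \<kappa> w" using scale_pos[OF w(1)] by (intro mult_right_mono) auto
      also have "\<dots> \<le> \<bar>M0\<bar> * (C3 * \<kappa> t)" using kw by (intro mult_left_mono) auto
      finally show ?thesis .
    qed
    ultimately have "infdist (\<Phi> (f t)) (ray_image g') \<le> K * I + K + K * (C0 * C3) * \<kappa> t + \<bar>M0\<bar> * C3 * \<kappa> t"
      using infdist_triangle[of "\<Phi> (f t)" "ray_image g'" "\<Phi> (g w)"] by (simp add: algebra_simps)
    moreover have "K * I \<le> C * I" unfolding C_def using nn I0 by (intro mult_right_mono) auto
    moreover have "K \<le> K * \<kappa> t" using K k by simp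
    ultimately show "infdist (\<Phi> (f t)) (ray_image g') \<le> C * infdist (f t) (ray_image g) + C * \<kappa> t"
      unfolding I_def[symmetric] by (simp add: C_def algebra_simps)
  qed
qed

text \<open>\<open>g'\<close> is near \<open>\<Phi> \<circ> g\<close> by symmetry of closeness, and
  \<open>\<Psi>\<close> carries this to nearness of \<open>\<Psi> \<circ> g'\<close> to
  \<open>g\<close>, since \<open>\<Psi> \<circ> \<Phi>\<close> is near the identity.\<close>

lemma scale_equivalence_close_sym:
  assumes eq: "scale_equivalence p q \<kappa> K \<Phi> \<Psi>"
    and g: "scale_ray p \<kappa> A1 g" and g': "scale_ray q \<kappa> A2 g'" and close: "sublinearly_close \<kappa> (\<Phi> \<circ> g) g'"
  shows "sublinearly_close \<kappa> (\<Psi> \<circ> g') g"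
proof -
  have \<Phi>: "scale_map p q \<kappa> K \<Phi>" and \<Psi>: "scale_map q p \<kappa> K \<Psi>" using eq by (auto simp: scale_equivalence_def)
  have K: "1 \<le> K" by (rule scale_mapD(1)[OF \<Phi>])
  obtain A3 where A3: "\<And>f. scale_ray p \<kappa> A1 f \<Longrightarrow> scale_ray q \<kappa> A3 (\<Phi> \<circ> f)"
    using scale_map_ray[OF \<Phi> scale_rayD(1)[OF g]] by metis
  have \<Phi>g: "scale_ray q \<kappa> A3 (\<Phi> \<circ> g)" by (rule A3[OF g])
  obtain C0 where C0: "\<And>s. 0 \<le> s \<Longrightarrow> \<kappa> (dist (g s) p) \<le> C0 * \<kappa> s"
    using scale_ray_norm[OF scale_rayD(1)[OF g]] g by metis
  have "sublinearly_close \<kappa> (\<Psi> \<circ> (\<Phi> \<circ> g)) g"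
  proof (rule sublinearly_closeI[where M = "K * C0"])
    fix s :: real assume s: "0 \<le> s"
    have "dist (\<Psi> (\<Phi> (g s))) (g s) \<le> K * \<kappa> (dist (g s) p)" using eq by (simp add: scale_equivalence_def)
    also have "\<dots> \<le> K * (C0 * \<kappa> s)" using C0[OF s] K by (intro mult_left_mono) auto
    finally show "\<exists>u\<ge>0. dist ((\<Psi> \<circ> (\<Phi> \<circ> g)) s) (g u) \<le> K * C0 * \<kappa> s" using s by (intro exI[of _ s]) auto
  qed
  from scale_map_infdist[OF \<Psi> \<Phi>g this scale_rayD(1)[OF g']] obtain C where
    C: "1 \<le> C" "\<And>f t. scale_ray q \<kappa> A2 f \<Longrightarrow> 0 \<le> t \<Longrightarrow>
       infdist (\<Psi> (f t)) (ray_image g) \<le> C * infdist (f t) (ray_image (\<Phi> \<circ> g)) + C * \<kappa> t" by metis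
  obtain M where M: "\<And>s. 0 \<le> s \<Longrightarrow> infdist (g' s) (ray_image (\<Phi> \<circ> g)) \<le> M * \<kappa> s"
    using sublinearly_close_sym[OF \<Phi>g g' close] unfolding sublinearly_close_def by auto
  have "infdist ((\<Psi> \<circ> g') s) (ray_image g) \<le> (C * M + C) * \<kappa> s" if s: "0 \<le> s" for s
  proof -
    have "C * infdist (g' s) (ray_image (\<Phi> \<circ> g)) \<le> C * (M * \<kappa> s)" using M[OF s] C(1) by (intro mult_left_mono) auto
    then have "infdist (\<Psi> (g' s)) (ray_image g) \<le> C * (M * \<kappa> s) + C * \<kappa> s" using C(2)[OF g' s] by linarith
    then show ?thesis by (simp add: algebra_simps)
  qed
  then show ?thesis unfolding sublinearly_close_def by blast
qed

lemma scale_equivalence_infdist: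
  fixes p :: "'a::metric_space" and q :: "'b::metric_space"
  assumes eq: "scale_equivalence p q \<kappa> K \<Phi> \<Psi>"
    and g: "scale_ray p \<kappa> A1 g" and close: "sublinearly_close \<kappa> (\<Phi> \<circ> g) g'" and A: "1 \<le> A"
  obtains C where "1 \<le> C" "\<And>f t. scale_ray q \<kappa> A f \<Longrightarrow> 0 \<le> t \<Longrightarrow>
       infdist (f t) (ray_image g') \<le> C * infdist (\<Psi> (f t)) (ray_image g) + C * \<kappa> t"
proof -
  have \<Phi>: "scale_map p q \<kappa> K \<Phi>" and \<Psi>: "scale_map q p \<kappa> K \<Psi>" using eq by (auto simp: scale_equivalence_def)
  have K: "1 \<le> K" by (rule scale_mapD(1)[OF \<Phi>])
  obtain A3 where A3: "1 \<le> A3" "\<And>f. scale_ray q \<kappa> A f \<Longrightarrow> scale_ray p \<kappa> A3 (\<Psi> \<circ> f)"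
    using scale_map_ray[OF \<Psi> A] by metis
  obtain C where C: "1 \<le> C" "\<And>f t. scale_ray p \<kappa> A3 f \<Longrightarrow> 0 \<le> t \<Longrightarrow>
       infdist (\<Phi> (f t)) (ray_image g') \<le> C * infdist (f t) (ray_image g) + C * \<kappa> t"
    using scale_map_infdist[OF \<Phi> g close A3(1)] by metis
  obtain C0 where C0: "1 \<le> C0" "\<And>f s. scale_ray q \<kappa> A f \<Longrightarrow> 0 \<le> s \<Longrightarrow> \<kappa> (dist (f s) q) \<le> C0 * \<kappa> s"
    using scale_ray_norm[OF A] by metis
  have KC: "0 \<le> K * C0" using K C0 by simp
  show ?thesis
  proof (rule that[of "C + K * C0"])
    show "1 \<le> C + K * C0" using C KC by linarith
    fix f t assume f: "scale_ray q \<kappa> A f" and t: "0 \<le> (t::real)"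
    have "dist (\<Phi> (\<Psi> (f t))) (f t) \<le> K * \<kappa> (dist (f t) q)" using eq by (simp add: scale_equivalence_def)
    also have "\<dots> \<le> K * (C0 * \<kappa> t)" using C0(2)[OF f t] K by (intro mult_left_mono) auto
    finally have "infdist (f t) (ray_image g') \<le> C * infdist (\<Psi> (f t)) (ray_image g) + C * \<kappa> t + K * (C0 * \<kappa> t)"
      using C(2)[OF A3(2)[OF f] t] infdist_triangle[of "f t" "ray_image g'" "\<Phi> (\<Psi> (f t))"] by (simp add: dist_commute)
    moreover have "0 \<le> K * C0 * infdist (\<Psi> (f t)) (ray_image g)" using KC by (simp add: infdist_nonneg)
    ultimately show "infdist (f t) (ray_image g') \<le> (C + K * C0) * infdist (\<Psi> (f t)) (ray_image g) + (C + K * C0) * \<kappa> t"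
      by (simp add: algebra_simps)
  qed
qed

text \<open>A test ray for \<open>g'\<close> is pulled back along \<open>\<Psi>\<close>: linear
  closeness passes to the pullback, the Morse property of \<open>g\<close> applies there, and the
  resulting sublinear closeness is pushed forward again. Times are unchanged, so
  \<open>\<delta>\<close> is kept; \<open>\<epsilon> / (2 * C1)\<close> leaves half of
  \<open>\<epsilon>\<close> for the error \<open>C1 * \<kappa> t\<close>.\<close>

lemma robustly_morse_scale_equivalence:
  fixes p :: "'a::metric_space" and q :: "'b::metric_space"
  assumes eq: "scale_equivalence p q \<kappa> K \<Phi> \<Psi>"
    and g: "scale_ray p \<kappa> A1 g" and g': "scale_ray q \<kappa> A2 g'" and close: "sublinearly_close \<kappa> (\<Phi> \<circ> g) g'"
    and Z: "robustly_morse p \<kappa> (ray_image g)"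
  shows "robustly_morse q \<kappa> (ray_image g')"
  unfolding robustly_morse_def
proof (intro allI impI)
  fix A :: real assume A: "1 \<le> A"
  have \<Psi>: "scale_map q p \<kappa> K \<Psi>" using eq by (auto simp: scale_equivalence_def)
  obtain A3 where A3: "1 \<le> A3" "\<And>f. scale_ray q \<kappa> A f \<Longrightarrow> scale_ray p \<kappa> A3 (\<Psi> \<circ> f)"
    using scale_map_ray[OF \<Psi> A] by metis
  obtain C1 where C1: "1 \<le> C1" "\<And>f t. scale_ray q \<kappa> A f \<Longrightarrow> 0 \<le> t \<Longrightarrow>
       infdist (\<Psi> (f t)) (ray_image g) \<le> C1 * infdist (f t) (ray_image g') + C1 * \<kappa> t"
    using scale_map_infdist[OF \<Psi> g' scale_equivalence_close_sym[OF eq g g' close] A] by metis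
  obtain C2 where C2: "1 \<le> C2" "\<And>f t. scale_ray q \<kappa> A f \<Longrightarrow> 0 \<le> t \<Longrightarrow>
       infdist (f t) (ray_image g') \<le> C2 * infdist (\<Psi> (f t)) (ray_image g) + C2 * \<kappa> t"
    using scale_equivalence_infdist[OF eq g close A] by metis
  obtain \<epsilon> \<delta> T M where P: "0 < \<epsilon>" "0 < \<delta>" "1 \<le> T" "1 \<le> M"
    "\<And>f t s. scale_ray p \<kappa> A3 f \<Longrightarrow> T \<le> t \<Longrightarrow> infdist (f t) (ray_image g) \<le> \<epsilon> * t \<Longrightarrow> 0 \<le> s \<Longrightarrow> s \<le> \<delta> * t \<Longrightarrow>
       infdist (f s) (ray_image g) \<le> M * \<kappa> s" by (rule robustly_morseE[OF Z A3(1)]) blast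
  obtain T1 where T1: "1 \<le> T1" "\<And>t. T1 \<le> t \<Longrightarrow> C1 * \<kappa> t + 0 \<le> (\<epsilon> / 2) * t"
    using scale_eventually_le[of "\<epsilon> / 2" C1 0] P(1) by auto
  have "infdist (f s) (ray_image g') \<le> (C2 * M + C2) * \<kappa> s"
    if f: "scale_ray q \<kappa> A f" and t: "max T T1 \<le> t" "infdist (f t) (ray_image g') \<le> \<epsilon> / (2 * C1) * t"
      and s: "0 \<le> s" "s \<le> \<delta> * t" for f t s
  proof -
    have t0: "0 \<le> t" using t T1 by simp
    have "C1 * infdist (f t) (ray_image g') \<le> C1 * (\<epsilon> / (2 * C1) * t)" using t C1(1) by (intro mult_left_mono) auto
    also have "\<dots> = \<epsilon> / 2 * t" using C1(1) by simp
    finally have "infdist (\<Psi> (f t)) (ray_image g) \<le> \<epsilon> * t"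
      using C1(2)[OF f t0] T1(2)[of t] t(1) by simp
    then have "infdist (\<Psi> (f s)) (ray_image g) \<le> M * \<kappa> s"
      using P(5)[OF A3(2)[OF f], of t s] t s by simp
    then have "C2 * infdist (\<Psi> (f s)) (ray_image g) \<le> C2 * (M * \<kappa> s)" using C2(1) by (intro mult_left_mono) auto
    then show ?thesis using C2(2)[OF f s(1)] by (simp add: algebra_simps)
  qed
  moreover have "0 < \<epsilon> / (2 * C1)" "1 \<le> max T T1" using P C1(1) by auto
  moreover have "1 \<le> C2 * M + C2" using C2(1) P(4) by (simp add: add_increasing)
  ultimately show "\<exists>\<epsilon>>0. \<exists>\<delta>>0. \<exists>T\<ge>1. \<exists>M\<ge>1. \<forall>f t. scale_ray q \<kappa> A f \<longrightarrow> T \<le> t \<longrightarrow>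
     infdist (f t) (ray_image g') \<le> \<epsilon> * t \<longrightarrow> (\<forall>s\<ge>0. s \<le> \<delta> * t \<longrightarrow> infdist (f s) (ray_image g') \<le> M * \<kappa> s)"
    using P(2) by blast
qed

lemma scale_equivalence_id: "scale_equivalence p p \<kappa> 1 id id"
proof -
  have "0 \<le> \<kappa> (max (dist x p) (dist y p))" for x y by (rule less_imp_le[OF scale_pos]) (simp add: le_max_iff_disj)
  moreover have "0 \<le> \<kappa> (dist x p)" for x by (rule less_imp_le[OF scale_pos]) simp
  ultimately show ?thesis by (auto simp: scale_equivalence_def scale_map_def)
qed

lemma robustly_morse_sublinearly_close:
  assumes "scale_ray p \<kappa> A1 g" "scale_ray p \<kappa> A2 g'" "sublinearly_close \<kappa> g g'" "robustly_morse p \<kappa> (ray_image g)"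
  shows "robustly_morse p \<kappa> (ray_image g')"
  using robustly_morse_scale_equivalence[OF scale_equivalence_id assms(1,2) _ assms(4)] assms(3) by simp

section \<open>From the given equivalence to a pair of coarsely inverse maps\<close>

text \<open>Domination speaks of times beyond \<open>t0\<close> only; evaluating it at the shifted
  time \<open>t + c\<close> and using monotonicity of \<open>\<theta>\<close> covers all
  \<open>t\<close>, while the shift costs only a factor in \<open>\<kappa>\<close>.\<close>

lemma dominates_le:
  assumes \<theta>: "strictly_sublinear \<theta>" and dom: "dominates \<kappa> \<theta>"
  obtains C where "1 \<le> C" "\<And>t. 0 \<le> t \<Longrightarrow> \<theta> t \<le> C * \<kappa> t"
proof -
  interpret \<theta>: sublinear_scale \<theta> using \<theta> by unfold_locales
  obtain C1 C2 t0 where d: "0 < C1" "0 \<le> t0" "\<And>t. t0 < t \<Longrightarrow> C1 * \<theta> t + C2 \<le> \<kappa> t"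
    using dom by (auto simp: dominates_def)
  define c where "c = t0 + 1"
  have c: "0 \<le> c" "1 \<le> c" using d by (auto simp: c_def)
  obtain C3 where C3: "1 \<le> C3" "\<And>s t. 0 \<le> s \<Longrightarrow> 0 \<le> t \<Longrightarrow> t \<le> c * s + c \<Longrightarrow> \<kappa> t \<le> C3 * \<kappa> s"
    using scale_affine[OF c(1)] by auto
  show ?thesis
  proof (rule that[of "max 1 ((C3 + \<bar>C2\<bar>) / C1)"])
    fix t :: real assume t: "0 \<le> t"
    have "C1 * \<theta> (t + c) + C2 \<le> \<kappa> (t + c)" using d t by (simp add: c_def)
    also have "\<kappa> (t + c) \<le> C3 * \<kappa> t" using t c mult_right_mono[of 1 c t] by (intro C3(2)) auto
    finally have "C1 * \<theta> (t + c) \<le> C3 * \<kappa> t + \<bar>C2\<bar>" by linarith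
    also have "\<bar>C2\<bar> \<le> \<bar>C2\<bar> * \<kappa> t" using mult_left_mono[OF scale_ge_1[OF t], of "\<bar>C2\<bar>"] by simp
    finally have "C1 * \<theta> (t + c) \<le> (C3 + \<bar>C2\<bar>) * \<kappa> t" by (simp add: algebra_simps)
    moreover have "C1 * \<theta> t \<le> C1 * \<theta> (t + c)" using d t c by (intro mult_left_mono \<theta>.scale_mono) auto
    ultimately have "C1 * \<theta> t \<le> (C3 + \<bar>C2\<bar>) * \<kappa> t" by linarith
    then have "\<theta> t \<le> (C3 + \<bar>C2\<bar>) / C1 * \<kappa> t" using d(1) by (simp add: field_simps)
    also have "\<dots> \<le> max 1 ((C3 + \<bar>C2\<bar>) / C1) * \<kappa> t" using scale_pos[OF t] by (intro mult_right_mono) auto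
    finally show "\<theta> t \<le> max 1 ((C3 + \<bar>C2\<bar>) / C1) * \<kappa> t" .
  qed simp
qed

text \<open>\<open>\<Psi>\<close> picks for each \<open>y\<close> a point whose image is
  \<open>O(\<kappa>)\<close>-close to \<open>y\<close>, by coarse surjectivity; its two inequalities
  are those of \<open>\<Phi>\<close> read at the chosen points.\<close>

lemma biLipschitz_scale_equivalence:
  fixes p :: "'a::metric_space" and q :: "'b::metric_space"
  assumes L: "1 \<le> L" and \<theta>: "strictly_sublinear \<theta>" and dom: "dominates \<kappa> \<theta>"
    and sbe: "sublinear_biLipschitz_equivalence p q L \<theta> \<Phi>"
  obtains K \<Psi> where "scale_equivalence p q \<kappa> K \<Phi> \<Psi>"
proof -
  obtain C where C: "1 \<le> C" "\<And>t. 0 \<le> t \<Longrightarrow> \<theta> t \<le> C * \<kappa> t" using dominates_le[OF \<theta> dom] by metis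
  define K where "K = max (L * C) (dist (\<Phi> p) q)"
  have LC: "L \<le> L * C" "C \<le> L * C" using L C(1) mult_left_mono[of 1 C L] mult_right_mono[of 1 L C] by auto
  have K: "1 \<le> K" "L \<le> K" "C \<le> K" "L * C \<le> K" "dist (\<Phi> p) q \<le> K"
    unfolding K_def using L LC by linarith+
  have \<Phi>: "scale_map p q \<kappa> K \<Phi>"
    unfolding scale_map_def
  proof (intro conjI allI)
    fix x y
    let ?m = "max (dist x p) (dist y p)"
    have m: "0 \<le> ?m" by (simp add: le_max_iff_disj)
    have k: "0 < \<kappa> ?m" by (rule scale_pos[OF m])
    have s1: "1 / L * dist x y - \<theta> ?m \<le> dist (\<Phi> x) (\<Phi> y)" and s2: "dist (\<Phi> x) (\<Phi> y) \<le> L * dist x y + \<theta> ?m"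
      using sbe by (auto simp: sublinear_biLipschitz_equivalence_def)
    have "L * dist x y \<le> K * dist x y" using K by (intro mult_right_mono) auto
    moreover have "C * \<kappa> ?m \<le> K * \<kappa> ?m" using K k by (intro mult_right_mono) auto
    ultimately show "dist (\<Phi> x) (\<Phi> y) \<le> K * dist x y + K * \<kappa> ?m" using s2 C(2)[OF m] by linarith
    have "dist x y \<le> L * dist (\<Phi> x) (\<Phi> y) + L * \<theta> ?m" using s1 L by (simp add: field_simps)
    also have "L * \<theta> ?m \<le> L * (C * \<kappa> ?m)" using C(2)[OF m] L by (intro mult_left_mono) auto
    finally have "dist x y \<le> L * dist (\<Phi> x) (\<Phi> y) + L * C * \<kappa> ?m" by simp
    also have "\<dots> \<le> K * dist (\<Phi> x) (\<Phi> y) + K * \<kappa> ?m" using K k by (intro add_mono mult_right_mono) auto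
    finally show "dist x y \<le> K * dist (\<Phi> x) (\<Phi> y) + K * \<kappa> ?m" .
  qed (use K in auto)
  obtain D where D: "0 \<le> D" "nbhd q \<theta> (range \<Phi>) D = UNIV"
    using sbe by (auto simp: sublinear_biLipschitz_equivalence_def)
  \<comment> \<open>The summand 1 makes the inequality below strict, so a suitable point exists even
    if the infimum is not attained.\<close>
  define E where "E = D * C + 1"
  have E: "1 \<le> E" using D C by (simp add: E_def)
  have "\<exists>x. dist (\<Phi> x) y \<le> E * \<kappa> (dist y q)" for y
  proof -
    have "y \<in> nbhd q \<theta> (range \<Phi>) D" using D by simp
    then have "infdist y (range \<Phi>) \<le> D * \<theta> (dist y q)" by (simp add: nbhd_def)
    also have "\<dots> \<le> D * (C * \<kappa> (dist y q))" using D C(2) by (intro mult_left_mono) auto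
    also have "\<dots> < E * \<kappa> (dist y q)" using scale_pos[of "dist y q"] by (simp add: E_def algebra_simps)
    finally have "(INF z\<in>range \<Phi>. dist y z) < E * \<kappa> (dist y q)" by (simp add: infdist_notempty)
    then have "\<exists>z\<in>range \<Phi>. dist y z < E * \<kappa> (dist y q)" by (subst (asm) cINF_less_iff) auto
    then show ?thesis by (auto simp: dist_commute intro: less_imp_le)
  qed
  then obtain \<Psi> where \<Psi>: "\<And>y. dist (\<Phi> (\<Psi> y)) y \<le> E * \<kappa> (dist y q)" by metis
  obtain C0 where C0: "1 \<le> C0" "\<And>x. dist x p \<le> C0 * dist (\<Phi> x) q + C0" "\<And>x. \<kappa> (dist (\<Phi> x) q) \<le> C0 * \<kappa> (dist x p)"
    using scale_map_norm[OF \<Phi>] by metis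
  obtain H where H: "0 \<le> H" "\<And>s. 0 \<le> s \<Longrightarrow> \<kappa> s \<le> 1 * s + H" using scale_small[of 1] by auto
  define c where "c = C0 * (1 + E) + C0 * (E * H) + C0"
  have c: "0 \<le> c" using C0(1) E H(1) by (simp add: c_def)
  obtain C3 where C3: "1 \<le> C3" "\<And>s t. 0 \<le> s \<Longrightarrow> 0 \<le> t \<Longrightarrow> t \<le> c * s + c \<Longrightarrow> \<kappa> t \<le> C3 * \<kappa> s"
    using scale_affine[OF c] by auto
  \<comment> \<open>The errors of \<open>\<Phi>\<close> at \<open>\<Psi> y\<close> are measured by
    the norm of \<open>\<Psi> y\<close>; this trades it for the norm of \<open>y\<close>.\<close>
  have kPsi: "\<kappa> (dist (\<Psi> y) p) \<le> C3 * \<kappa> (dist y q)" for y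
  proof (rule C3(2))
    have "dist (\<Psi> y) p \<le> C0 * dist (\<Phi> (\<Psi> y)) q + C0" by (rule C0(2))
    also have "C0 * dist (\<Phi> (\<Psi> y)) q \<le> C0 * (dist y q + E * (dist y q + H))"
    proof -
      have "E * \<kappa> (dist y q) \<le> E * (dist y q + H)" using H(2)[of "dist y q"] E by (intro mult_left_mono) auto
      then show ?thesis using \<Psi>[of y] dist_triangle[of "\<Phi> (\<Psi> y)" q y] C0(1) by (intro mult_left_mono) auto
    qed
    also have "C0 * (dist y q + E * (dist y q + H)) + C0 \<le> c * dist y q + c"
    proof -
      have "0 \<le> (C0 * (E * H) + C0) * dist y q" "0 \<le> C0 * (1 + E)" using C0(1) E H(1) by auto
      then show ?thesis by (simp add: c_def algebra_simps)
    qed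
    finally show "dist (\<Psi> y) p \<le> c * dist y q + c" by simp
  qed auto
  define K' where "K' = K * (2 * E) + K * C3 + 2 * E + K * (E * C0) + K * (C3 * C0) + dist (\<Psi> q) p"
  have nn: "0 \<le> K * E" "0 \<le> K * C3" "0 \<le> K * (E * C0)" "0 \<le> K * (C3 * C0)" "0 \<le> dist (\<Psi> q) p" "K \<le> K * E"
    using K(1) E C3(1) C0(1) by auto
  have K': "1 \<le> K'" "K \<le> K'" "K * (2 * E) + K * C3 \<le> K'" "K * C3 + 2 * E \<le> K'" "K * (E * C0) + K * (C3 * C0) \<le> K'"
    "E \<le> K'" "dist (\<Psi> q) p \<le> K'"
    unfolding K'_def using nn K(1) E by linarith+
  have "scale_map q p \<kappa> K' \<Psi>"
    unfolding scale_map_def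
  proof (intro conjI allI)
    fix x y
    let ?k = "\<kappa> (max (dist x q) (dist y q))"
    have k: "0 < ?k" by (rule scale_pos) (simp add: le_max_iff_disj)
    have kx: "\<kappa> (dist x q) \<le> ?k" "\<kappa> (dist y q) \<le> ?k" by (auto intro!: scale_mono)
    have "C3 * \<kappa> (dist x q) \<le> C3 * ?k" "C3 * \<kappa> (dist y q) \<le> C3 * ?k" using kx C3(1) by (auto intro!: mult_left_mono)
    then have km: "\<kappa> (max (dist (\<Psi> x) p) (dist (\<Psi> y) p)) \<le> C3 * ?k"
      using kPsi[of x] kPsi[of y] by (intro scale_max_le) auto
    then have Kkm: "K * \<kappa> (max (dist (\<Psi> x) p) (dist (\<Psi> y) p)) \<le> K * (C3 * ?k)" using K by (intro mult_left_mono) auto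
    have "E * \<kappa> (dist x q) \<le> E * ?k" "E * \<kappa> (dist y q) \<le> E * ?k" using kx E by (auto intro!: mult_left_mono)
    then have e: "dist (\<Phi> (\<Psi> x)) x \<le> E * ?k" "dist (\<Phi> (\<Psi> y)) y \<le> E * ?k" using \<Psi>[of x] \<Psi>[of y] by auto
    have "dist (\<Phi> (\<Psi> x)) (\<Phi> (\<Psi> y)) \<le> dist x y + E * ?k + E * ?k"
      using e dist_triangle[of "\<Phi> (\<Psi> x)" "\<Phi> (\<Psi> y)" x] dist_triangle[of x "\<Phi> (\<Psi> y)" y] by (simp add: dist_commute)
    then have "K * dist (\<Phi> (\<Psi> x)) (\<Phi> (\<Psi> y)) \<le> K * (dist x y + E * ?k + E * ?k)" using K by (intro mult_left_mono) auto
    then have "dist (\<Psi> x) (\<Psi> y) \<le> K * dist x y + (K * (2 * E) + K * C3) * ?k"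
      using scale_mapD(4)[OF \<Phi>, of "\<Psi> x" "\<Psi> y"] Kkm by (simp add: algebra_simps)
    also have "\<dots> \<le> K' * dist x y + K' * ?k" using K' k by (intro add_mono mult_right_mono) auto
    finally show "dist (\<Psi> x) (\<Psi> y) \<le> K' * dist x y + K' * ?k" .
    have "dist x y \<le> dist (\<Phi> (\<Psi> x)) (\<Phi> (\<Psi> y)) + E * ?k + E * ?k"
      using e dist_triangle[of x y "\<Phi> (\<Psi> x)"] dist_triangle[of "\<Phi> (\<Psi> x)" y "\<Phi> (\<Psi> y)"] by (simp add: dist_commute)
    also have "dist (\<Phi> (\<Psi> x)) (\<Phi> (\<Psi> y)) \<le> K * dist (\<Psi> x) (\<Psi> y) + K * (C3 * ?k)"
      using scale_mapD(3)[OF \<Phi>, of "\<Psi> x" "\<Psi> y"] Kkm by linarith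
    finally have "dist x y \<le> K * dist (\<Psi> x) (\<Psi> y) + (K * C3 + 2 * E) * ?k" by (simp add: algebra_simps)
    also have "\<dots> \<le> K' * dist (\<Psi> x) (\<Psi> y) + K' * ?k" using K' k by (intro add_mono mult_right_mono) auto
    finally show "dist x y \<le> K' * dist (\<Psi> x) (\<Psi> y) + K' * ?k" .
  qed (use K' in auto)
  moreover have "dist (\<Phi> (\<Psi> y)) y \<le> K' * \<kappa> (dist y q)" for y
    using \<Psi>[of y] mult_right_mono[OF K'(6) less_imp_le[OF scale_pos[of "dist y q"]]] by simp
  moreover have "dist (\<Psi> (\<Phi> x)) x \<le> K' * \<kappa> (dist x p)" for x
  proof -
    have k: "0 < \<kappa> (dist x p)" by (rule scale_pos) simp
    have "E * \<kappa> (dist (\<Phi> x) q) \<le> E * (C0 * \<kappa> (dist x p))" using C0(3)[of x] E by (intro mult_left_mono) auto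
    then have "K * dist (\<Phi> (\<Psi> (\<Phi> x))) (\<Phi> x) \<le> K * (E * (C0 * \<kappa> (dist x p)))"
      using \<Psi>[of "\<Phi> x"] K by (intro mult_left_mono) auto
    moreover have "K * \<kappa> (max (dist (\<Psi> (\<Phi> x)) p) (dist x p)) \<le> K * (C3 * (C0 * \<kappa> (dist x p)))"
    proof (intro mult_left_mono scale_max_le)
      have "C3 * \<kappa> (dist (\<Phi> x) q) \<le> C3 * (C0 * \<kappa> (dist x p))" using C0(3)[of x] C3(1) by (intro mult_left_mono) auto
      then show "\<kappa> (dist (\<Psi> (\<Phi> x)) p) \<le> C3 * (C0 * \<kappa> (dist x p))" using kPsi[of "\<Phi> x"] by linarith
      have "1 \<le> C3 * C0" using C3(1) mult_mono[OF C3(1) C0(1)] by simp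
      then show "\<kappa> (dist x p) \<le> C3 * (C0 * \<kappa> (dist x p))" using k mult_right_mono[of 1 "C3 * C0" "\<kappa> (dist x p)"] by simp
    qed (use K in auto)
    ultimately have "dist (\<Psi> (\<Phi> x)) x \<le> (K * (E * C0) + K * (C3 * C0)) * \<kappa> (dist x p)"
      using scale_mapD(4)[OF \<Phi>, of "\<Psi> (\<Phi> x)" x] by (simp add: algebra_simps)
    also have "\<dots> \<le> K' * \<kappa> (dist x p)" using K' k by (intro mult_right_mono) auto
    finally show ?thesis .
  qed
  ultimately have "scale_equivalence p q \<kappa> K' \<Phi> \<Psi>"
    using scale_map_mono[OF \<Phi> K'(2)] by (simp add: scale_equivalence_def)
  then show ?thesis by (rule that)
qed

end

section \<open>Geodesic representatives and boundary classes\<close>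

lemma geodesic_ray_Lipschitz: "geodesic_ray p \<eta> \<Longrightarrow> Lipschitz_ray 1 \<eta>"
  by (simp add: geodesic_ray_def Lipschitz_ray_def)

lemma geodesic_ray_quasi_geodesic: "geodesic_ray p \<eta> \<Longrightarrow> quasi_geodesic_ray p 1 0 \<eta>"
  using Lipschitz_ray_continuous[OF geodesic_ray_Lipschitz] by (auto simp: geodesic_ray_def quasi_geodesic_ray_def)

text \<open>Tychonoff in place of a diagonal sequence: the paths lie in a product of closed balls,
  compact for pointwise convergence, and a cluster point inherits every closed condition on finitely
  many coordinates.\<close>

lemma limit_geodesic_ray:
  fixes p :: "'a::metric_space"
  assumes proper: "\<And>(x::'a) r. compact (cball x r)"
    and f0: "\<And>n::nat. f n 0 = p"
    and geo: "\<And>n s t. 0 \<le> s \<Longrightarrow> s \<le> real n \<Longrightarrow> 0 \<le> t \<Longrightarrow> t \<le> real n \<Longrightarrow> dist (f n s) (f n t) = \<bar>s - t\<bar>"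
    and near: "\<And>n s. 0 \<le> s \<Longrightarrow> infdist (f n s) Z \<le> b s"
  obtains \<eta> where "geodesic_ray p \<eta>" "\<And>s. 0 \<le> s \<Longrightarrow> infdist (\<eta> s) Z \<le> b s"
proof -
  \<comment> \<open>Cut off outside \<open>{0..n}\<close>, where the geodesic hypothesis says
    nothing, so that all coordinates stay in the balls of \<open>K\<close>.\<close>
  define h where "h n s = (if 0 \<le> s \<and> s \<le> real n then f n s else p)" for n s
  define K where "K = PiE UNIV (\<lambda>t::real. cball p \<bar>t\<bar>)"
  have "compactin (product_topology (\<lambda>i. euclidean) UNIV) K"
    unfolding K_def compactin_PiE using proper by simp
  then have K: "compact K" by (simp add: euclidean_product_topology)
  have hK: "h n \<in> K" for n
  proof -
    have "dist p (h n s) \<le> \<bar>s\<bar>" for s using geo[of 0 n s] f0[of n] by (auto simp: h_def)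
    then show ?thesis by (auto simp: K_def PiE_iff)
  qed
  have "\<exists>\<eta>\<in>K. inf (nhds \<eta>) (filtermap h sequentially) \<noteq> bot"
    using K hK unfolding compact_filter by (auto simp: eventually_filtermap filtermap_bot_iff)
  then obtain \<eta> where \<eta>: "\<eta> \<in> K" "inf (nhds \<eta>) (filtermap h sequentially) \<noteq> bot" by blast
  have limit: "\<eta> \<in> S" if S: "closed S" "eventually (\<lambda>n. h n \<in> S) sequentially" for S
  proof (rule ccontr)
    assume "\<eta> \<notin> S"
    then have "eventually (\<lambda>x. x \<in> - S) (nhds \<eta>)" using S(1) by (intro eventually_nhds_in_open) (auto simp: open_closed)
    moreover have "eventually (\<lambda>x. x \<in> S) (filtermap h sequentially)" using S(2) by (simp add: eventually_filtermap)
    ultimately have "eventually (\<lambda>x. False) (inf (nhds \<eta>) (filtermap h sequentially))"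
      unfolding eventually_inf by (intro exI[of _ "\<lambda>x. x \<in> - S"] exI[of _ "\<lambda>x. x \<in> S"]) auto
    then show False using \<eta>(2) by (simp add: trivial_limit_def)
  qed
  have cont: "continuous_on UNIV (\<lambda>x :: real \<Rightarrow> 'a. x s)" for s by (rule continuous_on_product_coordinates)
  show ?thesis
  proof (rule that[of \<eta>])
    show "geodesic_ray p \<eta>" unfolding geodesic_ray_def
    proof (intro conjI allI impI)
      have "\<forall>t. \<eta> t \<in> cball p \<bar>t\<bar>" using \<eta>(1) by (simp add: K_def PiE_iff)
      then have "\<eta> 0 \<in> cball p \<bar>0\<bar>" by (rule spec)
      then show "\<eta> 0 = p" by simp
      fix s t :: real assume st: "0 \<le> s" "0 \<le> t"
      have "\<eta> \<in> {x. dist (x s) (x t) = \<bar>s - t\<bar>}"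
      proof (rule limit)
        show "closed {x :: real \<Rightarrow> 'a. dist (x s) (x t) = \<bar>s - t\<bar>}" by (intro closed_Collect_eq continuous_intros cont)
        obtain N :: nat where "max s t \<le> N" using real_arch_simple by blast
        then have "\<forall>n\<ge>N. h n \<in> {x. dist (x s) (x t) = \<bar>s - t\<bar>}" using geo st by (auto simp: h_def)
        then show "eventually (\<lambda>n. h n \<in> {x. dist (x s) (x t) = \<bar>s - t\<bar>}) sequentially"
          unfolding eventually_sequentially by blast
      qed
      then show "dist (\<eta> s) (\<eta> t) = \<bar>s - t\<bar>" by simp
    qed
    fix s :: real assume s: "0 \<le> s"
    have "\<eta> \<in> {x. infdist (x s) Z \<le> b s}"
    proof (rule limit)
      show "closed {x :: real \<Rightarrow> 'a. infdist (x s) Z \<le> b s}" by (intro closed_Collect_le continuous_on_infdist continuous_intros cont)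
      obtain N :: nat where "s \<le> N" using real_arch_simple by blast
      then have "\<forall>n\<ge>N. h n \<in> {x. infdist (x s) Z \<le> b s}" using near s by (auto simp: h_def)
      then show "eventually (\<lambda>n. h n \<in> {x. infdist (x s) Z \<le> b s}) sequentially"
        unfolding eventually_sequentially by blast
    qed
    then show "infdist (\<eta> s) Z \<le> b s" by simp
  qed
qed

context sublinear_scale
begin

text \<open>The tail of \<open>\<zeta>\<close> is entered at a point that almost minimises the distance to the basepoint; this
  keeps the geodesic from the basepoint to that point quasi-transverse to the tail.\<close>

lemma geodesic_then_tail:
  fixes p :: "'a::metric_space"
  assumes geo: "\<And>x y::'a. \<exists>g. geodesic_segment g x y" and qg: "quasi_geodesic_ray p q Q \<zeta>"
  obtains f d where "N \<le> d" "scale_ray p \<kappa> (4 * q + q * Q + Q + 1) f" "f 0 = p"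
    "\<And>s t. 0 \<le> s \<Longrightarrow> s \<le> d \<Longrightarrow> 0 \<le> t \<Longrightarrow> t \<le> d \<Longrightarrow> dist (f s) (f t) = \<bar>s - t\<bar>"
    "\<And>t. d < t \<Longrightarrow> f t \<in> ray_image \<zeta>"
proof -
  define A where "A = 4 * q + q * Q + Q + 1"
  have q: "1 \<le> q" "0 \<le> Q" and z0: "\<zeta> 0 = p" using qg by (auto simp: quasi_geodesic_ray_def)
  have zu: "dist (\<zeta> s) (\<zeta> t) \<le> q * \<bar>s - t\<bar> + Q" if "0 \<le> s" "0 \<le> t" for s t
    using qg that by (simp add: quasi_geodesic_ray_def)
  have zl: "\<bar>s - t\<bar> \<le> q * dist (\<zeta> s) (\<zeta> t) + q * Q" if "0 \<le> s" "0 \<le> t" for s t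
  proof -
    have "1 / q * \<bar>s - t\<bar> - Q \<le> dist (\<zeta> s) (\<zeta> t)" using qg that by (simp add: quasi_geodesic_ray_def)
    then show ?thesis using q by (simp add: field_simps)
  qed
  have qQ: "0 \<le> q * Q" using q by simp
  have A: "1 \<le> A" "q \<le> A" "Q \<le> A" "2 * q + 1 \<le> A" "q * Q + q + 1 \<le> A" "q * Q \<le> A"
    unfolding A_def using q qQ by linarith+
  \<comment> \<open>From this time on, the lower quasi-geodesic bound keeps \<open>\<zeta>\<close>
    at distance at least \<open>N\<close> from the basepoint.\<close>
  define \<tau>0 where "\<tau>0 = q * (\<bar>N\<bar> + Q)"
  have \<tau>0: "0 \<le> \<tau>0" using q by (simp add: \<tau>0_def)
  define S where "S = (\<lambda>s. dist (\<zeta> s) p) ` {\<tau>0..}"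
  have "Inf S < Inf S + 1" by simp
  moreover have bdd: "bdd_below S" by (auto simp: S_def intro: bdd_belowI[where m = 0])
  moreover have "S \<noteq> {}" by (auto simp: S_def)
  ultimately obtain x where "x \<in> S" "x < Inf S + 1" using cInf_less_iff by blast
  then obtain \<tau> where \<tau>: "\<tau>0 \<le> \<tau>" "dist (\<zeta> \<tau>) p < Inf S + 1" by (auto simp: S_def)
  have min: "dist (\<zeta> \<tau>) p \<le> dist (\<zeta> s) p + 1" if "\<tau> \<le> s" for s
  proof -
    have "Inf S \<le> dist (\<zeta> s) p" using that \<tau> bdd by (intro cInf_lower) (auto simp: S_def)
    then show ?thesis using \<tau> by simp
  qed
  define d where "d = dist p (\<zeta> \<tau>)"
  have d0: "0 \<le> d" by (simp add: d_def)
  have \<tau>p: "0 \<le> \<tau>" using \<tau> \<tau>0 by simp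
  have "q * (\<bar>N\<bar> + Q) \<le> q * d + q * Q" using zl[OF \<tau>p, of 0] \<tau> \<tau>p z0 by (simp add: \<tau>0_def d_def dist_commute)
  then have "q * \<bar>N\<bar> \<le> q * d" by (simp add: algebra_simps)
  then have Nd: "N \<le> d" using q by simp
  obtain g where g: "geodesic_segment g p (\<zeta> \<tau>)" using geo by blast
  define f where "f s = (if s \<le> d then g s else \<zeta> (\<tau> + (s - d)))" for s
  have f1: "dist (f s) (f t) = \<bar>s - t\<bar>" if "0 \<le> s" "s \<le> d" "0 \<le> t" "t \<le> d" for s t
    using g that by (auto simp: f_def geodesic_segment_def d_def)
  have f0: "f 0 = p" using g d0 by (simp add: f_def geodesic_segment_def)
  have fd: "f d = \<zeta> \<tau>" using g by (simp add: f_def geodesic_segment_def d_def)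
  have mix: "dist (f s) (f t) \<le> A * (t - s) + A \<and> t - s \<le> A * dist (f s) (f t) + A" if st: "0 \<le> s" "s \<le> t" for s t
  proof -
    define D where "D = dist (f s) (f t)"
    have D0: "0 \<le> D" by (simp add: D_def)
    have AD: "c * D \<le> A * D" if "c \<le> A" for c using that D0 by (rule mult_right_mono)
    have At: "c * (t - s) \<le> A * (t - s)" if "c \<le> A" for c using that st by (intro mult_right_mono) auto
    consider "t \<le> d" | "s \<le> d" "d < t" | "d < s" by linarith
    then have "D \<le> q * (t - s) + Q \<and> t - s \<le> (2 * q + 1) * D + (q * Q + q + 1)"
    proof cases
      case 1
      have eq: "D = t - s" using f1[of s t] 1 st by (simp add: D_def)
      have "0 \<le> (q - 1) * D" "0 \<le> 2 * q * D" using q D0 by auto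
      then show ?thesis using q qQ unfolding eq[symmetric] by (simp add: algebra_simps)
    next
      case 2
      define e where "e = t - d"
      have e: "0 < e" using 2 by (simp add: e_def)
      have ft: "f t = \<zeta> (\<tau> + e)" using 2 by (simp add: f_def e_def)
      have sd: "dist (f s) (\<zeta> \<tau>) = d - s" using f1[of s d] fd st 2 d0 by simp
      have y: "dist (\<zeta> \<tau>) (f t) \<le> q * e + Q" "e \<le> q * dist (\<zeta> \<tau>) (f t) + q * Q"
        using zu[of \<tau> "\<tau> + e"] zl[of \<tau> "\<tau> + e"] \<tau>p e ft by auto
      have "D \<le> (d - s) + (q * e + Q)" using y(1) sd dist_triangle[of "f s" "f t" "\<zeta> \<tau>"] by (simp add: D_def)
      moreover have "d - s \<le> q * (d - s)" using q 2 mult_right_mono[of 1 q "d - s"] by simp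
      ultimately have up: "D \<le> q * (t - s) + Q" by (simp add: e_def algebra_simps)
      \<comment> \<open>By almost minimality \<open>f t\<close> has norm at least
        \<open>d - 1\<close>, while it is at distance \<open>D\<close> from \<open>f s\<close>,
        whose norm is \<open>s\<close>; so the rest of the geodesic has length at most
        \<open>D + 1\<close>.\<close>
      have "dist (f s) p = s" using f1[of s 0] f0 st 2 d0 by simp
      then have "d - 1 \<le> s + D"
        using min[of "\<tau> + e"] e ft dist_triangle[of "f t" p "f s"] by (simp add: D_def d_def dist_commute)
      then have ds: "d - s \<le> D + 1" by simp
      have "dist (\<zeta> \<tau>) (f t) \<le> D + (d - s)" using sd dist_triangle[of "\<zeta> \<tau>" "f t" "f s"] by (simp add: D_def dist_commute)
      then have "q * dist (\<zeta> \<tau>) (f t) \<le> q * (D + (D + 1))" using ds q by (intro mult_left_mono) auto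
      then have "e \<le> 2 * q * D + q + q * Q" using y(2) by (simp add: algebra_simps)
      then have "t - s \<le> (2 * q + 1) * D + (q * Q + q + 1)" using ds by (simp add: e_def algebra_simps)
      with up show ?thesis by blast
    next
      case 3
      have "D \<le> q * (t - s) + Q" "t - s \<le> q * D + q * Q"
        using zu[of "\<tau> + (s - d)" "\<tau> + (t - d)"] zl[of "\<tau> + (s - d)" "\<tau> + (t - d)"] 3 st \<tau>p by (auto simp: D_def f_def)
      moreover have "0 \<le> (q + 1) * D" using q D0 by simp
      ultimately show ?thesis using q by (simp add: algebra_simps)
    qed
    then show ?thesis using AD[of "2 * q + 1"] At[of q] A unfolding D_def by linarith
  qed
  have "scale_ray p \<kappa> A f" unfolding scale_ray_def
  proof (intro conjI allI impI)
    show "1 \<le> A" "dist (f 0) p \<le> A" using A f0 by auto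
    fix s t :: real assume st: "0 \<le> s" "0 \<le> t"
    have "1 \<le> \<kappa> (max s t)" by (rule scale_ge_1) (use st in auto)
    then have k: "A \<le> A * \<kappa> (max s t)" using A(1) by simp
    show "dist (f s) (f t) \<le> A * \<bar>s - t\<bar> + A * \<kappa> (max s t)"
      using mix[of s t] mix[of t s] st k by (cases "s \<le> t") (auto simp: dist_commute)
    show "\<bar>s - t\<bar> \<le> A * dist (f s) (f t) + A * \<kappa> (max s t)"
      using mix[of s t] mix[of t s] st k by (cases "s \<le> t") (auto simp: dist_commute)
  qed
  then show ?thesis
  proof (intro that[of d f])
    show "f t \<in> ray_image \<zeta>" if "d < t" for t using that \<tau>p by (auto simp: f_def ray_image_def)
  qed (use Nd f0 f1 in \<open>auto simp: A_def\<close>)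
qed

text \<open>Approximants that are geodesic up to a time at least \<open>n\<close> and then run along
  \<open>\<zeta>\<close> have distance 0 from \<open>\<zeta>\<close> at arbitrarily late times. The
  robust Morse property, with one constant for all of them, keeps them
  \<open>O(\<kappa>)\<close>-close to \<open>\<zeta>\<close> from the start, and this survives the
  limit.\<close>

lemma geodesic_representative:
  fixes p :: "'a::metric_space"
  assumes space: "proper_geodesic_space TYPE('a)" and qg: "quasi_geodesic_ray p q Q \<zeta>"
    and Z: "robustly_morse p \<kappa> (ray_image \<zeta>)"
  obtains \<eta> where "geodesic_ray p \<eta>" "sublinearly_close \<kappa> \<eta> \<zeta>"
proof -
  have geo: "\<And>x y::'a. \<exists>g. geodesic_segment g x y" and proper: "\<And>(x::'a) r. compact (cball x r)"
    using space by (auto simp: proper_geodesic_space_def)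
  define A where "A = 4 * q + q * Q + Q + 1"
  have "\<forall>n::nat. \<exists>f d. real n \<le> d \<and> scale_ray p \<kappa> A f \<and> f 0 = p \<and>
    (\<forall>s t. 0 \<le> s \<longrightarrow> s \<le> d \<longrightarrow> 0 \<le> t \<longrightarrow> t \<le> d \<longrightarrow> dist (f s) (f t) = \<bar>s - t\<bar>) \<and>
    (\<forall>t>d. f t \<in> ray_image \<zeta>)"
    unfolding A_def
  proof
    fix n :: nat
    show "\<exists>f d. real n \<le> d \<and> scale_ray p \<kappa> (4 * q + q * Q + Q + 1) f \<and> f 0 = p \<and>
    (\<forall>s t. 0 \<le> s \<longrightarrow> s \<le> d \<longrightarrow> 0 \<le> t \<longrightarrow> t \<le> d \<longrightarrow> dist (f s) (f t) = \<bar>s - t\<bar>) \<and>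
    (\<forall>t>d. f t \<in> ray_image \<zeta>)"
      by (rule geodesic_then_tail[OF geo qg, of "real n"]) blast
  qed
  then obtain f d where f: "\<And>n. real n \<le> d n" "\<And>n. scale_ray p \<kappa> A (f n)" "\<And>n. f n 0 = p"
    "\<And>n s t. 0 \<le> s \<Longrightarrow> s \<le> d n \<Longrightarrow> 0 \<le> t \<Longrightarrow> t \<le> d n \<Longrightarrow> dist (f n s) (f n t) = \<bar>s - t\<bar>"
    "\<And>n t. d n < t \<Longrightarrow> f n t \<in> ray_image \<zeta>" by metis
  obtain \<epsilon> \<delta> T M where P: "0 < \<epsilon>" "0 < \<delta>" "1 \<le> T" "1 \<le> M"
    "\<And>f t s. scale_ray p \<kappa> A f \<Longrightarrow> T \<le> t \<Longrightarrow> infdist (f t) (ray_image \<zeta>) \<le> \<epsilon> * t \<Longrightarrow> 0 \<le> s \<Longrightarrow> s \<le> \<delta> * t \<Longrightarrow>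
       infdist (f s) (ray_image \<zeta>) \<le> M * \<kappa> s" by (rule robustly_morseE[OF Z scale_rayD(1)[OF f(2)]]) blast
  have near: "infdist (f n s) (ray_image \<zeta>) \<le> M * \<kappa> s" if s: "0 \<le> s" for n s
  proof -
    define t where "t = max (d n + 1) (max T (s / \<delta>))"
    have t: "d n < t" "T \<le> t" and "s / \<delta> \<le> t" unfolding t_def by simp_all
    then have st: "s \<le> \<delta> * t" using P(2) by (simp add: pos_divide_le_eq mult.commute)
    have "infdist (f n t) (ray_image \<zeta>) = 0" by (rule infdist_zero[OF f(5)[OF t(1)]])
    then have "infdist (f n t) (ray_image \<zeta>) \<le> \<epsilon> * t" using P(1,3) t(2) by simp
    then show ?thesis using P(5)[OF f(2) t(2) _ s st] by blast
  qed
  obtain \<eta> where "geodesic_ray p \<eta>" "\<And>s. 0 \<le> s \<Longrightarrow> infdist (\<eta> s) (ray_image \<zeta>) \<le> M * \<kappa> s"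
  proof (rule limit_geodesic_ray[of f p "ray_image \<zeta>" "\<lambda>s. M * \<kappa> s"])
    show "dist (f n s) (f n t) = \<bar>s - t\<bar>" if "0 \<le> s" "s \<le> real n" "0 \<le> t" "t \<le> real n" for n s t
      using f(4)[of s n t] f(1)[of n] that by simp
  qed (use proper f(3) near in auto)
  then show ?thesis using that unfolding sublinearly_close_def by blast
qed

end

section \<open>Boundary classes in terms of sublinear closeness\<close>

locale morse_space = sublinear_scale \<kappa> for \<kappa> +
  fixes p :: "'a::metric_space"
  assumes space: "proper_geodesic_space TYPE('a)"
begin

lemma geodesics_exist: "\<exists>g. geodesic_segment g (x::'a) y"
  using space by (simp add: proper_geodesic_space_def)

lemma morse_raysE:
  assumes "\<zeta> \<in> morse_rays p \<kappa>"
  obtains A q Q where "scale_ray p \<kappa> A \<zeta>" "quasi_geodesic_ray p q Q \<zeta>" "robustly_morse p \<kappa> (ray_image \<zeta>)"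
proof -
  obtain q Q where "quasi_geodesic_ray p q Q \<zeta>" "morse_set p \<kappa> (ray_image \<zeta>)" using assms by (auto simp: morse_rays_def)
  then show ?thesis using that quasi_geodesic_scale_ray morse_imp_robustly_morse[OF geodesics_exist] by blast
qed

lemma morse_raysI:
  "quasi_geodesic_ray p q Q \<zeta> \<Longrightarrow> robustly_morse p \<kappa> (ray_image \<zeta>) \<Longrightarrow> \<zeta> \<in> morse_rays p \<kappa>"
  using robustly_morse_imp_morse by (auto simp: morse_rays_def)

lemma morse_rays_close:
  assumes \<zeta>: "\<zeta> \<in> morse_rays p \<kappa>" and qg: "quasi_geodesic_ray p q Q \<gamma>" and close: "sublinearly_close \<kappa> \<gamma> \<zeta>"
  shows "\<gamma> \<in> morse_rays p \<kappa>"
proof -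
  obtain A q' Q' where z: "scale_ray p \<kappa> A \<zeta>" "robustly_morse p \<kappa> (ray_image \<zeta>)" using morse_raysE[OF \<zeta>] by metis
  have g: "scale_ray p \<kappa> (q * (Q + 1)) \<gamma>" by (rule quasi_geodesic_scale_ray[OF qg]) simp
  show ?thesis
    by (rule morse_raysI[OF qg robustly_morse_sublinearly_close[OF z(1) g sublinearly_close_sym[OF g z(1) close] z(2)]])
qed

lemma ray_rel_iff:
  "(\<alpha>, \<beta>) \<in> ray_rel p \<kappa> \<longleftrightarrow> \<alpha> \<in> morse_rays p \<kappa> \<and> \<beta> \<in> morse_rays p \<kappa> \<and> sublinearly_close \<kappa> \<alpha> \<beta>"
proof -
  have "ray_equiv \<alpha> \<beta> \<longleftrightarrow> sublinearly_close \<kappa> \<alpha> \<beta>" if a: "\<alpha> \<in> morse_rays p \<kappa>" and b: "\<beta> \<in> morse_rays p \<kappa>"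
  proof -
    obtain A q Q where "scale_ray p \<kappa> A \<alpha>" "robustly_morse p \<kappa> (ray_image \<alpha>)" by (rule morse_raysE[OF a])
    moreover obtain A' q' Q' where "scale_ray p \<kappa> A' \<beta>" "robustly_morse p \<kappa> (ray_image \<beta>)" by (rule morse_raysE[OF b])
    ultimately show ?thesis using ray_equiv_iff_sublinearly_close by blast
  qed
  then show ?thesis by (auto simp: ray_rel_def)
qed

text \<open>Transitivity is not visible in \<open>ray_equiv\<close>, a disjunction of limits; it
  comes from the description by sublinear closeness.\<close>

lemma equiv_ray_rel: "equiv (morse_rays p \<kappa>) (ray_rel p \<kappa>)"
proof (rule equivI)
  show "ray_rel p \<kappa> \<subseteq> morse_rays p \<kappa> \<times> morse_rays p \<kappa>" by (auto simp: ray_rel_def)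
  show "refl_on (morse_rays p \<kappa>) (ray_rel p \<kappa>)"
    by (auto simp: refl_on_def ray_rel_iff sublinearly_close_refl)
  show "sym (ray_rel p \<kappa>)"
    by (rule symI) (auto simp: ray_rel_iff elim!: morse_raysE intro: sublinearly_close_sym)
  show "trans (ray_rel p \<kappa>)"
    by (rule transI) (auto simp: ray_rel_iff elim!: morse_raysE intro: sublinearly_close_trans)
qed

lemma ray_class_in_boundary: "\<zeta> \<in> morse_rays p \<kappa> \<Longrightarrow> ray_class p \<kappa> \<zeta> \<in> morse_boundary p \<kappa>"
  unfolding ray_class_def morse_boundary_def by (rule quotientI)

lemma in_ray_class: "\<zeta> \<in> morse_rays p \<kappa> \<Longrightarrow> \<zeta> \<in> ray_class p \<kappa> \<zeta>"
  unfolding ray_class_def by (rule equiv_class_self[OF equiv_ray_rel])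

lemma boundary_memberD:
  assumes "B \<in> morse_boundary p \<kappa>" "\<beta> \<in> B"
  shows "\<beta> \<in> morse_rays p \<kappa>" "B = ray_class p \<kappa> \<beta>"
proof -
  obtain \<zeta> where z: "\<zeta> \<in> morse_rays p \<kappa>" "B = ray_rel p \<kappa> `` {\<zeta>}" using assms by (auto simp: morse_boundary_def elim: quotientE)
  then have "(\<zeta>, \<beta>) \<in> ray_rel p \<kappa>" using assms by auto
  then show "\<beta> \<in> morse_rays p \<kappa>" "B = ray_class p \<kappa> \<beta>"
    using z equiv_class_eq[OF equiv_ray_rel] by (auto simp: ray_class_def ray_rel_def)
qed

lemma boundary_member_exists:
  assumes "B \<in> morse_boundary p \<kappa>"
  obtains \<beta> where "\<beta> \<in> B"
  using assms in_quotient_imp_non_empty[OF equiv_ray_rel] by (auto simp: morse_boundary_def)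

lemma boundary_member_iff:
  assumes "B \<in> morse_boundary p \<kappa>" "\<beta> \<in> B"
  shows "\<gamma> \<in> B \<longleftrightarrow> \<gamma> \<in> morse_rays p \<kappa> \<and> sublinearly_close \<kappa> \<gamma> \<beta>"
proof -
  have "\<gamma> \<in> B \<longleftrightarrow> (\<beta>, \<gamma>) \<in> ray_rel p \<kappa>" using boundary_memberD(2)[OF assms] by (auto simp: ray_class_def)
  also have "\<dots> \<longleftrightarrow> (\<gamma>, \<beta>) \<in> ray_rel p \<kappa>" using equiv_ray_rel by (meson equivE symE)
  finally show ?thesis using boundary_memberD(1)[OF assms] by (simp add: ray_rel_iff)
qed

lemma boundary_geodesic:
  assumes "B \<in> morse_boundary p \<kappa>"
  obtains \<eta> where "\<eta> \<in> B" "geodesic_ray p \<eta>"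
proof -
  obtain \<beta> where b: "\<beta> \<in> B" by (rule boundary_member_exists[OF assms])
  note bm = boundary_memberD(1)[OF assms b]
  obtain A q Q where z: "quasi_geodesic_ray p q Q \<beta>" "robustly_morse p \<kappa> (ray_image \<beta>)" by (rule morse_raysE[OF bm])
  obtain \<eta> where e: "geodesic_ray p \<eta>" "sublinearly_close \<kappa> \<eta> \<beta>" by (rule geodesic_representative[OF space z])
  have "\<eta> \<in> morse_rays p \<kappa>" by (rule morse_rays_close[OF bm geodesic_ray_quasi_geodesic[OF e(1)] e(2)])
  then have "\<eta> \<in> B" using e(2) boundary_member_iff[OF assms b] by blast
  then show ?thesis using that e(1) by blast
qed

end

section \<open>The topology of the boundary\<close>

text \<open>The tests are all coarse rays near the class and not only its members, a family that
  maps with sublinear error preserve up to the constant. One time \<open>t \<ge> R\<close> is enough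
  to ask for, since the Morse property of \<open>\<beta>\<close> propagates closeness at a late
  \<open>t\<close> to all times up to \<open>\<delta> * t\<close>.\<close>

definition tracking_nbhd ::
  "'a::metric_space \<Rightarrow> (real \<Rightarrow> real) \<Rightarrow> (real \<Rightarrow> 'a) \<Rightarrow> real \<Rightarrow> real \<Rightarrow> real \<Rightarrow> (real \<Rightarrow> 'a) set set" where
  "tracking_nbhd p \<kappa> \<beta> A R \<epsilon> =
     {B \<in> morse_boundary p \<kappa>. \<forall>f \<alpha>. scale_ray p \<kappa> A f \<longrightarrow> \<alpha> \<in> B \<longrightarrow> sublinearly_close \<kappa> f \<alpha> \<longrightarrow>
        (\<exists>t\<ge>R. infdist (f t) (ray_image \<beta>) \<le> \<epsilon> * t)}"

lemma tracking_nbhdD: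
  assumes "B \<in> tracking_nbhd p \<kappa> \<beta> A R \<epsilon>"
  shows "B \<in> morse_boundary p \<kappa>"
    "scale_ray p \<kappa> A f \<Longrightarrow> \<alpha> \<in> B \<Longrightarrow> sublinearly_close \<kappa> f \<alpha> \<Longrightarrow> \<exists>t\<ge>R. infdist (f t) (ray_image \<beta>) \<le> \<epsilon> * t"
  using assms by (auto simp: tracking_nbhd_def)

context morse_space
begin

text \<open>Properness of the gauge leaves a bounded set of quasi-geodesic constants at radius
  \<open>r\<close>, so one \<open>A\<close> covers all rays to be tested. Tracking gives closeness
  at the time of norm \<open>R1\<close>, which is the premise under which the Morse property of
  \<open>\<beta>\<close> yields the exact constant \<open>m (q, Q)\<close>.\<close>

lemma tracking_subset_boundary_nbhd:
  assumes \<beta>: "\<beta> \<in> morse_rays p \<kappa>" and m: "morse_gauge p \<kappa> m (ray_image \<beta>)" and r: "0 < r"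
  obtains A R \<epsilon> where "1 \<le> A" "1 \<le> R" "0 < \<epsilon>" "tracking_nbhd p \<kappa> \<beta> A R \<epsilon> \<subseteq> boundary_nbhd p \<kappa> m \<beta> r"
proof -
  \<comment> \<open>Positivity of the gauge on the relevant range turns \<open>small_wrt\<close>
    into membership in this preimage of a compact interval.\<close>
  have "compact (m -` {0..r / (2 * \<kappa> r)})" using m by (simp add: morse_gauge_def proper_function_def)
  then have "bounded (m -` {0..r / (2 * \<kappa> r)})" by (rule compact_imp_bounded)
  then obtain b0 where "\<forall>z\<in>m -` {0..r / (2 * \<kappa> r)}. norm z \<le> b0" unfolding bounded_iff by blast
  then have b0: "norm z \<le> b0" if "m z \<in> {0..r / (2 * \<kappa> r)}" for z using that by blast
  define b where "b = max 1 b0"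
  have b1: "1 \<le> b" by (simp add: b_def)
  have bound: "q \<le> b \<and> Q \<le> b" if "1 \<le> q" "0 \<le> Q" "small_wrt \<kappa> (m (q, Q)) r" for q Q
  proof -
    have "0 < m (q, Q)" using m that by (simp add: morse_gauge_def)
    then have "norm (q, Q) \<le> b0" using b0[of "(q, Q)"] that by (simp add: small_wrt_def)
    then show ?thesis using norm_fst_le[of q Q] norm_snd_le[of Q q] by (auto simp: b_def)
  qed
  define A where "A = b * (b + 1)"
  have A: "1 \<le> A" using b1 mult_mono[of 1 b 1 "b + 1"] by (simp add: A_def)
  have rob: "robustly_morse p \<kappa> (ray_image \<beta>)" by (rule morse_raysE[OF \<beta>])
  obtain \<epsilon> \<delta> T M where P: "0 < \<epsilon>" "0 < \<delta>" "1 \<le> T" "1 \<le> M"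
    "\<And>f t s. scale_ray p \<kappa> A f \<Longrightarrow> T \<le> t \<Longrightarrow> infdist (f t) (ray_image \<beta>) \<le> \<epsilon> * t \<Longrightarrow> 0 \<le> s \<Longrightarrow> s \<le> \<delta> * t \<Longrightarrow>
       infdist (f s) (ray_image \<beta>) \<le> M * \<kappa> s" by (rule robustly_morseE[OF rob A]) blast
  obtain C0 where C0: "1 \<le> C0" "\<And>f s. scale_ray p \<kappa> A f \<Longrightarrow> 0 \<le> s \<Longrightarrow> \<kappa> s \<le> C0 * \<kappa> (dist (f s) p)"
    using scale_ray_norm[OF A] by metis
  have n: "0 < M * C0" using P C0 by simp
  obtain R1 where R1: "0 < R1" "\<And>q Q \<beta>'. quasi_geodesic_ray p q Q \<beta>' \<Longrightarrow> small_wrt \<kappa> (m (q, Q)) r \<Longrightarrow>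
       infdist (ray_point p \<beta>' R1) (ray_image \<beta>) \<le> (M * C0) * \<kappa> R1 \<Longrightarrow> ray_upto p \<beta>' r \<subseteq> nbhd p \<kappa> (ray_image \<beta>) (m (q, Q))"
    by (rule morse_gaugeE[OF m strict r n]) blast
  \<comment> \<open>Late enough for the window \<open>\<delta> * t\<close> to contain the time at
    which any tested ray reaches norm \<open>R1\<close>.\<close>
  define R where "R = max T (b * (R1 + b) / \<delta>)"
  have R: "T \<le> R" "1 \<le> R" "b * (R1 + b) / \<delta> \<le> R" using P(3) by (auto simp: R_def le_max_iff_disj)
  have "tracking_nbhd p \<kappa> \<beta> A R \<epsilon> \<subseteq> boundary_nbhd p \<kappa> m \<beta> r"
  proof
    fix B assume B: "B \<in> tracking_nbhd p \<kappa> \<beta> A R \<epsilon>"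
    show "B \<in> boundary_nbhd p \<kappa> m \<beta> r"
      unfolding boundary_nbhd_def
    proof (intro CollectI conjI ballI allI impI)
      show "B \<in> morse_boundary p \<kappa>" by (rule tracking_nbhdD(1)[OF B])
      fix \<alpha> q Q assume a: "\<alpha> \<in> B" and "quasi_geodesic_ray p q Q \<alpha> \<and> small_wrt \<kappa> (m (q, Q)) r"
      then have qg: "quasi_geodesic_ray p q Q \<alpha>" and sm: "small_wrt \<kappa> (m (q, Q)) r" by auto
      have q: "1 \<le> q" "0 \<le> Q" using qg by (auto simp: quasi_geodesic_ray_def)
      have qb: "q \<le> b" "Q \<le> b" using bound[OF q sm] by auto
      have "q * (Q + 1) \<le> A" unfolding A_def using q qb by (intro mult_mono) auto
      then have sa: "scale_ray p \<kappa> A \<alpha>" by (rule quasi_geodesic_scale_ray[OF qg])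
      obtain t where t: "R \<le> t" "infdist (\<alpha> t) (ray_image \<beta>) \<le> \<epsilon> * t"
        using tracking_nbhdD(2)[OF B sa a sublinearly_close_refl] by blast
      define s where "s = hit_time p \<alpha> R1"
      have s: "0 \<le> s" "dist (\<alpha> s) p = R1" "s \<le> q * (R1 + Q)" using hit_time[OF qg, of R1] R1(1) by (auto simp: s_def)
      have qR: "q * (R1 + Q) \<le> b * (R1 + b)" using q qb R1(1) by (intro mult_mono) auto
      have "b * (R1 + b) / \<delta> \<le> t" using R(3) t(1) by linarith
      then have "b * (R1 + b) \<le> \<delta> * t" using P(2) by (simp add: pos_divide_le_eq mult.commute)
      then have "infdist (\<alpha> s) (ray_image \<beta>) \<le> M * \<kappa> s" using P(5)[OF sa _ t(2) s(1)] R t(1) s(3) qR by simp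
      also have "\<dots> \<le> M * (C0 * \<kappa> R1)" using C0(2)[OF sa s(1)] s(2) P(4) by (intro mult_left_mono) auto
      finally have "infdist (ray_point p \<alpha> R1) (ray_image \<beta>) \<le> (M * C0) * \<kappa> R1" by (simp add: ray_point_def s_def)
      then show "ray_upto p \<alpha> r \<subseteq> nbhd p \<kappa> (ray_image \<beta>) (m (q, Q))" by (rule R1(2)[OF qg sm])
    qed
  qed
  then show ?thesis using that A R P(1) by blast
qed

text \<open>Straightening moves a test ray to a member of the class with fixed constants
  \<open>(W, 1)\<close>, to which the condition of \<open>boundary_nbhd\<close> applies as soon as
  \<open>r\<close> is large; the moment at which it reaches norm \<open>r\<close> is the time
  sought.\<close>

lemma boundary_nbhd_subset_tracking:
  assumes m: "morse_gauge p \<kappa> m (ray_image \<beta>)" and A: "1 \<le> A" and \<epsilon>: "0 < \<epsilon>"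
  obtains r where "0 < r" "boundary_nbhd p \<kappa> m \<beta> r \<subseteq> tracking_nbhd p \<kappa> \<beta> A R \<epsilon>"
proof -
  obtain W C where S: "1 \<le> W" "1 \<le> C"
    "\<And>f. scale_ray p \<kappa> A f \<Longrightarrow> \<exists>\<gamma>. tight_ray W p \<gamma> \<and> (\<forall>s\<ge>0. dist (\<gamma> s) (f s) \<le> C * \<kappa> s)"
    using straighten_ray[OF geodesics_exist A, of p] by metis
  have W2: "1 \<le> 2 * W" using S by simp
  obtain C0 where C0: "1 \<le> C0" "\<And>f s. scale_ray p \<kappa> (2 * W) f \<Longrightarrow> 0 \<le> s \<Longrightarrow> \<kappa> (dist (f s) p) \<le> C0 * \<kappa> s"
    using scale_ray_norm[OF W2] by metis
  define D where "D = m (W, 1)"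
  have D: "0 < D" using m S by (simp add: morse_gauge_def D_def)
  obtain T where T: "1 \<le> T" "\<And>t. T \<le> t \<Longrightarrow> (C + D * C0) * \<kappa> t + 0 \<le> \<epsilon> * t"
    using scale_eventually_le[OF \<epsilon>, of "C + D * C0" 0] by metis
  have "eventually (\<lambda>r. D \<le> r / (2 * \<kappa> r)) at_top"
    using strictly_sublinear_ratio_at_top[OF strict] by (simp add: filterlim_at_top)
  then obtain r0 where r0: "\<And>r. r0 \<le> r \<Longrightarrow> D \<le> r / (2 * \<kappa> r)" by (auto simp: eventually_at_top_linorder)
  define r where "r = max r0 (W * max R T + 1)"
  have r_ge: "r0 \<le> r" "W * max R T + 1 \<le> r" unfolding r_def by simp_all
  have "0 \<le> W * max R T" using S T by (simp add: le_max_iff_disj)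
  then have r: "0 < r" using r_ge by linarith
  have sm: "small_wrt \<kappa> (m (W, 1)) r" using r0[OF r_ge(1)] by (simp add: small_wrt_def D_def)
  have "boundary_nbhd p \<kappa> m \<beta> r \<subseteq> tracking_nbhd p \<kappa> \<beta> A R \<epsilon>"
  proof
    fix B assume "B \<in> boundary_nbhd p \<kappa> m \<beta> r"
    then have B: "B \<in> morse_boundary p \<kappa>"
      and near: "\<And>\<alpha> q Q. \<alpha> \<in> B \<Longrightarrow> quasi_geodesic_ray p q Q \<alpha> \<Longrightarrow> small_wrt \<kappa> (m (q, Q)) r \<Longrightarrow>
        ray_upto p \<alpha> r \<subseteq> nbhd p \<kappa> (ray_image \<beta>) (m (q, Q))" by (auto simp: boundary_nbhd_def)
    have "\<exists>t\<ge>R. infdist (f t) (ray_image \<beta>) \<le> \<epsilon> * t"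
      if f: "scale_ray p \<kappa> A f" and a: "\<alpha> \<in> B" and fa: "sublinearly_close \<kappa> f \<alpha>" for f \<alpha>
    proof -
      obtain \<gamma> where g: "tight_ray W p \<gamma>" "\<And>s. 0 \<le> s \<Longrightarrow> dist (\<gamma> s) (f s) \<le> C * \<kappa> s" using S(3)[OF f] by blast
      have qg: "quasi_geodesic_ray p W 1 \<gamma>" and sg: "scale_ray p \<kappa> (2 * W) \<gamma>"
        using tight_ray_quasi_geodesic[OF g(1)] tight_ray_scale_ray[OF g(1)] by auto
      have "sublinearly_close \<kappa> \<gamma> f" using g(2) by (intro sublinearly_closeI[where M = C]) auto
      then have ga: "sublinearly_close \<kappa> \<gamma> \<alpha>" by (rule sublinearly_close_trans[OF sg f _ fa])
      have "\<gamma> \<in> B" using boundary_member_iff[OF B a] ga morse_rays_close[OF boundary_memberD(1)[OF B a] qg ga] by blast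
      from near[OF this qg sm] have up: "ray_upto p \<gamma> r \<subseteq> nbhd p \<kappa> (ray_image \<beta>) D" by (simp add: D_def)
      define t where "t = hit_time p \<gamma> r"
      have t: "0 \<le> t" "r \<le> W * t + 1" using hit_time[OF qg, of r] r by (auto simp: t_def)
      have "W * max R T \<le> W * t" using t r_ge by linarith
      then have tRT: "R \<le> t" "T \<le> t" using S(1) by auto
      have "\<gamma> t \<in> nbhd p \<kappa> (ray_image \<beta>) D" using up t by (auto simp: ray_upto_def t_def)
      then have "infdist (\<gamma> t) (ray_image \<beta>) \<le> D * \<kappa> (dist (\<gamma> t) p)" by (simp add: nbhd_def)
      also have "\<dots> \<le> D * (C0 * \<kappa> t)" using C0(2)[OF sg t(1)] D by (intro mult_left_mono) auto
      finally have "infdist (f t) (ray_image \<beta>) \<le> (C + D * C0) * \<kappa> t"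
        using g(2)[OF t(1)] infdist_triangle[of "f t" "ray_image \<beta>" "\<gamma> t"] by (simp add: dist_commute algebra_simps)
      then show ?thesis using T(2)[OF tRT(2)] tRT(1) by (intro exI[of _ t]) auto
    qed
    then show "B \<in> tracking_nbhd p \<kappa> \<beta> A R \<epsilon>" using B by (auto simp: tracking_nbhd_def)
  qed
  then show ?thesis using that r by blast
qed

lemma tracking_nbhd_change_ray:
  assumes b: "scale_ray p \<kappa> A1 \<beta>" and close: "sublinearly_close \<kappa> \<beta> \<beta>'" and A: "1 \<le> A" and \<epsilon>: "0 < \<epsilon>"
  obtains R' \<epsilon>' where "1 \<le> R'" "0 < \<epsilon>'" "tracking_nbhd p \<kappa> \<beta> A R' \<epsilon>' \<subseteq> tracking_nbhd p \<kappa> \<beta>' A R \<epsilon>"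
proof -
  have "scale_map p p \<kappa> 1 id" using scale_equivalence_id[of p] by (simp add: scale_equivalence_def)
  from scale_map_infdist[OF this b _ A, of \<beta>'] close obtain C where C: "1 \<le> C"
    "\<And>f t. scale_ray p \<kappa> A f \<Longrightarrow> 0 \<le> t \<Longrightarrow> infdist (f t) (ray_image \<beta>') \<le> C * infdist (f t) (ray_image \<beta>) + C * \<kappa> t"
    by auto
  obtain T where T: "1 \<le> T" "\<And>t. T \<le> t \<Longrightarrow> C * \<kappa> t + 0 \<le> (\<epsilon> / 2) * t"
    using scale_eventually_le[of "\<epsilon> / 2" C 0] \<epsilon> by auto
  have "tracking_nbhd p \<kappa> \<beta> A (max R T) (\<epsilon> / (2 * C)) \<subseteq> tracking_nbhd p \<kappa> \<beta>' A R \<epsilon>"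
  proof
    fix B assume B: "B \<in> tracking_nbhd p \<kappa> \<beta> A (max R T) (\<epsilon> / (2 * C))"
    have "\<exists>t\<ge>R. infdist (f t) (ray_image \<beta>') \<le> \<epsilon> * t"
      if f: "scale_ray p \<kappa> A f" "\<alpha> \<in> B" "sublinearly_close \<kappa> f \<alpha>" for f \<alpha>
    proof -
      obtain t where t: "max R T \<le> t" "infdist (f t) (ray_image \<beta>) \<le> \<epsilon> / (2 * C) * t" using tracking_nbhdD(2)[OF B f] by blast
      have "C * infdist (f t) (ray_image \<beta>) \<le> C * (\<epsilon> / (2 * C) * t)" using t C(1) by (intro mult_left_mono) auto
      also have "\<dots> = \<epsilon> / 2 * t" using C(1) by simp
      finally have "infdist (f t) (ray_image \<beta>') \<le> \<epsilon> * t" using C(2)[OF f(1), of t] T(1) T(2)[of t] t(1) by simp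
      then show ?thesis using t by (intro exI[of _ t]) auto
    qed
    then show "B \<in> tracking_nbhd p \<kappa> \<beta>' A R \<epsilon>" using tracking_nbhdD(1)[OF B] by (auto simp: tracking_nbhd_def)
  qed
  moreover have "1 \<le> max R T" "0 < \<epsilon> / (2 * C)" using T(1) C(1) \<epsilon> by (auto simp: le_max_iff_disj)
  ultimately show ?thesis using that by blast
qed

text \<open>In \<open>is_boundary_nbhd\<close> the representative and its gauge vary with the
  neighbourhood. Here one fixed representative carries a whole base, which makes intersections and
  continuity manageable.\<close>

lemma is_boundary_nbhd_iff_tracking:
  assumes B: "B \<in> morse_boundary p \<kappa>" and b: "\<beta> \<in> B"
  shows "is_boundary_nbhd p \<kappa> B V \<longleftrightarrow> V \<subseteq> morse_boundary p \<kappa> \<and>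
    (\<exists>A\<ge>1. \<exists>R\<ge>1. \<exists>\<epsilon>>0. tracking_nbhd p \<kappa> \<beta> A R \<epsilon> \<subseteq> V)"
proof
  assume "is_boundary_nbhd p \<kappa> B V"
  then obtain \<beta>' m r where V: "V \<subseteq> morse_boundary p \<kappa>" and b': "\<beta>' \<in> B" and m: "morse_gauge p \<kappa> m (ray_image \<beta>')"
    and r: "0 < r" and sub: "boundary_nbhd p \<kappa> m \<beta>' r \<subseteq> V" by (auto simp: is_boundary_nbhd_def)
  obtain A R \<epsilon> where T: "1 \<le> A" "1 \<le> R" "0 < \<epsilon>" "tracking_nbhd p \<kappa> \<beta>' A R \<epsilon> \<subseteq> boundary_nbhd p \<kappa> m \<beta>' r"
    by (rule tracking_subset_boundary_nbhd[OF boundary_memberD(1)[OF B b'] m r])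
  obtain A1 q Q where "scale_ray p \<kappa> A1 \<beta>" by (rule morse_raysE[OF boundary_memberD(1)[OF B b]])
  moreover have "sublinearly_close \<kappa> \<beta> \<beta>'" using boundary_member_iff[OF B b'] b by blast
  ultimately obtain R' \<epsilon>' where "1 \<le> R'" "0 < \<epsilon>'" "tracking_nbhd p \<kappa> \<beta> A R' \<epsilon>' \<subseteq> tracking_nbhd p \<kappa> \<beta>' A R \<epsilon>"
    by (rule tracking_nbhd_change_ray[OF _ _ T(1) T(3)])
  moreover from this have "tracking_nbhd p \<kappa> \<beta> A R' \<epsilon>' \<subseteq> V" using T(4) sub by blast
  ultimately show "V \<subseteq> morse_boundary p \<kappa> \<and> (\<exists>A\<ge>1. \<exists>R\<ge>1. \<exists>\<epsilon>>0. tracking_nbhd p \<kappa> \<beta> A R \<epsilon> \<subseteq> V)"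
    using T(1) V by blast
next
  assume "V \<subseteq> morse_boundary p \<kappa> \<and> (\<exists>A\<ge>1. \<exists>R\<ge>1. \<exists>\<epsilon>>0. tracking_nbhd p \<kappa> \<beta> A R \<epsilon> \<subseteq> V)"
  then obtain A R \<epsilon> where V: "V \<subseteq> morse_boundary p \<kappa>" and T: "1 \<le> A" "0 < \<epsilon>" "tracking_nbhd p \<kappa> \<beta> A R \<epsilon> \<subseteq> V" by blast
  have "morse_set p \<kappa> (ray_image \<beta>)" using boundary_memberD(1)[OF B b] by (simp add: morse_rays_def)
  then obtain m where m: "morse_gauge p \<kappa> m (ray_image \<beta>)" by (auto simp: morse_set_def)
  obtain r where "0 < r" "boundary_nbhd p \<kappa> m \<beta> r \<subseteq> tracking_nbhd p \<kappa> \<beta> A R \<epsilon>"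
    by (rule boundary_nbhd_subset_tracking[OF m T(1,2)])
  then show "is_boundary_nbhd p \<kappa> B V" using V T(3) b m unfolding is_boundary_nbhd_def by blast
qed

lemma self_in_tracking_nbhd:
  assumes B: "B \<in> morse_boundary p \<kappa>" and b: "\<beta> \<in> B" and \<epsilon>: "0 < \<epsilon>"
  shows "B \<in> tracking_nbhd p \<kappa> \<beta> A R \<epsilon>"
proof -
  have "\<exists>t\<ge>R. infdist (f t) (ray_image \<beta>) \<le> \<epsilon> * t"
    if f: "scale_ray p \<kappa> A f" and a: "\<alpha> \<in> B" "sublinearly_close \<kappa> f \<alpha>" for f \<alpha>
  proof -
    obtain A1 q Q where "scale_ray p \<kappa> A1 \<alpha>" by (rule morse_raysE[OF boundary_memberD(1)[OF B a(1)]])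
    moreover have "sublinearly_close \<kappa> \<alpha> \<beta>" using boundary_member_iff[OF B b] a by blast
    ultimately have "sublinearly_close \<kappa> f \<beta>" using sublinearly_close_trans[OF f _ a(2)] by blast
    then obtain M where M: "\<And>s. 0 \<le> s \<Longrightarrow> infdist (f s) (ray_image \<beta>) \<le> M * \<kappa> s" unfolding sublinearly_close_def by blast
    obtain T where T: "1 \<le> T" "\<And>t. T \<le> t \<Longrightarrow> M * \<kappa> t + 0 \<le> \<epsilon> * t" using scale_eventually_le[OF \<epsilon>, of M 0] by metis
    define t where "t = max R T"
    have "R \<le> t" "T \<le> t" unfolding t_def by simp_all
    then show ?thesis using M[of t] T(1) T(2)[of t] by (intro exI[of _ t]) auto
  qed
  then show ?thesis using B by (auto simp: tracking_nbhd_def)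
qed

text \<open>This gives the axiom that a neighbourhood of a class is one of all nearby classes. A
  test ray \<open>f\<close> of a class \<open>E\<close> near \<open>B\<close> approaches a
  representative \<open>\<eta>\<close> of \<open>B\<close>; joining \<open>f\<close> to
  \<open>\<eta>\<close> produces a ray of class \<open>B\<close>, which must approach
  \<open>\<beta>\<close>, and so \<open>f\<close> is near \<open>\<beta>\<close> as long as it
  agrees with the joined ray up to \<open>O(\<kappa>)\<close>.\<close>

lemma tracking_nbhd_interior:
  assumes \<beta>: "\<beta> \<in> morse_rays p \<kappa>" and A: "1 \<le> A" and \<epsilon>: "0 < \<epsilon>"
  obtains A' R' \<epsilon>' where "1 \<le> A'" "1 \<le> R'" "0 < \<epsilon>'"
    "\<And>B. B \<in> tracking_nbhd p \<kappa> \<beta> A' R' \<epsilon>' \<Longrightarrow>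
       \<exists>\<eta>\<in>B. \<exists>R''\<ge>1. \<exists>\<epsilon>''>0. tracking_nbhd p \<kappa> \<eta> A R'' \<epsilon>'' \<subseteq> tracking_nbhd p \<kappa> \<beta> A R \<epsilon>"
proof -
  obtain \<epsilon>s \<delta>s Ts W C where J: "0 < \<epsilon>s" "0 < \<delta>s" "1 \<le> Ts" "1 \<le> W" "1 \<le> C"
    "\<And>f \<eta> t. \<lbrakk>scale_ray p \<kappa> A f; scale_ray p \<kappa> A \<eta>; Ts \<le> t; infdist (f t) (ray_image \<eta>) \<le> \<epsilon>s * t\<rbrakk> \<Longrightarrow>
       \<exists>\<gamma>. tight_ray W p \<gamma> \<and> (\<forall>s\<ge>0. s \<le> \<delta>s * t \<longrightarrow> dist (\<gamma> s) (f s) \<le> C * \<kappa> s) \<and> sublinearly_close \<kappa> \<gamma> \<eta>"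
    by (rule join_rays[OF geodesics_exist A, of p]) blast
  have W2: "1 \<le> 2 * W" using J by simp
  have rob: "robustly_morse p \<kappa> (ray_image \<beta>)" by (rule morse_raysE[OF \<beta>])
  obtain \<epsilon>' \<delta>' T' M where P: "0 < \<epsilon>'" "0 < \<delta>'" "1 \<le> T'" "1 \<le> M"
    "\<And>f t s. scale_ray p \<kappa> (2 * W) f \<Longrightarrow> T' \<le> t \<Longrightarrow> infdist (f t) (ray_image \<beta>) \<le> \<epsilon>' * t \<Longrightarrow> 0 \<le> s \<Longrightarrow> s \<le> \<delta>' * t \<Longrightarrow>
       infdist (f s) (ray_image \<beta>) \<le> M * \<kappa> s" by (rule robustly_morseE[OF rob W2]) blast
  obtain T where T: "1 \<le> T" "\<And>t. T \<le> t \<Longrightarrow> (C + M) * \<kappa> t + 0 \<le> \<epsilon> * t" using scale_eventually_le[OF \<epsilon>, of "C + M" 0] by metis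
  \<comment> \<open>The time at which closeness of \<open>f\<close> to \<open>\<beta>\<close> is
    verified, fixed in advance; \<open>R'\<close> and \<open>R''\<close> are large enough for
    \<open>s\<close> to lie in both windows, that of the Morse property and that of the
    join.\<close>
  define s where "s = max R T"
  have s: "R \<le> s" "T \<le> s" unfolding s_def by simp_all
  have s0: "0 \<le> s" using s T by simp
  define R' where "R' = max T' (s / \<delta>')"
  have R': "T' \<le> R'" "s / \<delta>' \<le> R'" unfolding R'_def by simp_all
  define R'' where "R'' = max Ts (s / \<delta>s)"
  have R'': "Ts \<le> R''" "s / \<delta>s \<le> R''" unfolding R''_def by simp_all
  show ?thesis
  proof (rule that[of "2 * W" R' \<epsilon>'])
    show "1 \<le> 2 * W" "1 \<le> R'" "0 < \<epsilon>'" using W2 P R' by auto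
    fix B assume B: "B \<in> tracking_nbhd p \<kappa> \<beta> (2 * W) R' \<epsilon>'"
    have Bb: "B \<in> morse_boundary p \<kappa>" by (rule tracking_nbhdD(1)[OF B])
    obtain \<eta> where \<eta>: "\<eta> \<in> B" "geodesic_ray p \<eta>" by (rule boundary_geodesic[OF Bb])
    \<comment> \<open>A geodesic ray is a coarse ray for every constant at least 1, so the joining
      constants chosen before \<open>B\<close> apply to it.\<close>
    have s\<eta>: "scale_ray p \<kappa> A \<eta>" using quasi_geodesic_scale_ray[OF geodesic_ray_quasi_geodesic[OF \<eta>(2)]] A by simp
    have "tracking_nbhd p \<kappa> \<eta> A R'' \<epsilon>s \<subseteq> tracking_nbhd p \<kappa> \<beta> A R \<epsilon>"
    proof
      fix E assume E: "E \<in> tracking_nbhd p \<kappa> \<eta> A R'' \<epsilon>s"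
      have "\<exists>t\<ge>R. infdist (f t) (ray_image \<beta>) \<le> \<epsilon> * t"
        if f: "scale_ray p \<kappa> A f" "\<alpha> \<in> E" "sublinearly_close \<kappa> f \<alpha>" for f \<alpha>
      proof -
        obtain t where t: "R'' \<le> t" "infdist (f t) (ray_image \<eta>) \<le> \<epsilon>s * t" using tracking_nbhdD(2)[OF E f] by blast
        obtain \<gamma> where g: "tight_ray W p \<gamma>" "\<And>s. 0 \<le> s \<Longrightarrow> s \<le> \<delta>s * t \<Longrightarrow> dist (\<gamma> s) (f s) \<le> C * \<kappa> s"
          "sublinearly_close \<kappa> \<gamma> \<eta>" using J(6)[OF f(1) s\<eta> order_trans[OF R''(1) t(1)] t(2)] by blast
        have sg: "scale_ray p \<kappa> (2 * W) \<gamma>" by (rule tight_ray_scale_ray[OF g(1)])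
        obtain t' where t': "R' \<le> t'" "infdist (\<gamma> t') (ray_image \<beta>) \<le> \<epsilon>' * t'" using tracking_nbhdD(2)[OF B sg \<eta>(1) g(3)] by blast
        have "s / \<delta>' \<le> t'" "s / \<delta>s \<le> t" using R' R'' t t' by auto
        then have st: "s \<le> \<delta>' * t'" "s \<le> \<delta>s * t" using P(2) J(2) by (auto simp: pos_divide_le_eq mult.commute)
        have "infdist (\<gamma> s) (ray_image \<beta>) \<le> M * \<kappa> s" using P(5)[OF sg _ t'(2) s0 st(1)] R'(1) t'(1) by simp
        then have "infdist (f s) (ray_image \<beta>) \<le> (C + M) * \<kappa> s"
          using g(2)[OF s0 st(2)] infdist_triangle[of "f s" "ray_image \<beta>" "\<gamma> s"] by (simp add: dist_commute algebra_simps)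
        then show ?thesis using T(2)[OF s(2)] s(1) by (intro exI[of _ s]) auto
      qed
      then show "E \<in> tracking_nbhd p \<kappa> \<beta> A R \<epsilon>" using tracking_nbhdD(1)[OF E] by (auto simp: tracking_nbhd_def)
    qed
    then show "\<exists>\<eta>\<in>B. \<exists>R''\<ge>1. \<exists>\<epsilon>''>0. tracking_nbhd p \<kappa> \<eta> A R'' \<epsilon>'' \<subseteq> tracking_nbhd p \<kappa> \<beta> A R \<epsilon>"
      using \<eta>(1) J(1) order_trans[OF J(3) R''(1)] by blast
  qed
qed

lemma tracking_nbhd_mono:
  assumes "A \<le> A'" "R \<le> R'" "1 \<le> R'" "\<epsilon>' \<le> \<epsilon>"
  shows "tracking_nbhd p \<kappa> \<beta> A' R' \<epsilon>' \<subseteq> tracking_nbhd p \<kappa> \<beta> A R \<epsilon>"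
proof
  fix B assume B: "B \<in> tracking_nbhd p \<kappa> \<beta> A' R' \<epsilon>'"
  have "\<exists>t\<ge>R. infdist (f t) (ray_image \<beta>) \<le> \<epsilon> * t"
    if f: "scale_ray p \<kappa> A f" "\<alpha> \<in> B" "sublinearly_close \<kappa> f \<alpha>" for f \<alpha>
  proof -
    obtain t where t: "R' \<le> t" "infdist (f t) (ray_image \<beta>) \<le> \<epsilon>' * t"
      using tracking_nbhdD(2)[OF B scale_ray_mono[OF f(1) assms(1)] f(2,3)] by blast
    have "\<epsilon>' * t \<le> \<epsilon> * t" using assms t by (intro mult_right_mono) auto
    then show ?thesis using t assms(2) by (intro exI[of _ t]) auto
  qed
  then show "B \<in> tracking_nbhd p \<kappa> \<beta> A R \<epsilon>" using tracking_nbhdD(1)[OF B] by (auto simp: tracking_nbhd_def)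
qed

text \<open>The four axioms of a neighbourhood system (\<open>up\<close>, \<open>inter\<close>,
  \<open>self\<close>, \<open>kernel\<close>) yield a topology whose open sets are the
  neighbourhoods of all their points. Uniqueness, which the definite description asks for, holds
  because a topology is determined by its neighbourhoods.\<close>

lemma boundary_topology_exists: "is_boundary_topology p \<kappa> (boundary_topology p \<kappa>)"
  and openin_boundary_topology:
    "openin (boundary_topology p \<kappa>) U \<longleftrightarrow> U \<subseteq> morse_boundary p \<kappa> \<and> (\<forall>B\<in>U. is_boundary_nbhd p \<kappa> B U)"
proof -
  let ?N = "is_boundary_nbhd p \<kappa>"
  let ?op = "\<lambda>U. U \<subseteq> morse_boundary p \<kappa> \<and> (\<forall>B\<in>U. ?N B U)"
  have up: "?N B V" if "?N B U" "U \<subseteq> V" "V \<subseteq> morse_boundary p \<kappa>" for B U V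
    using that unfolding is_boundary_nbhd_def by blast
  have inter: "?N B (U \<inter> V)" if B: "B \<in> morse_boundary p \<kappa>" and UV: "?N B U" "?N B V" for B U V
  proof -
    obtain \<beta> where b: "\<beta> \<in> B" by (rule boundary_member_exists[OF B])
    note iff = is_boundary_nbhd_iff_tracking[OF B b]
    obtain A R \<epsilon> where T: "1 \<le> A" "1 \<le> R" "0 < \<epsilon>" "tracking_nbhd p \<kappa> \<beta> A R \<epsilon> \<subseteq> U"
      using UV(1)[unfolded iff] by blast
    obtain A' R' \<epsilon>' where T': "1 \<le> A'" "1 \<le> R'" "0 < \<epsilon>'" "tracking_nbhd p \<kappa> \<beta> A' R' \<epsilon>' \<subseteq> V"
      using UV(2)[unfolded iff] by blast
    have "tracking_nbhd p \<kappa> \<beta> (max A A') (max R R') (min \<epsilon> \<epsilon>') \<subseteq> tracking_nbhd p \<kappa> \<beta> A R \<epsilon>"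
      "tracking_nbhd p \<kappa> \<beta> (max A A') (max R R') (min \<epsilon> \<epsilon>') \<subseteq> tracking_nbhd p \<kappa> \<beta> A' R' \<epsilon>'"
      using T(2) by (rule_tac [!] tracking_nbhd_mono) (auto simp: le_max_iff_disj)
    then have "tracking_nbhd p \<kappa> \<beta> (max A A') (max R R') (min \<epsilon> \<epsilon>') \<subseteq> U \<inter> V" using T(4) T'(4) by blast
    moreover have "1 \<le> max A A'" "1 \<le> max R R'" "0 < min \<epsilon> \<epsilon>'" using T(1-3) T'(1-3) by auto
    moreover have "U \<inter> V \<subseteq> morse_boundary p \<kappa>" using UV(1) by (auto simp: is_boundary_nbhd_def)
    ultimately show ?thesis unfolding iff by blast
  qed
  have self: "B \<in> V" if B: "B \<in> morse_boundary p \<kappa>" and V: "?N B V" for B V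
  proof -
    obtain \<beta> where b: "\<beta> \<in> B" by (rule boundary_member_exists[OF B])
    then obtain A R \<epsilon> where "0 < \<epsilon>" "tracking_nbhd p \<kappa> \<beta> A R \<epsilon> \<subseteq> V"
      using V[unfolded is_boundary_nbhd_iff_tracking[OF B b]] by blast
    then show ?thesis using self_in_tracking_nbhd[OF B b] by blast
  qed
  have kernel: "\<exists>U. ?N B U \<and> (\<forall>E\<in>U. ?N E V)" if B: "B \<in> morse_boundary p \<kappa>" and V: "?N B V" for B V
  proof -
    obtain \<beta> where b: "\<beta> \<in> B" by (rule boundary_member_exists[OF B])
    obtain A R \<epsilon> where T: "1 \<le> A" "0 < \<epsilon>" "tracking_nbhd p \<kappa> \<beta> A R \<epsilon> \<subseteq> V" and Vb: "V \<subseteq> morse_boundary p \<kappa>"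
      using V[unfolded is_boundary_nbhd_iff_tracking[OF B b]] by blast
    obtain A' R' \<epsilon>' where T': "1 \<le> A'" "1 \<le> R'" "0 < \<epsilon>'"
      "\<And>E. E \<in> tracking_nbhd p \<kappa> \<beta> A' R' \<epsilon>' \<Longrightarrow>
       \<exists>\<eta>\<in>E. \<exists>R''\<ge>1. \<exists>\<epsilon>''>0. tracking_nbhd p \<kappa> \<eta> A R'' \<epsilon>'' \<subseteq> tracking_nbhd p \<kappa> \<beta> A R \<epsilon>"
      by (rule tracking_nbhd_interior[OF boundary_memberD(1)[OF B b] T(1,2), of R]) blast
    let ?U = "tracking_nbhd p \<kappa> \<beta> A' R' \<epsilon>'"
    have Ub: "?U \<subseteq> morse_boundary p \<kappa>" by (auto simp: tracking_nbhd_def)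
    then have "?N B ?U" unfolding is_boundary_nbhd_iff_tracking[OF B b] using T'(1-3) by blast
    moreover have "?N E V" if E: "E \<in> ?U" for E
    proof -
      obtain \<eta> R'' \<epsilon>'' where e: "\<eta> \<in> E" "1 \<le> R''" "0 < \<epsilon>''" "tracking_nbhd p \<kappa> \<eta> A R'' \<epsilon>'' \<subseteq> V"
        using T'(4)[OF E] T(3) by blast
      have Eb: "E \<in> morse_boundary p \<kappa>" using E Ub by blast
      show ?thesis unfolding is_boundary_nbhd_iff_tracking[OF Eb e(1)] using e(2-4) T(1) Vb by blast
    qed
    ultimately show ?thesis by blast
  qed
  have ist: "istopology ?op"
    unfolding istopology_def
  proof (intro conjI allI impI)
    fix S T assume S: "?op S" and T: "?op T"
    show "S \<inter> T \<subseteq> morse_boundary p \<kappa>" using S by blast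
    show "\<forall>B\<in>S \<inter> T. ?N B (S \<inter> T)" using S T inter by blast
  next
    fix \<K> assume K: "\<forall>K\<in>\<K>. ?op K"
    show "\<Union> \<K> \<subseteq> morse_boundary p \<kappa>" using K by blast
    show "\<forall>B\<in>\<Union> \<K>. ?N B (\<Union> \<K>)"
    proof
      fix B assume "B \<in> \<Union> \<K>"
      then obtain U where "U \<in> \<K>" "B \<in> U" by blast
      then have "?N B U" "U \<subseteq> \<Union> \<K>" "\<Union> \<K> \<subseteq> morse_boundary p \<kappa>" using K by blast+
      then show "?N B (\<Union> \<K>)" by (rule up)
    qed
  qed
  define T where "T = topology ?op"
  have op: "openin T U \<longleftrightarrow> ?op U" for U unfolding T_def using topology_inverse'[OF ist] by simp
  have whole: "?N B (morse_boundary p \<kappa>)" if B: "B \<in> morse_boundary p \<kappa>" for B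
  proof -
    obtain \<beta> where b: "\<beta> \<in> B" by (rule boundary_member_exists[OF B])
    have "tracking_nbhd p \<kappa> \<beta> 1 1 1 \<subseteq> morse_boundary p \<kappa>" by (auto simp: tracking_nbhd_def)
    moreover have "(1::real) \<le> 1" "(0::real) < 1" by simp_all
    ultimately show ?thesis unfolding is_boundary_nbhd_iff_tracking[OF B b] by blast
  qed
  have topspace: "topspace T = morse_boundary p \<kappa>"
  proof
    show "topspace T \<subseteq> morse_boundary p \<kappa>" using op[of "topspace T"] by simp
    have "openin T (morse_boundary p \<kappa>)" unfolding op using whole by blast
    then show "morse_boundary p \<kappa> \<subseteq> topspace T" by (rule openin_subset)
  qed
  have T: "is_boundary_topology p \<kappa> T"
    unfolding is_boundary_topology_def
  proof (intro conjI ballI allI impI)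
    show "topspace T = morse_boundary p \<kappa>" by (rule topspace)
    fix B V assume B: "B \<in> morse_boundary p \<kappa>" and V: "V \<subseteq> morse_boundary p \<kappa>"
    show "(\<exists>W. openin T W \<and> B \<in> W \<and> W \<subseteq> V) \<longleftrightarrow> ?N B V"
    proof
      assume "\<exists>W. openin T W \<and> B \<in> W \<and> W \<subseteq> V"
      then obtain W where W: "openin T W" "B \<in> W" "W \<subseteq> V" by blast
      then have "?N B W" unfolding op by blast
      then show "?N B V" by (rule up[OF _ W(3) V])
    next
      assume N: "?N B V"
      \<comment> \<open>The candidate for the interior of \<open>V\<close>; by \<open>kernel\<close>
        it is a neighbourhood of each of its points.\<close>
      let ?W = "{E \<in> morse_boundary p \<kappa>. ?N E V}"
      have "?N E ?W" if E: "E \<in> ?W" for E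
      proof -
        have Eb: "E \<in> morse_boundary p \<kappa>" and EV: "?N E V" using E by auto
        obtain U where U: "?N E U" "\<And>D. D \<in> U \<Longrightarrow> ?N D V" using kernel[OF Eb EV] by blast
        have "U \<subseteq> morse_boundary p \<kappa>" using U(1) by (simp add: is_boundary_nbhd_def)
        then have "U \<subseteq> ?W" using U(2) by blast
        then show ?thesis by (rule up[OF U(1)]) blast
      qed
      then have "openin T ?W" unfolding op by blast
      moreover have "?W \<subseteq> V" using self by blast
      ultimately show "\<exists>W. openin T W \<and> B \<in> W \<and> W \<subseteq> V" using B N by blast
    qed
  qed
  have "T' = T" if T': "is_boundary_topology p \<kappa> T'" for T'
  proof -
    have "openin T' U \<longleftrightarrow> openin T U" for U
    proof -
      have "openin T' U \<longleftrightarrow> U \<subseteq> topspace T' \<and> (\<forall>B\<in>U. \<exists>W. openin T' W \<and> B \<in> W \<and> W \<subseteq> U)"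
        using openin_subset openin_subopen[of T' U] by blast
      also have "\<dots> \<longleftrightarrow> U \<subseteq> topspace T \<and> (\<forall>B\<in>U. \<exists>W. openin T W \<and> B \<in> W \<and> W \<subseteq> U)"
        using T T' unfolding is_boundary_topology_def by (intro conj_cong refl ball_cong) (auto simp: subset_iff)
      also have "\<dots> \<longleftrightarrow> openin T U" using openin_subset openin_subopen[of T U] by blast
      finally show ?thesis .
    qed
    then show ?thesis by (simp add: topology_eq)
  qed
  then have eq: "boundary_topology p \<kappa> = T" unfolding boundary_topology_def using T by (rule the_equality[rotated])
  show "is_boundary_topology p \<kappa> (boundary_topology p \<kappa>)" using T eq by simp
  show "openin (boundary_topology p \<kappa>) U \<longleftrightarrow> U \<subseteq> morse_boundary p \<kappa> \<and> (\<forall>B\<in>U. is_boundary_nbhd p \<kappa> B U)"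
    using op eq by simp
qed

lemma topspace_boundary_topology: "topspace (boundary_topology p \<kappa>) = morse_boundary p \<kappa>"
  using boundary_topology_exists by (simp add: is_boundary_topology_def)

end

section \<open>The induced homeomorphism\<close>

text \<open>A relation between classes, because \<open>\<Phi> \<circ> \<zeta>\<close> is in general
  not a quasi-geodesic ray and so has no class of its own.\<close>

definition corresponding_classes ::
  "(real \<Rightarrow> real) \<Rightarrow> ('a::metric_space \<Rightarrow> 'b::metric_space) \<Rightarrow> (real \<Rightarrow> 'a) set \<Rightarrow> (real \<Rightarrow> 'b) set \<Rightarrow> bool" where
  "corresponding_classes \<kappa> \<Phi> B E \<longleftrightarrow> (\<exists>\<zeta>\<in>B. \<exists>\<eta>\<in>E. sublinearly_close \<kappa> (\<Phi> \<circ> \<zeta>) \<eta>)"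

locale morse_space_equivalence = X: morse_space \<kappa> p + Y: morse_space \<kappa> q
  for \<kappa> and p :: "'a::metric_space" and q :: "'b::metric_space" +
  fixes K \<Phi> \<Psi>
  assumes equivalence: "scale_equivalence p q \<kappa> K \<Phi> \<Psi>"
begin

lemma inverse_equivalence: "morse_space_equivalence \<kappa> q p K \<Psi> \<Phi>"
  using scale_equivalence_sym[OF equivalence] by unfold_locales

lemma forward_map: "scale_map p q \<kappa> K \<Phi>"
  using equivalence by (simp add: scale_equivalence_def)

lemma forward_ray:
  assumes "scale_ray p \<kappa> A f"
  obtains A' where "scale_ray q \<kappa> A' (\<Phi> \<circ> f)"
  using X.scale_map_ray[OF forward_map scale_rayD(1)[OF assms]] assms by metis

lemma forward_close:
  assumes f: "scale_ray p \<kappa> A f" and g: "scale_ray p \<kappa> A' g" and fg: "sublinearly_close \<kappa> f g"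
    and close: "sublinearly_close \<kappa> (\<Phi> \<circ> g) h"
  shows "sublinearly_close \<kappa> (\<Phi> \<circ> f) h"
proof -
  obtain C where C: "1 \<le> C"
    "\<And>f t. scale_ray p \<kappa> A f \<Longrightarrow> 0 \<le> t \<Longrightarrow> infdist (\<Phi> (f t)) (ray_image h) \<le> C * infdist (f t) (ray_image g) + C * \<kappa> t"
    using X.scale_map_infdist[OF forward_map g close scale_rayD(1)[OF f]] by metis
  obtain M where M: "\<And>s. 0 \<le> s \<Longrightarrow> infdist (f s) (ray_image g) \<le> M * \<kappa> s"
    using fg unfolding sublinearly_close_def by blast
  have "infdist ((\<Phi> \<circ> f) s) (ray_image h) \<le> (C * M + C) * \<kappa> s" if s: "0 \<le> s" for s
  proof -
    have "C * infdist (f s) (ray_image g) \<le> C * (M * \<kappa> s)" using M[OF s] C(1) by (intro mult_left_mono) auto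
    then have "infdist (\<Phi> (f s)) (ray_image h) \<le> C * (M * \<kappa> s) + C * \<kappa> s" using C(2)[OF f s] by linarith
    then show ?thesis by (simp add: algebra_simps)
  qed
  then show ?thesis unfolding sublinearly_close_def by blast
qed

lemma corresponding_classes_close:
  assumes B: "B \<in> morse_boundary p \<kappa>" "\<zeta> \<in> B" and E: "E \<in> morse_boundary q \<kappa>" "\<eta> \<in> E"
    and corr: "corresponding_classes \<kappa> \<Phi> B E"
  shows "sublinearly_close \<kappa> (\<Phi> \<circ> \<zeta>) \<eta>"
proof -
  obtain \<zeta>' \<eta>' where r: "\<zeta>' \<in> B" "\<eta>' \<in> E" "sublinearly_close \<kappa> (\<Phi> \<circ> \<zeta>') \<eta>'"
    using corr by (auto simp: corresponding_classes_def)
  obtain A q1 Q1 where z: "scale_ray p \<kappa> A \<zeta>" by (rule X.morse_raysE[OF X.boundary_memberD(1)[OF B]])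
  obtain A' q2 Q2 where z': "scale_ray p \<kappa> A' \<zeta>'" by (rule X.morse_raysE[OF X.boundary_memberD(1)[OF B(1) r(1)]])
  obtain A'' q3 Q3 where e': "scale_ray q \<kappa> A'' \<eta>'" by (rule Y.morse_raysE[OF Y.boundary_memberD(1)[OF E(1) r(2)]])
  obtain A3 where Fz: "scale_ray q \<kappa> A3 (\<Phi> \<circ> \<zeta>)" by (rule forward_ray[OF z])
  have "sublinearly_close \<kappa> \<zeta> \<zeta>'" using X.boundary_member_iff[OF B(1) r(1)] B(2) by blast
  then have "sublinearly_close \<kappa> (\<Phi> \<circ> \<zeta>) \<eta>'" by (rule forward_close[OF z z' _ r(3)])
  moreover have "sublinearly_close \<kappa> \<eta>' \<eta>" using Y.boundary_member_iff[OF E] r(2) by blast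
  ultimately show ?thesis by (rule X.sublinearly_close_trans[OF Fz e'])
qed

text \<open>Straightening \<open>\<Phi> \<circ> \<zeta>\<close> gives an honest quasi-geodesic ray,
  and the robust Morse property passes to it from \<open>\<zeta>\<close>.\<close>

lemma corresponding_class_exists:
  assumes B: "B \<in> morse_boundary p \<kappa>"
  obtains E where "E \<in> morse_boundary q \<kappa>" "corresponding_classes \<kappa> \<Phi> B E"
proof -
  obtain \<zeta> where \<zeta>: "\<zeta> \<in> B" by (rule X.boundary_member_exists[OF B])
  obtain A q1 Q1 where z: "scale_ray p \<kappa> A \<zeta>" "robustly_morse p \<kappa> (ray_image \<zeta>)"
    by (rule X.morse_raysE[OF X.boundary_memberD(1)[OF B \<zeta>]])
  obtain A' where Fz: "scale_ray q \<kappa> A' (\<Phi> \<circ> \<zeta>)" by (rule forward_ray[OF z(1)])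
  obtain W C where S: "\<And>f. scale_ray q \<kappa> A' f \<Longrightarrow> \<exists>\<gamma>. tight_ray W q \<gamma> \<and> (\<forall>s\<ge>0. dist (\<gamma> s) (f s) \<le> C * \<kappa> s)"
    using X.straighten_ray[OF Y.geodesics_exist scale_rayD(1)[OF Fz]] by metis
  obtain \<gamma> where g: "tight_ray W q \<gamma>" "\<And>s. 0 \<le> s \<Longrightarrow> dist (\<gamma> s) (\<Phi> (\<zeta> s)) \<le> C * \<kappa> s"
    using S[OF Fz] by auto
  have close: "sublinearly_close \<kappa> (\<Phi> \<circ> \<zeta>) \<gamma>"
    using g(2) by (intro sublinearly_closeI[where M = C]) (auto simp: dist_commute)
  have "robustly_morse q \<kappa> (ray_image \<gamma>)"
    by (rule X.robustly_morse_scale_equivalence[OF equivalence z(1) X.tight_ray_scale_ray[OF g(1)] close z(2)])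
  then have m: "\<gamma> \<in> morse_rays q \<kappa>" by (rule Y.morse_raysI[OF tight_ray_quasi_geodesic[OF g(1)]])
  show ?thesis
  proof (rule that[OF Y.ray_class_in_boundary[OF m]])
    show "corresponding_classes \<kappa> \<Phi> B (ray_class q \<kappa> \<gamma>)"
      using \<zeta> Y.in_ray_class[OF m] close unfolding corresponding_classes_def by blast
  qed
qed

lemma corresponding_class_unique:
  assumes B: "B \<in> morse_boundary p \<kappa>" and E: "E \<in> morse_boundary q \<kappa>" and E': "E' \<in> morse_boundary q \<kappa>"
    and c: "corresponding_classes \<kappa> \<Phi> B E" "corresponding_classes \<kappa> \<Phi> B E'"
  shows "E = E'"
proof -
  obtain \<zeta> where \<zeta>: "\<zeta> \<in> B" by (rule X.boundary_member_exists[OF B])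
  obtain \<eta> where \<eta>: "\<eta> \<in> E" by (rule Y.boundary_member_exists[OF E])
  obtain \<eta>' where \<eta>': "\<eta>' \<in> E'" by (rule Y.boundary_member_exists[OF E'])
  obtain A q1 Q1 where z: "scale_ray p \<kappa> A \<zeta>" by (rule X.morse_raysE[OF X.boundary_memberD(1)[OF B \<zeta>]])
  obtain A' where Fz: "scale_ray q \<kappa> A' (\<Phi> \<circ> \<zeta>)" by (rule forward_ray[OF z])
  have em: "\<eta> \<in> morse_rays q \<kappa>" by (rule Y.boundary_memberD(1)[OF E \<eta>])
  obtain A'' q3 Q3 where e: "scale_ray q \<kappa> A'' \<eta>" by (rule Y.morse_raysE[OF em])
  have "sublinearly_close \<kappa> \<eta> (\<Phi> \<circ> \<zeta>)"
    by (rule X.sublinearly_close_sym[OF Fz e corresponding_classes_close[OF B \<zeta> E \<eta> c(1)]])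
  then have "sublinearly_close \<kappa> \<eta> \<eta>'"
    by (rule X.sublinearly_close_trans[OF e Fz _ corresponding_classes_close[OF B \<zeta> E' \<eta>' c(2)]])
  then have "\<eta> \<in> E'" using Y.boundary_member_iff[OF E' \<eta>'] em by blast
  then show ?thesis using Y.boundary_memberD(2)[OF E \<eta>] Y.boundary_memberD(2)[OF E'] by simp
qed

lemma corresponding_classes_inverse:
  assumes B: "B \<in> morse_boundary p \<kappa>" and E: "E \<in> morse_boundary q \<kappa>" and c: "corresponding_classes \<kappa> \<Phi> B E"
  shows "corresponding_classes \<kappa> \<Psi> E B"
proof -
  obtain \<zeta> \<eta> where r: "\<zeta> \<in> B" "\<eta> \<in> E" "sublinearly_close \<kappa> (\<Phi> \<circ> \<zeta>) \<eta>"
    using c by (auto simp: corresponding_classes_def)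
  obtain A q1 Q1 where z: "scale_ray p \<kappa> A \<zeta>" by (rule X.morse_raysE[OF X.boundary_memberD(1)[OF B r(1)]])
  obtain A'' q3 Q3 where e: "scale_ray q \<kappa> A'' \<eta>" by (rule Y.morse_raysE[OF Y.boundary_memberD(1)[OF E r(2)]])
  have "sublinearly_close \<kappa> (\<Psi> \<circ> \<eta>) \<zeta>" by (rule X.scale_equivalence_close_sym[OF equivalence z e r(3)])
  then show ?thesis using r unfolding corresponding_classes_def by blast
qed

definition boundary_map :: "(real \<Rightarrow> 'a) set \<Rightarrow> (real \<Rightarrow> 'b) set" where
  "boundary_map B = (THE E. E \<in> morse_boundary q \<kappa> \<and> corresponding_classes \<kappa> \<Phi> B E)"

lemma boundary_map:
  assumes B: "B \<in> morse_boundary p \<kappa>"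
  shows "boundary_map B \<in> morse_boundary q \<kappa>" "corresponding_classes \<kappa> \<Phi> B (boundary_map B)"
proof -
  obtain E where "E \<in> morse_boundary q \<kappa>" "corresponding_classes \<kappa> \<Phi> B E" by (rule corresponding_class_exists[OF B])
  then have "\<exists>!E. E \<in> morse_boundary q \<kappa> \<and> corresponding_classes \<kappa> \<Phi> B E"
    using corresponding_class_unique[OF B] by blast
  from theI'[OF this] show "boundary_map B \<in> morse_boundary q \<kappa>" "corresponding_classes \<kappa> \<Phi> B (boundary_map B)"
    unfolding boundary_map_def by auto
qed

text \<open>A test ray \<open>f\<close> of \<open>E'\<close> pulls back to the test ray
  \<open>\<Psi> \<circ> f\<close> of \<open>B'\<close>. Composition does not change times, so the
  time at which the pullback is linearly close to \<open>\<zeta>\<close> is one at which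
  \<open>f\<close> is linearly close to \<open>\<eta>\<close>.\<close>

lemma tracking_nbhd_forward:
  assumes B: "B \<in> morse_boundary p \<kappa>" "\<zeta> \<in> B" and E: "E \<in> morse_boundary q \<kappa>" "\<eta> \<in> E"
    and corr: "corresponding_classes \<kappa> \<Phi> B E" and A: "1 \<le> A" and \<epsilon>: "0 < \<epsilon>"
  obtains A' R' \<epsilon>' where "1 \<le> A'" "1 \<le> R'" "0 < \<epsilon>'"
    "\<And>B' E'. \<lbrakk>B' \<in> tracking_nbhd p \<kappa> \<zeta> A' R' \<epsilon>'; E' \<in> morse_boundary q \<kappa>; corresponding_classes \<kappa> \<Phi> B' E'\<rbrakk>
       \<Longrightarrow> E' \<in> tracking_nbhd q \<kappa> \<eta> A R \<epsilon>"
proof -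
  interpret inv: morse_space_equivalence \<kappa> q p K \<Psi> \<Phi> by (rule inverse_equivalence)
  obtain A1 q1 Q1 where z: "scale_ray p \<kappa> A1 \<zeta>" by (rule X.morse_raysE[OF X.boundary_memberD(1)[OF B]])
  obtain A' where A': "1 \<le> A'" "\<And>f. scale_ray q \<kappa> A f \<Longrightarrow> scale_ray p \<kappa> A' (\<Psi> \<circ> f)"
    using X.scale_map_ray[OF inv.forward_map A] by metis
  obtain C where C: "1 \<le> C" "\<And>f t. scale_ray q \<kappa> A f \<Longrightarrow> 0 \<le> t \<Longrightarrow>
       infdist (f t) (ray_image \<eta>) \<le> C * infdist (\<Psi> (f t)) (ray_image \<zeta>) + C * \<kappa> t"
    using X.scale_equivalence_infdist[OF equivalence z corresponding_classes_close[OF B E corr] A] by metis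
  obtain T where T: "1 \<le> T" "\<And>t. T \<le> t \<Longrightarrow> C * \<kappa> t + 0 \<le> (\<epsilon> / 2) * t"
    using X.scale_eventually_le[of "\<epsilon> / 2" C 0] \<epsilon> by auto
  define R' where "R' = max R T"
  have R': "R \<le> R'" "T \<le> R'" unfolding R'_def by simp_all
  show ?thesis
  proof (rule that[of A' R' "\<epsilon> / (2 * C)"])
    show "1 \<le> A'" "1 \<le> R'" "0 < \<epsilon> / (2 * C)" using A'(1) R' T(1) \<epsilon> C(1) by auto
    fix B' E' assume B': "B' \<in> tracking_nbhd p \<kappa> \<zeta> A' R' (\<epsilon> / (2 * C))" and E': "E' \<in> morse_boundary q \<kappa>"
      and c: "corresponding_classes \<kappa> \<Phi> B' E'"
    note B'b = tracking_nbhdD(1)[OF B']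
    obtain \<gamma> where g: "\<gamma> \<in> B'" by (rule X.boundary_member_exists[OF B'b])
    have "\<exists>t\<ge>R. infdist (f t) (ray_image \<eta>) \<le> \<epsilon> * t"
      if f: "scale_ray q \<kappa> A f" and a: "\<alpha> \<in> E'" "sublinearly_close \<kappa> f \<alpha>" for f \<alpha>
    proof -
      obtain A2 q2 Q2 where sa: "scale_ray q \<kappa> A2 \<alpha>" by (rule Y.morse_raysE[OF Y.boundary_memberD(1)[OF E' a(1)]])
      have "sublinearly_close \<kappa> (\<Psi> \<circ> \<alpha>) \<gamma>"
        by (rule inv.corresponding_classes_close[OF E' a(1) B'b g corresponding_classes_inverse[OF B'b E' c]])
      then have "sublinearly_close \<kappa> (\<Psi> \<circ> f) \<gamma>" by (rule inv.forward_close[OF f sa a(2)])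
      then obtain t where t: "R' \<le> t" "infdist (\<Psi> (f t)) (ray_image \<zeta>) \<le> \<epsilon> / (2 * C) * t"
        using tracking_nbhdD(2)[OF B' A'(2)[OF f] g] by auto
      have "C * infdist (\<Psi> (f t)) (ray_image \<zeta>) \<le> C * (\<epsilon> / (2 * C) * t)" using t C(1) by (intro mult_left_mono) auto
      also have "\<dots> = \<epsilon> / 2 * t" using C(1) by simp
      finally have "infdist (f t) (ray_image \<eta>) \<le> \<epsilon> * t" using C(2)[OF f, of t] T(1) T(2)[of t] t(1) R' by simp
      then show ?thesis using t(1) R'(1) by (intro exI[of _ t]) auto
    qed
    then show "E' \<in> tracking_nbhd q \<kappa> \<eta> A R \<epsilon>" using E' by (auto simp: tracking_nbhd_def)
  qed
qed

lemma continuous_boundary_map: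
  "continuous_map (boundary_topology p \<kappa>) (boundary_topology q \<kappa>) boundary_map"
  unfolding continuous_map_def X.topspace_boundary_topology Y.topspace_boundary_topology
proof (intro conjI allI impI)
  show "boundary_map \<in> morse_boundary p \<kappa> \<rightarrow> morse_boundary q \<kappa>" using boundary_map(1) by blast
  fix V assume "openin (boundary_topology q \<kappa>) V"
  then have V: "\<And>E. E \<in> V \<Longrightarrow> is_boundary_nbhd q \<kappa> E V" unfolding Y.openin_boundary_topology by blast
  let ?U = "{B \<in> morse_boundary p \<kappa>. boundary_map B \<in> V}"
  have "is_boundary_nbhd p \<kappa> B ?U" if "B \<in> ?U" for B
  proof -
    have B: "B \<in> morse_boundary p \<kappa>" and BV: "boundary_map B \<in> V" using that by auto
    note E = boundary_map[OF B]
    obtain \<zeta> where \<zeta>: "\<zeta> \<in> B" by (rule X.boundary_member_exists[OF B])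
    obtain \<eta> where \<eta>: "\<eta> \<in> boundary_map B" by (rule Y.boundary_member_exists[OF E(1)])
    obtain A R \<epsilon> where T: "1 \<le> A" "0 < \<epsilon>" "tracking_nbhd q \<kappa> \<eta> A R \<epsilon> \<subseteq> V"
      using V[OF BV, unfolded Y.is_boundary_nbhd_iff_tracking[OF E(1) \<eta>]] by blast
    obtain A' R' \<epsilon>' where T': "1 \<le> A'" "1 \<le> R'" "0 < \<epsilon>'"
      "\<And>B' E'. \<lbrakk>B' \<in> tracking_nbhd p \<kappa> \<zeta> A' R' \<epsilon>'; E' \<in> morse_boundary q \<kappa>; corresponding_classes \<kappa> \<Phi> B' E'\<rbrakk>
       \<Longrightarrow> E' \<in> tracking_nbhd q \<kappa> \<eta> A R \<epsilon>"
      by (rule tracking_nbhd_forward[OF B \<zeta> E(1) \<eta> E(2) T(1,2), of R]) blast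
    have "tracking_nbhd p \<kappa> \<zeta> A' R' \<epsilon>' \<subseteq> ?U"
    proof
      fix B' assume B': "B' \<in> tracking_nbhd p \<kappa> \<zeta> A' R' \<epsilon>'"
      note B'b = tracking_nbhdD(1)[OF B']
      show "B' \<in> ?U" using T'(4)[OF B' boundary_map[OF B'b]] T(3) B'b by blast
    qed
    then show ?thesis unfolding X.is_boundary_nbhd_iff_tracking[OF B \<zeta>] using T'(1-3) by blast
  qed
  then show "openin (boundary_topology p \<kappa>) ?U" unfolding X.openin_boundary_topology by blast
qed

text \<open>The inverse is the boundary map of the equivalence with \<open>\<Phi>\<close> and
  \<open>\<Psi>\<close> exchanged; both compositions are identities by uniqueness of corresponding
  classes.\<close>

lemma homeomorphic_boundary_map:
  "homeomorphic_map (boundary_topology p \<kappa>) (boundary_topology q \<kappa>) boundary_map"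
proof -
  interpret inv: morse_space_equivalence \<kappa> q p K \<Psi> \<Phi> by (rule inverse_equivalence)
  have 1: "inv.boundary_map (boundary_map B) = B" if B: "B \<in> morse_boundary p \<kappa>" for B
  proof -
    note E = boundary_map[OF B]
    show ?thesis
      by (rule inv.corresponding_class_unique[OF E(1) inv.boundary_map(1)[OF E(1)] B inv.boundary_map(2)[OF E(1)]
          corresponding_classes_inverse[OF B E]])
  qed
  have 2: "boundary_map (inv.boundary_map E) = E" if E: "E \<in> morse_boundary q \<kappa>" for E
  proof -
    note B = inv.boundary_map[OF E]
    show ?thesis
      by (rule corresponding_class_unique[OF B(1) boundary_map(1)[OF B(1)] E boundary_map(2)[OF B(1)]
          inv.corresponding_classes_inverse[OF E B]])
  qed
  have "homeomorphic_maps (boundary_topology p \<kappa>) (boundary_topology q \<kappa>) boundary_map inv.boundary_map"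
    unfolding homeomorphic_maps_def X.topspace_boundary_topology Y.topspace_boundary_topology
    using continuous_boundary_map inv.continuous_boundary_map 1 2 by blast
  then show ?thesis by (auto simp: homeomorphic_map_maps)
qed

text \<open>Closeness is known in terms of time along \<open>\<Phi> \<circ> \<zeta>\<close>, whereas
  \<open>nbhd\<close> measures it by norm; for the coarse ray \<open>\<Phi> \<circ> \<zeta>\<close>
  the two agree up to a constant.\<close>

lemma induced_by_boundary_map: "induced_by p q \<kappa> \<Phi> boundary_map"
  unfolding induced_by_def
proof
  fix \<zeta> assume \<zeta>: "\<zeta> \<in> morse_rays p \<kappa>"
  note B = X.ray_class_in_boundary[OF \<zeta>] and E = boundary_map[OF X.ray_class_in_boundary[OF \<zeta>]]
  obtain \<eta> where \<eta>: "\<eta> \<in> boundary_map (ray_class p \<kappa> \<zeta>)" "geodesic_ray q \<eta>" by (rule Y.boundary_geodesic[OF E(1)])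
  have "sublinearly_close \<kappa> (\<Phi> \<circ> \<zeta>) \<eta>" by (rule corresponding_classes_close[OF B X.in_ray_class[OF \<zeta>] E(1) \<eta>(1) E(2)])
  then obtain M where M: "\<And>s. 0 \<le> s \<Longrightarrow> infdist ((\<Phi> \<circ> \<zeta>) s) (ray_image \<eta>) \<le> M * \<kappa> s"
    unfolding sublinearly_close_def by blast
  obtain A q1 Q1 where z: "scale_ray p \<kappa> A \<zeta>" by (rule X.morse_raysE[OF \<zeta>])
  obtain A' where Fz: "scale_ray q \<kappa> A' (\<Phi> \<circ> \<zeta>)" by (rule forward_ray[OF z])
  obtain C0 where C0: "1 \<le> C0" "\<And>s. 0 \<le> s \<Longrightarrow> \<kappa> s \<le> C0 * \<kappa> (dist ((\<Phi> \<circ> \<zeta>) s) q)"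
    using X.scale_ray_norm[OF scale_rayD(1)[OF Fz]] Fz by metis
  \<comment> \<open>The summand 1 keeps \<open>m\<close> positive even if \<open>M\<close> is
    0.\<close>
  define m where "m = \<bar>M\<bar> * C0 + 1"
  have m: "0 < m" using C0(1) by (simp add: m_def add_nonneg_pos)
  have "(\<Phi> \<circ> \<zeta>) ` {0..} \<subseteq> nbhd q \<kappa> (ray_image \<eta>) m"
  proof
    fix x assume "x \<in> (\<Phi> \<circ> \<zeta>) ` {0..}"
    then obtain s where s: "0 \<le> s" "x = (\<Phi> \<circ> \<zeta>) s" by auto
    have k: "0 < \<kappa> (dist x q)" by (rule X.scale_pos) simp
    have "infdist x (ray_image \<eta>) \<le> M * \<kappa> s" using M[OF s(1)] s(2) by simp
    also have "\<dots> \<le> \<bar>M\<bar> * \<kappa> s" using X.scale_pos[OF s(1)] by (intro mult_right_mono) auto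
    also have "\<dots> \<le> \<bar>M\<bar> * (C0 * \<kappa> (dist x q))" using C0(2)[OF s(1)] s(2) by (intro mult_left_mono) auto
    also have "\<dots> \<le> m * \<kappa> (dist x q)" using k by (simp add: m_def algebra_simps)
    finally show "x \<in> nbhd q \<kappa> (ray_image \<eta>) m" by (simp add: nbhd_def)
  qed
  then show "\<exists>\<eta>\<in>morse_rays q \<kappa>. geodesic_ray q \<eta> \<and> (\<exists>m>0. (\<Phi> \<circ> \<zeta>) ` {0..} \<subseteq> nbhd q \<kappa> (ray_image \<eta>) m) \<and>
      boundary_map (ray_class p \<kappa> \<zeta>) = ray_class q \<kappa> \<eta>"
    using Y.boundary_memberD[OF E(1) \<eta>(1)] \<eta>(2) m by blast
qed

end

theorem theoremA:
  fixes p\<^sub>X :: "'a::metric_space" and p\<^sub>Y :: "'b::metric_space"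
    and L :: real and \<theta> \<kappa> :: "real \<Rightarrow> real" and \<Phi> :: "'a \<Rightarrow> 'b"
  assumes "L \<ge> 1"
    and "strictly_sublinear \<theta>"
    and "proper_geodesic_space TYPE('a)"
    and "proper_geodesic_space TYPE('b)"
    and "sublinear_biLipschitz_equivalence p\<^sub>X p\<^sub>Y L \<theta> \<Phi>"
    and "strictly_sublinear \<kappa>"
    and "dominates \<kappa> \<theta>"
  shows "\<exists>\<Phi>\<^sub>s. homeomorphic_map (boundary_topology p\<^sub>X \<kappa>) (boundary_topology p\<^sub>Y \<kappa>) \<Phi>\<^sub>s \<and>
              induced_by p\<^sub>X p\<^sub>Y \<kappa> \<Phi> \<Phi>\<^sub>s"
proof -
  interpret sublinear_scale \<kappa> by unfold_locales (rule assms(6))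
  obtain K \<Psi> where eq: "scale_equivalence p\<^sub>X p\<^sub>Y \<kappa> K \<Phi> \<Psi>"
    by (rule biLipschitz_scale_equivalence[OF assms(1,2,7,5)])
  interpret morse_space_equivalence \<kappa> p\<^sub>X p\<^sub>Y K \<Phi> \<Psi>
    by unfold_locales (rule assms(3), rule assms(4), rule eq)
  show ?thesis using homeomorphic_boundary_map induced_by_boundary_map by blast
qed

end
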